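(* Let $\alpha,\lambda,\mu>0$ be constants and let $\frac1M\ge 0$ and $K^{\mathcal D}\ge 0$; for each fracture $F^j$, $j=1,\dots,N_F$, let $\eta^j>0$ be a constant and let $K^{F^j}\ge 0$. Let $K_{dr}=\lambda+\frac23\mu$ and let $\Delta t>0$ be the time step. Fix a time index $k\ge 1$. Let $p^{k}\in V_h^{f,\mathcal D}$, $\mathbf u^{k}\in \mathbf V_h^m$, $p^{F^j,k}\in V_h^{f,F^j}$, $\boldsymbol\Lambda^{j,k}\in\mathbf Q_h^{m,j}$ ($j=1,\dots,N_F$) be the solution of the fully discrete coupled problem (BE) at time step $k$, and, for $i\ge 1$, let $p^{k,i}$, $\mathbf u^{k,i}$, $p^{F^j,k,i}$, $\boldsymbol\Lambda^{j,k,i}$ be the $i$-th iterate of the fixed-stress splitting scheme (FS), started from the solution at the previous time step; both (BE) and (FS) are written out in the context. Define the errors $$e_p^{i}=p^{k,i}-p^{k},\quad e_{F^j}^{i}=p^{F^j,k,i}-p^{F^j,k},\quad e_{\mathbf u}^{i}=\mathbf u^{k,i}-\mathbf u^{k},\quad e_{\boldsymbol\Lambda^j}^{i}=\boldsymbol\Lambda^{j,k,i}-\boldsymbol\Lambda^{j,k}.$$ Let $\delta_F$ be given with $0<\delta_F\le 2$. Then, for every $i\ge 1$, $$2\mu\,\|\boldsymbol\epsilon(e_{\mathbf u}^{i})\|_{0,\mathring{\mathcal D}}^2+\lambda\,\|\nabla\cdot e_{\mathbf u}^{i}\|_{0,\mathring{\mathcal D}}^2\le \frac{\alpha^2}{K_{dr}}\,\|e_p^{i}\|_{0,\mathring{\mathcal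 D}}^2,$$ $$K^{F^j}\|\nabla e_{F^j}^{i}\|_{0,F^j}^2+2\eta^j\|e_{F^j}^{i}\|_{0,F^j}^2\le \frac{\eta^j}{\delta_F}\int_{F^j}\Big(\big[(e_p^{i})^j_+\big]^2+\big[(e_p^{i})^j_-\big]^2\Big)\qquad\forall j=1,\dots,N_F,$$ $$\Big(\frac1M+\frac{\alpha^2}{2K_{dr}}+\frac{\Delta t\,K^{\mathcal D}}{C_P}\Big)\|e_p^{i}\|_{0,\mathring{\mathcal D}}^2\le \frac{\alpha^2}{2K_{dr}}\,\|e_p^{i-1}\|_{0,\mathring{\mathcal D}}^2,$$ where $C_P$ is the Poincaré constant defined in the context. These estimates provide the convergence of the fixed-stress splitting scheme as $i\to\infty$.
   Context: **Geometry.** $\mathcal D\subset\mathbb R^3$ is a bounded (polyhedral) domain crossed by non-intersecting planar polygonal fractures $F^1,\dots,F^{N_F}$, and $\mathring{\mathcal D}=\mathcal D\setminus\bigcup_j F^j$. For $s=m$ (mechanics) and $s=f$ (flow), $\partial\mathcal D=\Gamma^s_D\cup\Gamma^s_N$ with $\Gamma^s_D\cap\Gamma^s_N=\emptyset$; and $\partial F^j=\gamma^j_D\cup\gamma^j_N$ with $\gamma_D^j\cap\gamma_N^j=\emptyset$ (Dirichlet and Neumann parts). $\mathbf n^j$ is a fixed unit normal to $F^j$. The part of $\partial\mathring{\mathcal D}$ lying on $F^j$ has two sides; the $+$ side is the one whose unit normal pointing outward from $\mathring{\mathcal D}$ is $\mathbf n^j$, the $-$ side the one whose outward unit normal is $-\mathbf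 n^j$. For a function $v$ on $\mathring{\mathcal D}$, $v^j_\pm$ denote its traces on $F^j$ from the $\pm$ side. $\|\cdot\|_{0,\omega}$ is the $L^2(\omega)$ norm (of scalar, vector or tensor fields). On $F^j$, $\nabla$ is the tangential gradient. Since functions may jump across fractures, all derivatives of functions on $\mathring{\mathcal D}$ are taken in $\mathring{\mathcal D}$. **Elasticity.** $\boldsymbol\epsilon(\mathbf u)=\frac12(\nabla\mathbf u+\nabla\mathbf u^{\top})$ and $\mathbf C\boldsymbol\epsilon=\lambda\,\mathrm{tr}(\boldsymbol\epsilon)\mathbf I+2\mu\boldsymbol\epsilon$, with $\lambda,\mu$ the Lamé coefficients. **Discrete spaces.** $\mathcal T^{\mathcal D}$ is a tetrahedral mesh of $\mathcal D$ (not required to conform to the fractures) and $\mathcal T^{F^j}$ a triangular mesh of $F^j$. - $V_h^{f,\mathcal D}$ is the extended finite element (XFEM) space spanned by the continuous piecewise linear functions on $\mathcal T^{\mathcal D}$ vanishing on $\Gamma^f_D$, together with the enrichment functions, for each $j$: $\phi_k(\mathbf x)\big(\mathcal H^j(\mathbf x)\mathcal E^j(\mathbf x)-\mathcal H^j(\mathbf x_k)\mathcal E^j(\mathbf x_k)\big)$ for all mesh vertices $\mathbf x_k$ of $\mathcal T^{\mathcal D}_{\mathcal E^j}$ not on $\Gamma_D^f$, and $\phi_k(\mathbf x)\big(\mathcal H^j(\mathbf x)-\mathcal H^j(\mathbf x_k)\big)$ for all vertices $\mathbf x_k$ of $\mathcal T^{\mathcal D}_{\mathcal H^j}$ that are neither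 vertices of $\mathcal T^{\mathcal D}_{\mathcal E^j}$ nor on $\Gamma^f_D$. Here $\phi_k$ is the Lagrangian piecewise linear hat function of vertex $\mathbf x_k$; $\mathcal H^j(\mathbf x)=\mathrm{sign}(\mathbf n^j\cdot(\mathbf x-\mathbf x_0))$ with $\mathbf x_0\in F^j$ fixed; $\mathcal T^{\mathcal D}_{\mathcal H^j}$ is the set of elements entirely cut by $F^j$; $\mathcal T^{\mathcal D}_{\mathcal E^j}$ is the set of elements lying in $\mathcal D\setminus\partial\mathcal D$ that intersect $\partial F^j$; and $\mathcal E^j(\mathbf x)=\zeta\prod_{r}\big(\varepsilon^j_r(\mathcal B_{F^j}(\mathbf x))\big)^{p}$ if $\mathcal B_{F^j}(\mathbf x)\in F^j$, and $0$ otherwise, where $\mathcal B_{F^j}$ is the affine map from the reference system of $\mathcal D$ to the local reference system of $F^j$, $\varepsilon^j_r$ are the linear functions whose zero sets are the lines containing the edges of $F^j$ interior to $\mathcal D$, $\zeta$ is a scaling making $\mathcal E^j=1$ at the barycenter of $F^j$, and $p$ is a fixed exponent controlling the shape ($\mathcal E^j$ is the constant $1$ if $F^j$ entirely crosses the domain). - $\mathbf V_h^m$ is the space of vector fields with three components, each in the XFEM space built in the same way with $\Gamma^m_D$ in place of $\Gamma^f_D$. - $V_h^{f,F^j}$ is the space of continuous piecewise linear functions on $\mathcal T^{F^j}$ vanishing on $\gamma_D^j$; $\mathbf Q_h^{m,j}$ is the space of continuous piecewise linear vector fields (three components, no boundary condition) on $\mathcal T^{F^j}$. **Poincaré constant.**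 $C_P>0$ is a constant such that $\|q\|_{0,\mathring{\mathcal D}}^2\le C_P\|\nabla q\|_{0,\mathring{\mathcal D}}^2$ for all $q\in V_h^{f,\mathcal D}$. **Data.** $g$ is a given source term. The values $\mathbf u^{k-1}\in\mathbf V_h^m$ and $p^{k-1}\in V_h^{f,\mathcal D}$ (and $p^{F^j,k-1}\in V_h^{f,F^j}$) are the given solution at the previous time step; all initial values (time index $0$) are zero. **Fully discrete coupled problem (BE).** Find $\mathbf u^k\in\mathbf V_h^m$, $p^k\in V_h^{f,\mathcal D}$ and, for each $j$, $p^{F^j,k}\in V_h^{f,F^j}$, $\boldsymbol\Lambda^{j,k}\in\mathbf Q_h^{m,j}$ such that for all $q\in V_h^{f,\mathcal D}$, all $q^{F^j}\in V_h^{f,F^j}$, all $\mathbf v\in\mathbf V_h^m$, all $\boldsymbol\tau^j\in\mathbf Q_h^{m,j}$ and all $j$: $$\frac1{\Delta t}\int_{\mathring{\mathcal D}}\Big(\frac1M p^k+\alpha\nabla\cdot\mathbf u^k\Big)q+\int_{\mathring{\mathcal D}}K^{\mathcal D}\nabla p^k\cdot\nabla q+\sum_{j}\int_{F^j}\eta^j\big((p^k)^j_+q^j_++(p^k)^j_-q^j_-\big)-\sum_j\int_{F^j}\eta^jp^{F^j,k}(q^j_++q^j_-)=\frac1{\Delta t}\int_{\mathring{\mathcal D}}\Big(\frac1Mp^{k-1}+\alpha\nabla\cdot\mathbf u^{k-1}\Big)q+\int_{\mathring{\mathcal D}}g\,q,$$ $$\int_{F^j}K^{F^j}\nabla p^{F^j,k}\cdot\nabla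 q^{F^j}+\int_{F^j}2\eta^jp^{F^j,k}q^{F^j}-\int_{F^j}\eta^j\big((p^k)^j_++(p^k)^j_-\big)q^{F^j}=0,$$ $$-\int_{\mathring{\mathcal D}}\alpha p^k\,\nabla\cdot\mathbf v+\int_{\mathring{\mathcal D}}\mathbf C\boldsymbol\epsilon(\mathbf u^k):\boldsymbol\epsilon(\mathbf v)+\sum_j\int_{F^j}\big(\boldsymbol\Lambda^{j,k}-\alpha p^{F^j,k}\mathbf n^j\big)\cdot(\mathbf v^j_--\mathbf v^j_+)=0,$$ $$\int_{F^j}\big((\mathbf u^k)^j_--(\mathbf u^k)^j_+\big)\cdot\boldsymbol\tau^j=0.$$ **Fixed-stress scheme (FS).** Set $\mathbf u^{k,0}=\mathbf u^{k-1}$, $p^{k,0}=p^{k-1}$, $p^{F^j,k,0}=p^{F^j,k-1}$. For $i\ge1$, given the iterate $i-1$, first find $p^{k,i}\in V_h^{f,\mathcal D}$ and $p^{F^j,k,i}\in V_h^{f,F^j}$ for each $j$ such that for all $q\in V_h^{f,\mathcal D}$, all $q^{F^j}\in V_h^{f,F^j}$ and all $j$: $$\frac1{\Delta t}\int_{\mathring{\mathcal D}}\Big(\frac1M+\frac{\alpha^2}{K_{dr}}\Big)p^{k,i}q+\int_{\mathring{\mathcal D}}K^{\mathcal D}\nabla p^{k,i}\cdot\nabla q+\sum_j\int_{F^j}\eta^j\big((p^{k,i})^j_+q^j_++(p^{k,i})^j_-q^j_-\big)-\sum_j\int_{F^j}\eta^jp^{F^j,k,i}(q^j_++q^j_-)$$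 $$=\frac1{\Delta t}\int_{\mathring{\mathcal D}}\Big(\frac1Mp^{k-1}+\alpha\nabla\cdot\mathbf u^{k-1}\Big)q+\int_{\mathring{\mathcal D}}g\,q-\frac1{\Delta t}\int_{\mathring{\mathcal D}}\alpha\,\nabla\cdot\mathbf u^{k,i-1}\,q+\frac1{\Delta t}\int_{\mathring{\mathcal D}}\frac{\alpha^2}{K_{dr}}p^{k,i-1}q,$$ $$\int_{F^j}K^{F^j}\nabla p^{F^j,k,i}\cdot\nabla q^{F^j}+\int_{F^j}2\eta^jp^{F^j,k,i}q^{F^j}-\int_{F^j}\eta^j\big((p^{k,i})^j_++(p^{k,i})^j_-\big)q^{F^j}=0;$$ then find $\mathbf u^{k,i}\in\mathbf V_h^m$ and $\boldsymbol\Lambda^{j,k,i}\in\mathbf Q_h^{m,j}$ for each $j$ such that for all $\mathbf v\in\mathbf V_h^m$, all $\boldsymbol\tau^j\in\mathbf Q_h^{m,j}$ and all $j$: $$\int_{\mathring{\mathcal D}}\mathbf C\boldsymbol\epsilon(\mathbf u^{k,i}):\boldsymbol\epsilon(\mathbf v)+\sum_j\int_{F^j}\boldsymbol\Lambda^{j,k,i}\cdot(\mathbf v^j_--\mathbf v^j_+)=\int_{\mathring{\mathcal D}}\alpha p^{k,i}\,\nabla\cdot\mathbf v+\sum_j\int_{F^j}\alpha p^{F^j,k,i}\mathbf n^j\cdot(\mathbf v^j_--\mathbf v^j_+),$$ $$\int_{F^j}\big((\mathbf u^{k,i})^j_--(\mathbf u^{k,i})^j_+\big)\cdot\boldsymbol\tau^j=0.$$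 **Convergence.** Convergence of the scheme means that the iterates' errors controlled by the stated estimates, namely $\|e_p^i\|_{0,\mathring{\mathcal D}}$, $\|\boldsymbol\epsilon(e_{\mathbf u}^i)\|_{0,\mathring{\mathcal D}}$, $\|\nabla\cdot e_{\mathbf u}^i\|_{0,\mathring{\mathcal D}}$ and $\|e_{F^j}^i\|_{0,F^j}$, tend to $0$ as $i\to\infty$.
   Formalization: Proved for 0<δ_F≤1, since the second estimate can fail for 1<δ_F≤2; convergence is proved if 1/M>0, or K^D>0, or the pressure p^k of the (BE) solution is unique, since it can fail when 1/M=K^D=0 and p^k is not unique. *)

theory Defs
  imports "HOL-Analysis.Analysis"
begin

type_synonym R3 = "real^3"

section \<open>Fractured domain, meshes\<close>

text \<open>Fractures are indexed by \<open>1..n_frac\<close>. The fracture \<open>frac j\<close> is the closed planar region bounded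
  by the closed polygon with corners \<open>corner j\<close>; it lies in the plane through \<open>origin j\<close> with unit
  normal \<open>nrm j\<close>, and \<open>(tang1 j, tang2 j)\<close> completes the normal to an orthonormal frame, which gives
  the local reference system of the fracture. Mesh elements are closed simplices.\<close>

record fractured_domain =
  region :: "R3 set"
  n_frac :: nat
  frac :: "nat \<Rightarrow> R3 set"
  corner :: "nat \<Rightarrow> R3 list"
  origin :: "nat \<Rightarrow> R3"
  nrm :: "nat \<Rightarrow> R3"
  tang1 :: "nat \<Rightarrow> R3"
  tang2 :: "nat \<Rightarrow> R3"
  GammaD_f :: "R3 set"
  GammaN_f :: "R3 set"
  GammaD_m :: "R3 set"
  GammaN_m :: "R3 set"
  gammaD :: "nat \<Rightarrow> R3 set"
  gammaN :: "nat \<Rightarrow> R3 set"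
  tets :: "R3 set set"
  tris :: "nat \<Rightarrow> R3 set set"
  tip_exp :: real

abbreviation fractures :: "fractured_domain \<Rightarrow> nat set" where
  "fractures G \<equiv> {1..n_frac G}"

definition cut_region :: "fractured_domain \<Rightarrow> R3 set" where
  "cut_region G = region G - (\<Union>j\<in>fractures G. frac G j)"

definition frac_plane :: "fractured_domain \<Rightarrow> nat \<Rightarrow> R3 set" where
  "frac_plane G j = {x. nrm G j \<bullet> (x - origin G j) = 0}"

definition chart :: "fractured_domain \<Rightarrow> nat \<Rightarrow> real^2 \<Rightarrow> R3" where
  "chart G j \<xi> = origin G j + (\<xi>$1) *\<^sub>R tang1 G j + (\<xi>$2) *\<^sub>R tang2 G j"

definition local_coords :: "fractured_domain \<Rightarrow> nat \<Rightarrow> R3 \<Rightarrow> real^2" where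
  "local_coords G j x = vector [(x - origin G j) \<bullet> tang1 G j, (x - origin G j) \<bullet> tang2 G j]"

definition edge_start :: "R3 list \<Rightarrow> nat \<Rightarrow> R3" where
  "edge_start ws r = ws ! r"

definition edge_end :: "R3 list \<Rightarrow> nat \<Rightarrow> R3" where
  "edge_end ws r = ws ! (Suc r mod length ws)"

definition edge :: "R3 list \<Rightarrow> nat \<Rightarrow> R3 set" where
  "edge ws r = closed_segment (edge_start ws r) (edge_end ws r)"

definition simple_polygon :: "R3 list \<Rightarrow> bool" where
  "simple_polygon ws \<longleftrightarrow> 3 \<le> length ws \<and> distinct ws \<and>
     (\<forall>r<length ws. \<forall>s<length ws. r \<noteq> s \<longrightarrow>
        open_segment (edge_start ws r) (edge_end ws r) \<inter> edge ws s = {})"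

definition polygonal_region :: "R3 set \<Rightarrow> R3 list \<Rightarrow> bool" where
  "polygonal_region F ws \<longleftrightarrow> simple_polygon ws \<and> compact F \<and> rel_interior F \<noteq> {} \<and>
     rel_frontier F = (\<Union>r<length ws. edge ws r)"

definition mesh_vertices :: "R3 set set \<Rightarrow> R3 set" where
  "mesh_vertices T = {x. \<exists>K\<in>T. x extreme_point_of K}"


section \<open>Integrals, norms and derivatives\<close>

definition vol_int :: "fractured_domain \<Rightarrow> (R3 \<Rightarrow> real) \<Rightarrow> real" where
  "vol_int G f = (LINT x:cut_region G|lebesgue. f x)"

text \<open>Since the frame is orthonormal, the chart is an isometry onto the plane of the fracture, so
  the area integral is the planar Lebesgue integral in local coordinates.\<close>

definition surf_int ::
  "fractured_domain \<Rightarrow> nat \<Rightarrow> (R3 \<Rightarrow> 'b::{banach,second_countable_topology}) \<Rightarrow> 'b" where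
  "surf_int G j f = (LINT \<xi>:{\<xi>. chart G j \<xi> \<in> frac G j}|lebesgue. f (chart G j \<xi>))"

definition vol_norm :: "fractured_domain \<Rightarrow> (R3 \<Rightarrow> 'b::real_normed_vector) \<Rightarrow> real" where
  "vol_norm G f = sqrt (vol_int G (\<lambda>x. (norm (f x))\<^sup>2))"

definition surf_norm :: "fractured_domain \<Rightarrow> nat \<Rightarrow> (R3 \<Rightarrow> 'b::real_normed_vector) \<Rightarrow> real" where
  "surf_norm G j f = sqrt (surf_int G j (\<lambda>x. (norm (f x))\<^sup>2))"

definition grad :: "(R3 \<Rightarrow> real) \<Rightarrow> R3 \<Rightarrow> R3" where
  "grad q x = (THE D. GDERIV q x :> D)"

definition tan_grad :: "fractured_domain \<Rightarrow> nat \<Rightarrow> (R3 \<Rightarrow> real) \<Rightarrow> R3 \<Rightarrow> R3" where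
  "tan_grad G j q x = (THE D. D \<bullet> nrm G j = 0 \<and>
     (q has_derivative (\<lambda>h. h \<bullet> D)) (at x within frac_plane G j))"

definition divergence :: "(R3 \<Rightarrow> R3) \<Rightarrow> R3 \<Rightarrow> real" where
  "divergence u x = trace (jacobian u (at x))"

definition strain :: "(R3 \<Rightarrow> R3) \<Rightarrow> R3 \<Rightarrow> real^3^3" where
  "strain u x = (1/2) *\<^sub>R (jacobian u (at x) + transpose (jacobian u (at x)))"

definition elasticity :: "real \<Rightarrow> real \<Rightarrow> real^3^3 \<Rightarrow> real^3^3" where
  "elasticity lam mu E = (lam * trace E) *\<^sub>R mat 1 + (2 * mu) *\<^sub>R E"

text \<open>One-sided traces on \<open>frac j\<close>. The outward normal of the cut region is \<open>nrm j\<close> on the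
  \<open>+\<close> side, so the \<open>+\<close> side is approached from points lying below the plane with respect
  to \<open>nrm j\<close>.\<close>

definition trace_pos :: "fractured_domain \<Rightarrow> nat \<Rightarrow> (R3 \<Rightarrow> 'b::t2_space) \<Rightarrow> R3 \<Rightarrow> 'b" where
  "trace_pos G j v x = Lim (at x within {y \<in> cut_region G. nrm G j \<bullet> (y - x) < 0}) v"

definition trace_neg :: "fractured_domain \<Rightarrow> nat \<Rightarrow> (R3 \<Rightarrow> 'b::t2_space) \<Rightarrow> R3 \<Rightarrow> 'b" where
  "trace_neg G j v x = Lim (at x within {y \<in> cut_region G. nrm G j \<bullet> (y - x) > 0}) v"


section \<open>Discrete spaces\<close>

text \<open>Functions in the discrete spaces are made canonical by extending them by zero off the mesh.\<close>

definition P1 :: "R3 set set \<Rightarrow> (R3 \<Rightarrow> real) set" where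
  "P1 T = {q. continuous_on (\<Union>T) q \<and> (\<forall>K\<in>T. \<exists>a b. \<forall>x\<in>K. q x = a \<bullet> x + b) \<and>
              (\<forall>x. x \<notin> \<Union>T \<longrightarrow> q x = 0)}"

definition is_hat :: "R3 set set \<Rightarrow> R3 \<Rightarrow> (R3 \<Rightarrow> real) \<Rightarrow> bool" where
  "is_hat T v \<phi> \<longleftrightarrow> \<phi> \<in> P1 T \<and> (\<forall>w\<in>mesh_vertices T. \<phi> w = (if w = v then 1 else 0))"

definition fun_span :: "(R3 \<Rightarrow> real) set \<Rightarrow> (R3 \<Rightarrow> real) set" where
  "fun_span B = {\<lambda>x. \<Sum>b\<in>S. c b * b x | S c. finite S \<and> S \<subseteq> B}"

definition heavi :: "fractured_domain \<Rightarrow> nat \<Rightarrow> R3 \<Rightarrow> real" where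
  "heavi G j x = sgn (nrm G j \<bullet> (x - origin G j))"

definition tets_H :: "fractured_domain \<Rightarrow> nat \<Rightarrow> R3 set set" where
  "tets_H G j = {K \<in> tets G. frac_plane G j \<inter> interior K \<noteq> {} \<and> frac_plane G j \<inter> K \<subseteq> frac G j}"

definition tets_E :: "fractured_domain \<Rightarrow> nat \<Rightarrow> R3 set set" where
  "tets_E G j = {K \<in> tets G. K \<subseteq> region G - frontier (region G) \<and> K \<inter> rel_frontier (frac G j) \<noteq> {}}"

definition interior_edges :: "fractured_domain \<Rightarrow> nat \<Rightarrow> nat set" where
  "interior_edges G j = {r. r < length (corner G j) \<and>
     open_segment (edge_start (corner G j) r) (edge_end (corner G j) r) \<subseteq> region G}"

text \<open>The affine function vanishing on the line through the \<open>r\<close>-th edge is determined up to a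
  nonzero factor, which cancels against the scaling in \<open>tip_fun\<close>.\<close>

definition edge_fun :: "fractured_domain \<Rightarrow> nat \<Rightarrow> nat \<Rightarrow> real^2 \<Rightarrow> real" where
  "edge_fun G j r \<xi> =
     (let a = local_coords G j (edge_start (corner G j) r);
          b = local_coords G j (edge_end (corner G j) r)
      in (b$1 - a$1) * (\<xi>$2 - a$2) - (b$2 - a$2) * (\<xi>$1 - a$1))"

text \<open>The exponent is any positive real. The absolute value for non-integer exponents amounts to
  choosing the sign of \<open>edge_fun\<close> so that it is nonnegative on the (convex) fracture.\<close>

definition tip_pow :: "real \<Rightarrow> real \<Rightarrow> real" where
  "tip_pow p t = (if p \<in> \<nat> then t ^ nat \<lfloor>p\<rfloor> else \<bar>t\<bar> powr p)"

definition barycenter :: "fractured_domain \<Rightarrow> nat \<Rightarrow> R3" where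
  "barycenter G j = (1 / surf_int G j (\<lambda>_. 1)) *\<^sub>R surf_int G j (\<lambda>x. x)"

definition tip_scale :: "fractured_domain \<Rightarrow> nat \<Rightarrow> real" where
  "tip_scale G j = 1 / (\<Prod>r\<in>interior_edges G j.
     tip_pow (tip_exp G) (edge_fun G j r (local_coords G j (barycenter G j))))"

text \<open>A fracture without edges in the interior of the domain entirely crosses it. The condition
  that the local coordinates of \<open>x\<close> lie in the fracture is expressed through the orthogonal
  projection \<open>chart \<circ> local_coords\<close> onto the fracture plane.\<close>

definition tip_fun :: "fractured_domain \<Rightarrow> nat \<Rightarrow> R3 \<Rightarrow> real" where
  "tip_fun G j x =
     (if interior_edges G j = {} then 1
      else if chart G j (local_coords G j x) \<in> frac G j
      then tip_scale G j *
           (\<Prod>r\<in>interior_edges G j. tip_pow (tip_exp G) (edge_fun G j r (local_coords G j x)))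
      else 0)"

definition enrichments :: "fractured_domain \<Rightarrow> R3 set \<Rightarrow> (R3 \<Rightarrow> real) set" where
  "enrichments G GD =
     {\<lambda>x. \<phi> x * (heavi G j x * tip_fun G j x - heavi G j v * tip_fun G j v) | \<phi> j v.
        j \<in> fractures G \<and> v \<in> mesh_vertices (tets_E G j) \<and> v \<notin> GD \<and> is_hat (tets G) v \<phi>} \<union>
     {\<lambda>x. \<phi> x * (heavi G j x - heavi G j v) | \<phi> j v.
        j \<in> fractures G \<and> v \<in> mesh_vertices (tets_H G j) \<and> v \<notin> mesh_vertices (tets_E G j) \<and>
        v \<notin> GD \<and> is_hat (tets G) v \<phi>}"

definition xfem :: "fractured_domain \<Rightarrow> R3 set \<Rightarrow> (R3 \<Rightarrow> real) set" where
  "xfem G GD = fun_span ({q \<in> P1 (tets G). \<forall>x\<in>GD. q x = 0} \<union> enrichments G GD)"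

definition V_f :: "fractured_domain \<Rightarrow> (R3 \<Rightarrow> real) set" where
  "V_f G = xfem G (GammaD_f G)"

definition V_m :: "fractured_domain \<Rightarrow> (R3 \<Rightarrow> R3) set" where
  "V_m G = {v. \<forall>i. (\<lambda>x. v x $ i) \<in> xfem G (GammaD_m G)}"

definition V_F :: "fractured_domain \<Rightarrow> nat \<Rightarrow> (R3 \<Rightarrow> real) set" where
  "V_F G j = {q \<in> P1 (tris G j). \<forall>x\<in>gammaD G j. q x = 0}"

definition Q_m :: "fractured_domain \<Rightarrow> nat \<Rightarrow> (R3 \<Rightarrow> R3) set" where
  "Q_m G j = {t. \<forall>i. (\<lambda>x. t x $ i) \<in> P1 (tris G j)}"

text \<open>The last clause ensures that the crack-tip enrichments have finite energy, as the discrete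
  problems require; it holds automatically when the exponent is at least 1.\<close>

definition admissible :: "fractured_domain \<Rightarrow> bool" where
  "admissible G \<longleftrightarrow>
     open (region G) \<and> connected (region G) \<and> bounded (region G) \<and> region G \<noteq> {} \<and>
     triangulation (tets G) \<and> (\<forall>K\<in>tets G. 3 simplex K) \<and> \<Union>(tets G) = closure (region G) \<and>
     GammaD_f G \<union> GammaN_f G = frontier (region G) \<and> GammaD_f G \<inter> GammaN_f G = {} \<and>
     GammaD_m G \<union> GammaN_m G = frontier (region G) \<and> GammaD_m G \<inter> GammaN_m G = {} \<and>
     (\<forall>j\<in>fractures G.
        norm (nrm G j) = 1 \<and> norm (tang1 G j) = 1 \<and> norm (tang2 G j) = 1 \<and>
        nrm G j \<bullet> tang1 G j = 0 \<and> nrm G j \<bullet> tang2 G j = 0 \<and> tang1 G j \<bullet> tang2 G j = 0 \<and>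
        polygonal_region (frac G j) (corner G j) \<and>
        origin G j \<in> frac G j \<and> frac G j \<subseteq> frac_plane G j \<and>
        rel_interior (frac G j) \<subseteq> region G \<and>
        gammaD G j \<union> gammaN G j = rel_frontier (frac G j) \<and> gammaD G j \<inter> gammaN G j = {} \<and>
        triangulation (tris G j) \<and> (\<forall>K\<in>tris G j. 2 simplex K) \<and> \<Union>(tris G j) = frac G j) \<and>
     (\<forall>i\<in>fractures G. \<forall>j\<in>fractures G. i \<noteq> j \<longrightarrow> frac G i \<inter> frac G j = {}) \<and>
     tip_exp G > 0 \<and>
     (\<forall>j\<in>fractures G.
        set_borel_measurable lebesgue (cut_region G) (grad (tip_fun G j)) \<and>
        set_integrable lebesgue (cut_region G) (\<lambda>x. (norm (grad (tip_fun G j) x))\<^sup>2))"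

definition poincare_constant :: "fractured_domain \<Rightarrow> real \<Rightarrow> bool" where
  "poincare_constant G CP \<longleftrightarrow> CP > 0 \<and>
     (\<forall>q\<in>V_f G. (vol_norm G q)\<^sup>2 \<le> CP * (vol_norm G (grad q))\<^sup>2)"


section \<open>Discrete problems\<close>

record poro_coeffs =
  alpha :: real
  lam :: real
  mu :: real
  invM :: real
  KD :: real
  eta :: "nat \<Rightarrow> real"
  KF :: "nat \<Rightarrow> real"
  dt :: real

definition K_dr :: "poro_coeffs \<Rightarrow> real" where
  "K_dr C = lam C + 2/3 * mu C"

definition admissible_coeffs :: "fractured_domain \<Rightarrow> poro_coeffs \<Rightarrow> bool" where
  "admissible_coeffs G C \<longleftrightarrow>
     alpha C > 0 \<and> lam C > 0 \<and> mu C > 0 \<and> invM C \<ge> 0 \<and> KD C \<ge> 0 \<and> dt C > 0 \<and>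
     (\<forall>j\<in>fractures G. eta C j > 0 \<and> KF C j \<ge> 0)"

text \<open>The fracture flow and constraint equations are common to the coupled problem and to the
  fixed-stress scheme.\<close>

definition fracture_flow_eq ::
  "fractured_domain \<Rightarrow> poro_coeffs \<Rightarrow> (R3 \<Rightarrow> real) \<Rightarrow> (nat \<Rightarrow> R3 \<Rightarrow> real) \<Rightarrow> bool" where
  "fracture_flow_eq G C p pF \<longleftrightarrow> (\<forall>j\<in>fractures G. \<forall>q\<in>V_F G j.
     surf_int G j (\<lambda>x. KF C j * (tan_grad G j (pF j) x \<bullet> tan_grad G j q x))
     + surf_int G j (\<lambda>x. 2 * eta C j * pF j x * q x)
     - surf_int G j (\<lambda>x. eta C j * (trace_pos G j p x + trace_neg G j p x) * q x) = 0)"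

definition constraint_eq :: "fractured_domain \<Rightarrow> (R3 \<Rightarrow> R3) \<Rightarrow> bool" where
  "constraint_eq G u \<longleftrightarrow> (\<forall>j\<in>fractures G. \<forall>t\<in>Q_m G j.
     surf_int G j (\<lambda>x. (trace_neg G j u x - trace_pos G j u x) \<bullet> t x) = 0)"

text \<open>\<open>up, pp\<close> is the solution at the previous time step, \<open>g\<close> the source term.\<close>

definition BE_solution ::
  "fractured_domain \<Rightarrow> poro_coeffs \<Rightarrow> (R3 \<Rightarrow> real) \<Rightarrow> (R3 \<Rightarrow> R3) \<Rightarrow> (R3 \<Rightarrow> real) \<Rightarrow>
   (R3 \<Rightarrow> R3) \<Rightarrow> (R3 \<Rightarrow> real) \<Rightarrow> (nat \<Rightarrow> R3 \<Rightarrow> real) \<Rightarrow> (nat \<Rightarrow> R3 \<Rightarrow> R3) \<Rightarrow> bool" where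
  "BE_solution G C g up pp u p pF \<Lambda> \<longleftrightarrow>
     u \<in> V_m G \<and> p \<in> V_f G \<and> (\<forall>j\<in>fractures G. pF j \<in> V_F G j \<and> \<Lambda> j \<in> Q_m G j) \<and>
     (\<forall>q\<in>V_f G.
        1 / dt C * vol_int G (\<lambda>x. (invM C * p x + alpha C * divergence u x) * q x)
        + vol_int G (\<lambda>x. KD C * (grad p x \<bullet> grad q x))
        + (\<Sum>j\<in>fractures G. surf_int G j (\<lambda>x. eta C j *
             (trace_pos G j p x * trace_pos G j q x + trace_neg G j p x * trace_neg G j q x)))
        - (\<Sum>j\<in>fractures G. surf_int G j (\<lambda>x. eta C j * pF j x *
             (trace_pos G j q x + trace_neg G j q x)))
        = 1 / dt C * vol_int G (\<lambda>x. (invM C * pp x + alpha C * divergence up x) * q x)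
          + vol_int G (\<lambda>x. g x * q x)) \<and>
     fracture_flow_eq G C p pF \<and>
     (\<forall>v\<in>V_m G.
        - vol_int G (\<lambda>x. alpha C * p x * divergence v x)
        + vol_int G (\<lambda>x. elasticity (lam C) (mu C) (strain u x) \<bullet> strain v x)
        + (\<Sum>j\<in>fractures G. surf_int G j (\<lambda>x. (\<Lambda> j x - (alpha C * pF j x) *\<^sub>R nrm G j) \<bullet>
             (trace_neg G j v x - trace_pos G j v x))) = 0) \<and>
     constraint_eq G u"

text \<open>\<open>uit, pit\<close> is the previous iterate.\<close>

definition FS_flow ::
  "fractured_domain \<Rightarrow> poro_coeffs \<Rightarrow> (R3 \<Rightarrow> real) \<Rightarrow> (R3 \<Rightarrow> R3) \<Rightarrow> (R3 \<Rightarrow> real) \<Rightarrow>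
   (R3 \<Rightarrow> R3) \<Rightarrow> (R3 \<Rightarrow> real) \<Rightarrow> (R3 \<Rightarrow> real) \<Rightarrow> (nat \<Rightarrow> R3 \<Rightarrow> real) \<Rightarrow> bool" where
  "FS_flow G C g up pp uit pit p pF \<longleftrightarrow>
     p \<in> V_f G \<and> (\<forall>j\<in>fractures G. pF j \<in> V_F G j) \<and>
     (\<forall>q\<in>V_f G.
        1 / dt C * vol_int G (\<lambda>x. (invM C + (alpha C)\<^sup>2 / K_dr C) * p x * q x)
        + vol_int G (\<lambda>x. KD C * (grad p x \<bullet> grad q x))
        + (\<Sum>j\<in>fractures G. surf_int G j (\<lambda>x. eta C j *
             (trace_pos G j p x * trace_pos G j q x + trace_neg G j p x * trace_neg G j q x)))
        - (\<Sum>j\<in>fractures G. surf_int G j (\<lambda>x. eta C j * pF j x *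
             (trace_pos G j q x + trace_neg G j q x)))
        = 1 / dt C * vol_int G (\<lambda>x. (invM C * pp x + alpha C * divergence up x) * q x)
          + vol_int G (\<lambda>x. g x * q x)
          - 1 / dt C * vol_int G (\<lambda>x. alpha C * divergence uit x * q x)
          + 1 / dt C * vol_int G (\<lambda>x. (alpha C)\<^sup>2 / K_dr C * pit x * q x)) \<and>
     fracture_flow_eq G C p pF"

definition FS_mech ::
  "fractured_domain \<Rightarrow> poro_coeffs \<Rightarrow> (R3 \<Rightarrow> real) \<Rightarrow> (nat \<Rightarrow> R3 \<Rightarrow> real) \<Rightarrow>
   (R3 \<Rightarrow> R3) \<Rightarrow> (nat \<Rightarrow> R3 \<Rightarrow> R3) \<Rightarrow> bool" where
  "FS_mech G C p pF u \<Lambda> \<longleftrightarrow>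
     u \<in> V_m G \<and> (\<forall>j\<in>fractures G. \<Lambda> j \<in> Q_m G j) \<and>
     (\<forall>v\<in>V_m G.
        vol_int G (\<lambda>x. elasticity (lam C) (mu C) (strain u x) \<bullet> strain v x)
        + (\<Sum>j\<in>fractures G. surf_int G j (\<lambda>x. \<Lambda> j x \<bullet> (trace_neg G j v x - trace_pos G j v x)))
        = vol_int G (\<lambda>x. alpha C * p x * divergence v x)
          + (\<Sum>j\<in>fractures G. surf_int G j (\<lambda>x. ((alpha C * pF j x) *\<^sub>R nrm G j) \<bullet>
               (trace_neg G j v x - trace_pos G j v x)))) \<and>
     constraint_eq G u"

text \<open>Time-marching up to step \<open>k\<close>, started from zero initial values; \<open>g n\<close> is the source at
  step \<open>n\<close>.\<close>

definition BE_evolution ::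
  "fractured_domain \<Rightarrow> poro_coeffs \<Rightarrow> (nat \<Rightarrow> R3 \<Rightarrow> real) \<Rightarrow> nat \<Rightarrow>
   (nat \<Rightarrow> R3 \<Rightarrow> R3) \<Rightarrow> (nat \<Rightarrow> R3 \<Rightarrow> real) \<Rightarrow> (nat \<Rightarrow> nat \<Rightarrow> R3 \<Rightarrow> real) \<Rightarrow>
   (nat \<Rightarrow> nat \<Rightarrow> R3 \<Rightarrow> R3) \<Rightarrow> bool" where
  "BE_evolution G C g k u p pF \<Lambda> \<longleftrightarrow>
     u 0 = (\<lambda>_. 0) \<and> p 0 = (\<lambda>_. 0) \<and> (\<forall>j\<in>fractures G. pF 0 j = (\<lambda>_. 0)) \<and>
     (\<forall>n\<in>{1..k}. BE_solution G C (g n) (u (n - 1)) (p (n - 1)) (u n) (p n) (pF n) (\<Lambda> n))"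

text \<open>Speaking of ``the'' solution presupposes uniqueness; only uniqueness of the matrix pressure
  is demanded, which is automatic if \<open>invM\<close> or \<open>KD\<close> is positive and a Poincare inequality holds.\<close>

definition BE_pressure_unique ::
  "fractured_domain \<Rightarrow> poro_coeffs \<Rightarrow> (R3 \<Rightarrow> real) \<Rightarrow> (R3 \<Rightarrow> R3) \<Rightarrow> (R3 \<Rightarrow> real) \<Rightarrow> bool" where
  "BE_pressure_unique G C g up pp \<longleftrightarrow>
     (\<forall>u p pF \<Lambda> u' p' pF' \<Lambda>'.
        BE_solution G C g up pp u p pF \<Lambda> \<and> BE_solution G C g up pp u' p' pF' \<Lambda>' \<longrightarrow>
        vol_norm G (\<lambda>x. p' x - p x) = 0)"

text \<open>Fixed-stress iterates at step \<open>k\<close>; \<open>\<Lambda>it i\<close> is meaningful for \<open>i \<ge> 1\<close> only.\<close>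

definition FS_iterates ::
  "fractured_domain \<Rightarrow> poro_coeffs \<Rightarrow> (R3 \<Rightarrow> real) \<Rightarrow>
   (R3 \<Rightarrow> R3) \<Rightarrow> (R3 \<Rightarrow> real) \<Rightarrow> (nat \<Rightarrow> R3 \<Rightarrow> real) \<Rightarrow>
   (nat \<Rightarrow> R3 \<Rightarrow> R3) \<Rightarrow> (nat \<Rightarrow> R3 \<Rightarrow> real) \<Rightarrow> (nat \<Rightarrow> nat \<Rightarrow> R3 \<Rightarrow> real) \<Rightarrow>
   (nat \<Rightarrow> nat \<Rightarrow> R3 \<Rightarrow> R3) \<Rightarrow> bool" where
  "FS_iterates G C g up pp pFp uit pit pFit \<Lambda>it \<longleftrightarrow>
     uit 0 = up \<and> pit 0 = pp \<and> (\<forall>j\<in>fractures G. pFit 0 j = pFp j) \<and>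
     (\<forall>i\<ge>1. FS_flow G C g up pp (uit (i - 1)) (pit (i - 1)) (pit i) (pFit i) \<and>
             FS_mech G C (pit i) (pFit i) (uit i) (\<Lambda>it i))"

end

(*
  XFEM functions are piecewise smooth away from finitely many planes (the fracture planes and the
  planes through fracture edges orthogonal to them). Since the tip functions have finite energy, they
  have square integrable gradients and, at almost every point of a fracture, one-sided limits, so that
  all integrals of the discrete problems are genuine bilinear forms. Subtracting the coupled problem from the scheme and testing
  with the errors gives the three estimates; the multipliers drop out because of the constraint.

  If invM = KD = 0, the last estimate is no contraction. But then the pressure errors satisfy
  |e_i - e_(i+1)|^2 <= 2 (|e_i|^2 - |e_(i+1)|^2), and a pair of successive errors with
  e_i = e_(i+1) solves the homogeneous coupled problem, whose pressure vanishes by uniqueness. In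
  finite dimension this gives |e_i|^2 <= c |e_i - e_(i+1)|^2, hence geometric convergence. Likewise
  the traces of the pressure errors are bounded by their L^2 norms.
*)
theory Submission
  imports Defs "HOL-Library.Function_Algebras"
begin

section \<open>Square integrable functions\<close>

text \<open>Gradients, Jacobians and traces are total functions obtained from \<open>THE\<close>,
  \<open>frechet_derivative\<close> and \<open>Lim\<close>. They are linear only almost everywhere
  and only on regular functions, and the integral of a non-integrable function is 0. So each term
  must be exhibited as an L2 pairing of almost everywhere linear maps before equations may be
  subtracted; most of the preparation serves this.

  Discrete functions carry values on null sets too, so the L2 form is only semidefinite on them.
  Hence forms are compared by inclusion of their kernels.

  The contraction arises as follows. Let a = alpha^2/K_dr, let x, u be the old errors and y the new
  pressure error. The right-hand side tested with y is (a x - alpha div u, y). Young's inequality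
  asks for |a x - alpha div u|^2 / a = a|x|^2 - 2 alpha (div u, x) + K_dr |div u|^2. The mechanics
  equation turns the middle term into minus twice the elastic energy, and K_dr |div u|^2 is at most
  once that energy, so the whole is at most a|x|^2.\<close>

definition sqint :: "'a measure \<Rightarrow> ('a \<Rightarrow> 'b::euclidean_space) \<Rightarrow> bool" where
  "sqint M f \<longleftrightarrow> f \<in> borel_measurable M \<and> integrable M (\<lambda>x. (norm (f x))\<^sup>2)"

definition ip :: "'a measure \<Rightarrow> ('a \<Rightarrow> 'b::euclidean_space) \<Rightarrow> ('a \<Rightarrow> 'b) \<Rightarrow> real" where
  "ip M f g = (\<integral>x. f x \<bullet> g x \<partial>M)"

lemma sqint_measurable: "sqint M f \<Longrightarrow> f \<in> borel_measurable M"
  by (simp add: sqint_def)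

lemma integrable_inner:
  assumes "sqint M f" "sqint M g"
  shows "integrable M (\<lambda>x. f x \<bullet> g x)"
proof (rule Bochner_Integration.integrable_bound)
  show "integrable M (\<lambda>x. (norm (f x))\<^sup>2 + (norm (g x))\<^sup>2)"
    using assms by (auto simp: sqint_def)
  show "(\<lambda>x. f x \<bullet> g x) \<in> borel_measurable M"
    using assms by (auto simp: sqint_def)
  show "AE x in M. norm (f x \<bullet> g x) \<le> norm ((norm (f x))\<^sup>2 + (norm (g x))\<^sup>2)"
  proof (intro AE_I2)
    fix x
    have "\<bar>f x \<bullet> g x\<bar> \<le> norm (f x) * norm (g x)" by (rule Cauchy_Schwarz_ineq2)
    also have "\<dots> \<le> (norm (f x))\<^sup>2 + (norm (g x))\<^sup>2"
      using sum_squares_bound[of "norm (f x)" "norm (g x)"]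
        mult_nonneg_nonneg[OF norm_ge_zero[of "f x"] norm_ge_zero[of "g x"]] by linarith
    finally show "norm (f x \<bullet> g x) \<le> norm ((norm (f x))\<^sup>2 + (norm (g x))\<^sup>2)" by simp
  qed
qed

lemma sqint_lincomb:
  assumes "sqint M f" "sqint M g"
  shows "sqint M (\<lambda>x. a *\<^sub>R f x + b *\<^sub>R g x)"
proof -
  have "integrable M (\<lambda>x. a\<^sup>2 * (norm (f x))\<^sup>2 + 2 * a * b * (f x \<bullet> g x) + b\<^sup>2 * (norm (g x))\<^sup>2)"
    using assms integrable_inner[OF assms] by (auto simp: sqint_def)
  also have "(\<lambda>x. a\<^sup>2 * (norm (f x))\<^sup>2 + 2 * a * b * (f x \<bullet> g x) + b\<^sup>2 * (norm (g x))\<^sup>2) =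
      (\<lambda>x. (norm (a *\<^sub>R f x + b *\<^sub>R g x))\<^sup>2)"
    by (rule ext) (simp add: power2_norm_eq_inner inner_add inner_commute power2_eq_square[of a]
        power2_eq_square[of b] algebra_simps)
  finally show ?thesis using assms by (auto simp: sqint_def)
qed

lemma sqint_zero: "sqint M (\<lambda>x. 0)" by (simp add: sqint_def)

lemma sqint_scaleR: "sqint M f \<Longrightarrow> sqint M (\<lambda>x. a *\<^sub>R f x)"
  using sqint_lincomb[of M f f a 0] by simp

lemma sqint_add: "sqint M f \<Longrightarrow> sqint M g \<Longrightarrow> sqint M (\<lambda>x. f x + g x)"
  using sqint_lincomb[of M f g 1 1] by simp

lemma sqint_diff: "sqint M f \<Longrightarrow> sqint M g \<Longrightarrow> sqint M (\<lambda>x. f x - g x)"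
  using sqint_lincomb[of M f g 1 "-1"] by simp

lemma sqint_bounded:
  assumes "finite_measure M" "f \<in> borel_measurable M" "AE x in M. norm (f x) \<le> B"
  shows "sqint M f"
  unfolding sqint_def
proof
  show "integrable M (\<lambda>x. (norm (f x))\<^sup>2)"
  proof (rule finite_measure.integrable_const_bound[OF assms(1), where B="B\<^sup>2"])
    show "AE x in M. norm ((norm (f x))\<^sup>2) \<le> B\<^sup>2"
      using assms(3) by (auto intro!: power_mono elim!: eventually_mono)
  qed (use assms in measurable)
qed fact

lemma sqint_dominated:
  assumes "sqint M g" "f \<in> borel_measurable M" "AE x in M. norm (f x) \<le> norm (g x)"
  shows "sqint M f"
  unfolding sqint_def
proof
  show "integrable M (\<lambda>x. (norm (f x))\<^sup>2)"
  proof (rule Bochner_Integration.integrable_bound)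
    show "integrable M (\<lambda>x. (norm (g x))\<^sup>2)" using assms by (simp add: sqint_def)
    show "AE x in M. norm ((norm (f x))\<^sup>2) \<le> norm ((norm (g x))\<^sup>2)"
      using assms(3) by (auto intro!: power_mono elim!: eventually_mono)
  qed (use assms in measurable)
qed fact

lemma sqint_mult_bounded:
  fixes h :: "'a \<Rightarrow> real"
  assumes "sqint M f" "h \<in> borel_measurable M" "AE x in M. \<bar>h x\<bar> \<le> B"
  shows "sqint M (\<lambda>x. h x *\<^sub>R f x)"
proof (rule sqint_dominated)
  show "sqint M (\<lambda>x. B *\<^sub>R f x)" using assms(1) by (rule sqint_scaleR)
  show "(\<lambda>x. h x *\<^sub>R f x) \<in> borel_measurable M"
    using assms by (auto simp: sqint_def)
  show "AE x in M. norm (h x *\<^sub>R f x) \<le> norm (B *\<^sub>R f x)"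
    using assms(3) by (auto elim!: eventually_mono intro!: mult_right_mono)
qed

lemma sqint_bounded_linear:
  fixes L :: "'b::euclidean_space \<Rightarrow> 'c::euclidean_space"
  assumes "sqint M f" "bounded_linear L"
  shows "sqint M (\<lambda>x. L (f x))"
proof -
  obtain K where K: "\<And>y. norm (L y) \<le> norm y * K"
    using assms(2) bounded_linear.bounded by blast
  show ?thesis
  proof (rule sqint_dominated)
    show "sqint M (\<lambda>x. K *\<^sub>R f x)" using assms(1) by (rule sqint_scaleR)
    have "L \<in> borel_measurable borel"
      using assms(2) by (intro borel_measurable_continuous_onI linear_continuous_on)
    then show "(\<lambda>x. L (f x)) \<in> borel_measurable M"
      using sqint_measurable[OF assms(1)] by (auto intro: measurable_compose)
    show "AE x in M. norm (L (f x)) \<le> norm (K *\<^sub>R f x)"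
    proof (intro AE_I2)
      fix x
      show "norm (L (f x)) \<le> norm (K *\<^sub>R f x)"
        using K[of "f x"] mult_right_mono[OF abs_ge_self[of K], of "norm (f x)"]
        by (simp add: mult.commute)
    qed
  qed
qed

lemma sqint_componentwise:
  assumes "\<And>b. b \<in> Basis \<Longrightarrow> sqint M (\<lambda>x. f x \<bullet> b)"
  shows "sqint M f"
  unfolding sqint_def
proof
  show "f \<in> borel_measurable M"
    using assms by (auto simp: sqint_def borel_measurable_euclidean_space[of f])
  have "integrable M (\<lambda>x. \<Sum>b\<in>Basis. (f x \<bullet> b)\<^sup>2)"
    using assms by (auto simp: sqint_def)
  also have "(\<lambda>x. \<Sum>b\<in>Basis. (f x \<bullet> b)\<^sup>2) = (\<lambda>x. (norm (f x))\<^sup>2)"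
    by (auto simp: fun_eq_iff norm_eq_sqrt_inner euclidean_inner[of "f _" "f _"] power2_eq_square sum_nonneg)
  finally show "integrable M (\<lambda>x. (norm (f x))\<^sup>2)" .
qed

text \<open>Measurability of \<open>f\<close> is a separate assumption because \<open>M\<close> is
  arbitrary here; for the complete measures used below it follows from the almost everywhere
  equality by \<open>borel_measurable_AE_eq\<close>.\<close>

lemma sqint_cong_AE:
  assumes "AE x in M. f x = g x" "f \<in> borel_measurable M" "sqint M g"
  shows "sqint M f"
  using assms(3,2) by (rule sqint_dominated) (use assms(1) in \<open>auto elim!: eventually_mono\<close>)

lemma ip_commute: "ip M f g = ip M g f"
  by (simp add: ip_def inner_commute)

lemma ip_cong_AE:
  assumes "AE x in M. f x = g x" "f \<in> borel_measurable M" "sqint M g" "sqint M h"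
  shows "ip M f h = ip M g h"
  unfolding ip_def
  by (rule integral_cong_AE) (use assms in \<open>auto simp: sqint_def elim!: eventually_mono\<close>)

lemma ip_lincomb_left:
  assumes "sqint M f" "sqint M g" "sqint M h"
  shows "ip M (\<lambda>x. a *\<^sub>R f x + b *\<^sub>R g x) h = a * ip M f h + b * ip M g h"
  using integrable_inner[OF assms(1,3)] integrable_inner[OF assms(2,3)]
  by (simp add: ip_def inner_add_left)

lemma ip_lincomb_AE:
  assumes "AE x in M. F x = a *\<^sub>R f x + b *\<^sub>R g x" "F \<in> borel_measurable M"
    "sqint M f" "sqint M g" "sqint M h"
  shows "ip M F h = a * ip M f h + b * ip M g h"
    "ip M h F = a * ip M h f + b * ip M h g"
proof -
  show "ip M F h = a * ip M f h + b * ip M g h"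
    using assms by (subst ip_cong_AE[OF assms(1)]) (auto simp: sqint_lincomb ip_lincomb_left)
  then show "ip M h F = a * ip M h f + b * ip M h g"
    by (simp add: ip_commute)
qed

lemma ip_lincomb_right:
  assumes "sqint M f" "sqint M g" "sqint M h"
  shows "ip M h (\<lambda>x. a *\<^sub>R f x + b *\<^sub>R g x) = a * ip M h f + b * ip M h g"
  using ip_lincomb_left[OF assms] by (simp add: ip_commute)

lemma ip_self_nonneg: "0 \<le> ip M f f"
  by (simp add: ip_def)

lemma ip_self_norm: "ip M f f = (\<integral>x. (norm (f x))\<^sup>2 \<partial>M)"
  by (simp add: ip_def power2_norm_eq_inner)

text \<open>Expansion of the nonnegative square of \<open>c f - g\<close>, divided by
  \<open>c\<close>. The choice of the weight \<open>c\<close> determines the constants of the energy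
  estimates.\<close>

lemma ip_young:
  assumes "sqint M f" "sqint M g" "0 < c"
  shows "2 * ip M f g \<le> c * ip M f f + ip M g g / c"
proof -
  have "0 \<le> ip M (\<lambda>x. c *\<^sub>R f x + (-1) *\<^sub>R g x) (\<lambda>x. c *\<^sub>R f x + (-1) *\<^sub>R g x)"
    by (rule ip_self_nonneg)
  also have "\<dots> = c * (c * ip M f f - ip M f g) - (c * ip M g f - ip M g g)"
    using assms by (simp only: ip_lincomb_left ip_lincomb_right sqint_lincomb) (simp add: algebra_simps)
  also have "\<dots> = c * (c * ip M f f - 2 * ip M f g) + ip M g g"
    by (simp add: ip_commute[of M g f] algebra_simps)
  finally show ?thesis using assms(3) by (simp add: field_simps power2_eq_square)
qed

lemma ip_young_neg:
  assumes "sqint M f" "sqint M g" "0 < c"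
  shows "- 2 * ip M f g \<le> c * ip M f f + ip M g g / c"
proof -
  have "ip M (\<lambda>x. (-1) *\<^sub>R f x) g = - ip M f g" "ip M (\<lambda>x. (-1) *\<^sub>R f x) (\<lambda>x. (-1) *\<^sub>R f x) = ip M f f"
    by (simp_all add: ip_def)
  then show ?thesis
    using ip_young[OF sqint_scaleR[OF assms(1), of "-1"] assms(2,3)] by simp
qed

text \<open>With a null \<open>g\<close>, Young's inequality leaves a bound by
  \<open>c * ip M f f\<close> for every positive \<open>c\<close>.\<close>

lemma ip_zero_right:
  assumes "sqint M f" "sqint M g" "ip M g g = 0"
  shows "ip M f g = 0"
proof (rule ccontr)
  assume ne: "ip M f g \<noteq> 0"
  have *: "\<bar>2 * ip M f g\<bar> \<le> c * ip M f f" if "0 < c" for c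
    using ip_young[OF assms(1,2) that] ip_young_neg[OF assms(1,2) that] assms(3) by auto
  have "ip M f f > 0" using *[of 1] ne ip_self_nonneg[of M f] by auto
  \<comment> \<open>The weight below bounds twice the absolute value of \<open>ip M f g\<close> by
    that value itself.\<close>
  then show False
    using *[of "\<bar>ip M f g\<bar> / ip M f f"] ne by (auto simp: field_simps)
qed

lemma ip_self_lincomb:
  assumes "sqint M f" "sqint M g"
  shows "ip M (\<lambda>x. a *\<^sub>R f x + b *\<^sub>R g x) (\<lambda>x. a *\<^sub>R f x + b *\<^sub>R g x) =
    a\<^sup>2 * ip M f f + 2 * a * b * ip M f g + b\<^sup>2 * ip M g g"
  using assms by (simp only: ip_lincomb_left ip_lincomb_right sqint_lincomb)
    (simp add: ip_commute[of M g f] power2_eq_square algebra_simps)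

lemma ip_self_zero_AE:
  assumes "sqint M f" "ip M f f = 0"
  shows "AE x in M. f x = 0"
  using assms integral_nonneg_eq_0_iff_AE[of M "\<lambda>x. (norm (f x))\<^sup>2"]
  by (auto simp: sqint_def ip_self_norm)


section \<open>Pointwise vector space structure of functions\<close>

text \<open>With this instance \<open>subspace\<close>, \<open>span\<close> and dimension arguments
  apply to the discrete function spaces; the additive structure comes from
  \<open>Function_Algebras\<close>.\<close>

instantiation "fun" :: (type, real_vector) real_vector
begin

definition "scaleR_fun a f = (\<lambda>x. a *\<^sub>R f x)"

instance
  by standard (auto simp: fun_eq_iff scaleR_fun_def algebra_simps)

end

lemma scaleR_fun_apply: "(a *\<^sub>R f) x = a *\<^sub>R f x"
  by (simp add: scaleR_fun_def)

lemma sum_fun_apply: "(\<Sum>i\<in>A. f i) x = (\<Sum>i\<in>A. f i x)"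
  by (induction A rule: infinite_finite_induct) auto

lemma fun_span_eq_span: "fun_span B = span B"
  by (force simp: fun_span_def span_explicit fun_eq_iff sum_fun_apply scaleR_fun_apply)

lemma lincomb_fun_eq: "(\<lambda>x. a *\<^sub>R f x + b *\<^sub>R g x) = a *\<^sub>R f + b *\<^sub>R g"
  by (auto simp: fun_eq_iff scaleR_fun_apply)

lemma subspace_lincomb_mem:
  "subspace S \<Longrightarrow> f \<in> S \<Longrightarrow> g \<in> S \<Longrightarrow> a *\<^sub>R f + b *\<^sub>R g \<in> S"
  by (simp add: subspace_add subspace_scale)

section \<open>Comparison of semi-inner products in finite dimension\<close>

text \<open>Only semidefinite, because functions differing on a null set are different elements of
  the discrete spaces; and only on \<open>S\<close>, because linearity of the integrals is
  established there alone. Symmetry supplies linearity in the second argument.\<close>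

definition psd_on :: "'a::real_vector set \<Rightarrow> ('a \<Rightarrow> 'a \<Rightarrow> real) \<Rightarrow> bool" where
  "psd_on S d \<longleftrightarrow> (\<forall>x\<in>S. \<forall>y\<in>S. d x y = d y x) \<and> (\<forall>x\<in>S. 0 \<le> d x x) \<and>
     (\<forall>a b. \<forall>x\<in>S. \<forall>y\<in>S. \<forall>z\<in>S. d (a *\<^sub>R x + b *\<^sub>R y) z = a * d x z + b * d y z)"

lemma psd_on_commute: "psd_on S d \<Longrightarrow> x \<in> S \<Longrightarrow> y \<in> S \<Longrightarrow> d x y = d y x"
  unfolding psd_on_def by blast

lemma psd_on_nonneg: "psd_on S d \<Longrightarrow> x \<in> S \<Longrightarrow> 0 \<le> d x x"
  unfolding psd_on_def by blast

lemma psd_on_lincomb: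
  "psd_on S d \<Longrightarrow> x \<in> S \<Longrightarrow> y \<in> S \<Longrightarrow> z \<in> S \<Longrightarrow>
    d (a *\<^sub>R x + b *\<^sub>R y) z = a * d x z + b * d y z"
  unfolding psd_on_def by blast

lemma psd_on_quadratic:
  assumes "subspace S" "psd_on S d" "x \<in> S" "y \<in> S"
  shows "d (a *\<^sub>R x + b *\<^sub>R y) (a *\<^sub>R x + b *\<^sub>R y) = a\<^sup>2 * d x x + 2 * a * b * d x y + b\<^sup>2 * d y y"
proof -
  let ?z = "a *\<^sub>R x + b *\<^sub>R y"
  have z: "?z \<in> S" using assms by (simp add: subspace_lincomb_mem)
  have "d ?z ?z = a * d x ?z + b * d y ?z"
    by (rule psd_on_lincomb[OF assms(2,3,4) z])
  moreover have "d x ?z = a * d x x + b * d x y" "d y ?z = a * d x y + b * d y y"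
    unfolding psd_on_commute[OF assms(2,3) z] psd_on_commute[OF assms(2,4) z]
      psd_on_lincomb[OF assms(2,3,4,3)] psd_on_lincomb[OF assms(2,3,4,4)]
      psd_on_commute[OF assms(2,4,3)] by (rule refl)+
  ultimately show ?thesis by (simp add: power2_eq_square algebra_simps)
qed

text \<open>Along the line through \<open>x\<close> in the null direction \<open>y\<close> the form
  is affine in the parameter, so a nonzero slope would make it negative somewhere.\<close>

lemma psd_on_kernel:
  assumes "subspace S" "psd_on S d" "x \<in> S" "y \<in> S" "d y y = 0"
  shows "d x y = 0"
proof (rule ccontr)
  assume ne: "d x y \<noteq> 0"
  \<comment> \<open>Chosen so that the form takes the value -1.\<close>
  let ?b = "- (d x x + 1) / (2 * d x y)"
  have "0 \<le> d (1 *\<^sub>R x + ?b *\<^sub>R y) (1 *\<^sub>R x + ?b *\<^sub>R y)"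
    by (rule psd_on_nonneg[OF assms(2) subspace_lincomb_mem[OF assms(1,3,4)]])
  also have "\<dots> = d x x + 2 * ?b * d x y"
    by (subst psd_on_quadratic[OF assms(1-4)]) (simp add: assms(5))
  also have "\<dots> = -1" using ne by (simp add: field_simps)
  finally show False by simp
qed

text \<open>Parallelogram law: the values at \<open>x + t y\<close> and \<open>x - t y\<close> add
  up to the right-hand side, and the second is nonnegative.\<close>

lemma psd_on_quadratic_le:
  assumes "subspace S" "psd_on S d" "x \<in> S" "y \<in> S"
  shows "d (x + t *\<^sub>R y) (x + t *\<^sub>R y) \<le> 2 * d x x + 2 * t\<^sup>2 * d y y"
proof -
  have "0 \<le> d (1 *\<^sub>R x + (-t) *\<^sub>R y) (1 *\<^sub>R x + (-t) *\<^sub>R y)"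
    by (rule psd_on_nonneg[OF assms(2) subspace_lincomb_mem[OF assms(1,3,4)]])
  then show ?thesis
    using psd_on_quadratic[OF assms, of 1 t] psd_on_quadratic[OF assms, of 1 "-t"] by (simp add: mult.commute)
qed

text \<open>Orthogonal projections onto \<open>span A\<close> are carried along in the induction, since they
  provide the Gram-Schmidt step.\<close>

lemma psd_dominated_span:
  assumes S: "subspace S" and d: "psd_on S d" and n: "psd_on S n"
    and ker: "\<And>x. x \<in> S \<Longrightarrow> d x x = 0 \<Longrightarrow> n x x = 0"
    and A: "finite A" "A \<subseteq> S"
  shows "(\<exists>c\<ge>0. \<forall>x\<in>span A. n x x \<le> c * d x x) \<and>
    (\<forall>b\<in>S. \<exists>y\<in>span A. \<forall>w\<in>span A. d (b - y) w = 0)"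
  using A
proof (induction A rule: finite_induct)
  case empty
  have 0: "0 \<in> S" using S by (rule subspace_0)
  have z: "psd_on S m \<Longrightarrow> x \<in> S \<Longrightarrow> m x 0 = 0" for m :: "'a \<Rightarrow> 'a \<Rightarrow> real" and x
    using psd_on_lincomb[of S m 0 0 x 0 0] psd_on_commute[of S m x 0] 0 by simp
  show ?case
    using z[OF d] z[OF n 0] 0 by (auto intro!: exI[of _ 0])
next
  case (insert a A)
  then obtain c where c: "c \<ge> 0" "\<And>x. x \<in> span A \<Longrightarrow> n x x \<le> c * d x x"
    and proj: "\<And>b. b \<in> S \<Longrightarrow> \<exists>y\<in>span A. \<forall>w\<in>span A. d (b - y) w = 0" by auto
  have spS: "span A \<subseteq> S" using insert S by (simp add: span_minimal)
  have spiS: "span (insert a A) \<subseteq> S" using insert S by (simp add: span_minimal)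
  obtain y where y: "y \<in> span A" "\<And>w. w \<in> span A \<Longrightarrow> d (a - y) w = 0"
    using proj[of a] insert by auto
  define a' where "a' = a - y"
  have a'S: "a' \<in> S" using insert y spS S by (auto simp: a'_def intro: subspace_diff)
  have a'i: "a' \<in> span (insert a A)"
    unfolding a'_def using y(1) by (meson insertI1 span_base span_diff span_mono subset_insertI subsetD)
  have orth: "w \<in> span A \<Longrightarrow> d w a' = 0" for w
    using y(2)[of w] psd_on_commute[OF d a'S, of w] spS by (auto simp: a'_def)
  have dec: "\<exists>w t. w \<in> span A \<and> x = w + t *\<^sub>R a'"
    if x: "x \<in> span (insert a A)" for x
  proof -
    obtain t where "x - t *\<^sub>R a \<in> span A" using iffD1[OF span_breakdown_eq x] by blast
    then have "x - t *\<^sub>R a + t *\<^sub>R y \<in> span A" using y by (simp add: span_add span_scale)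
    moreover have "x = (x - t *\<^sub>R a + t *\<^sub>R y) + t *\<^sub>R a'" by (simp add: a'_def algebra_simps)
    ultimately show ?thesis by blast
  qed
  \<comment> \<open>If \<open>a'\<close> is null for \<open>d\<close>, then \<open>ker\<close> makes
    it null for \<open>n\<close>, so the default 0 still satisfies
    \<open>n a' a' = e * d a' a'\<close>.\<close>
  define e where "e = (if d a' a' = 0 then 0 else n a' a' / d a' a')"
  have e: "n a' a' = e * d a' a'" "e \<ge> 0"
    using ker[OF a'S] psd_on_nonneg[OF d a'S] psd_on_nonneg[OF n a'S] by (auto simp: e_def)
  show ?case
  proof
    show "\<exists>c\<ge>0. \<forall>x\<in>span (insert a A). n x x \<le> c * d x x"
    \<comment> \<open>The form \<open>d\<close> splits orthogonally along \<open>w + t a'\<close>,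
      while \<open>n\<close> splits only up to the factor 2 of
      \<open>psd_on_quadratic_le\<close>.\<close>
    proof (intro exI[of _ "2 * (c + e)"] conjI ballI)
      show "0 \<le> 2 * (c + e)" using c e by simp
      fix x assume "x \<in> span (insert a A)"
      then obtain w t where w: "w \<in> span A" "x = w + t *\<^sub>R a'" using dec by blast
      have wS: "w \<in> S" using w spS by auto
      have dx: "d x x = d w w + t\<^sup>2 * d a' a'"
        using psd_on_quadratic[OF S d wS a'S, of 1 t] orth[OF w(1)] w(2) by simp
      have "n x x \<le> 2 * n w w + 2 * t\<^sup>2 * n a' a'"
        using psd_on_quadratic_le[OF S n wS a'S, of t] w(2) by simp
      also have "\<dots> \<le> 2 * (c * d w w) + 2 * t\<^sup>2 * (e * d a' a')"
        using c(2)[OF w(1)] e(1) by simp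
      also have "\<dots> \<le> 2 * (c + e) * d x x"
      proof -
        have "0 \<le> e * d w w" "0 \<le> c * (t\<^sup>2 * d a' a')"
          using c e psd_on_nonneg[OF d wS] psd_on_nonneg[OF d a'S] by simp_all
        then show ?thesis by (simp add: dx algebra_simps)
      qed
      finally show "n x x \<le> 2 * (c + e) * d x x" .
    qed
    show "\<forall>b\<in>S. \<exists>y\<in>span (insert a A). \<forall>w\<in>span (insert a A). d (b - y) w = 0"
    proof
      fix b assume b: "b \<in> S"
      obtain yb where yb: "yb \<in> span A" "\<And>w. w \<in> span A \<Longrightarrow> d (b - yb) w = 0"
        using proj[OF b] by auto
      define r where "r = b - yb"
      have rS: "r \<in> S" using b yb spS S by (auto simp: r_def intro: subspace_diff)
      \<comment> \<open>Coefficient of the projection onto \<open>a'\<close>. If \<open>a'\<close>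
        is null for \<open>d\<close>, then \<open>d r a'\<close> vanishes by
        \<open>psd_on_kernel\<close> and 0 serves.\<close>
      define s where "s = (if d a' a' = 0 then 0 else d r a' / d a' a')"
      have sa: "d r a' = s * d a' a'"
        using psd_on_kernel[OF S d rS a'S] by (auto simp: s_def)
      show "\<exists>y\<in>span (insert a A). \<forall>w\<in>span (insert a A). d (b - y) w = 0"
      proof (intro bexI[of _ "yb + s *\<^sub>R a'"] ballI)
        show "yb + s *\<^sub>R a' \<in> span (insert a A)"
          using yb(1) a'i by (meson span_add span_mono span_scale subset_insertI subsetD)
        fix x assume "x \<in> span (insert a A)"
        then obtain w t where w: "w \<in> span A" "x = w + t *\<^sub>R a'" using dec by blast
        have wS: "w \<in> S" using w spS by auto
        have q: "b - (yb + s *\<^sub>R a') = 1 *\<^sub>R r + (-s) *\<^sub>R a'" by (simp add: r_def)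
        have qS: "1 *\<^sub>R r + (-s) *\<^sub>R a' \<in> S" using rS a'S S by (rule_tac subspace_lincomb_mem)
        have "d (1 *\<^sub>R r + (-s) *\<^sub>R a') w = 0"
          using yb(2)[OF w(1), folded r_def] orth[OF w(1)] psd_on_commute[OF d a'S wS]
          unfolding psd_on_lincomb[OF d rS a'S wS] by simp
        moreover have "d (1 *\<^sub>R r + (-s) *\<^sub>R a') a' = 0"
          using sa unfolding psd_on_lincomb[OF d rS a'S a'S] by simp
        ultimately have "d (1 *\<^sub>R w + t *\<^sub>R a') (1 *\<^sub>R r + (-s) *\<^sub>R a') = 0"
          unfolding psd_on_lincomb[OF d wS a'S qS] psd_on_commute[OF d wS qS] psd_on_commute[OF d a'S qS]
          by simp
        moreover have "1 *\<^sub>R w + t *\<^sub>R a' \<in> S" using wS a'S S by (rule_tac subspace_lincomb_mem)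
        ultimately show "d (b - (yb + s *\<^sub>R a')) x = 0"
          unfolding q w(2) using psd_on_commute[OF d qS, of "1 *\<^sub>R w + t *\<^sub>R a'"] by simp
      qed
    qed
  qed
qed

text \<open>\<open>B\<close> may reach outside \<open>S\<close>: the piecewise linear functions
  vanishing on a Dirichlet part come without an explicit basis, but lie in the finite-dimensional
  \<open>P1\<close>. An independent subset of \<open>S\<close> is then finite.\<close>

theorem psd_dominated:
  assumes "subspace S" "finite B" "S \<subseteq> span B" "psd_on S d" "psd_on S n"
    and "\<And>x. x \<in> S \<Longrightarrow> d x x = 0 \<Longrightarrow> n x x = 0"
  obtains c where "c \<ge> 0" "\<And>x. x \<in> S \<Longrightarrow> n x x \<le> c * d x x"
proof -
  obtain A where A: "A \<subseteq> S" "independent A" "S \<subseteq> span A"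
    by (rule basis_exists[of S])
  have "finite A"
    using independent_span_bound[OF assms(2) A(2) order_trans[OF A(1) assms(3)]] by simp
  with psd_dominated_span[OF assms(1,4,5,6) _ A(1)] have
    "\<exists>c\<ge>0. \<forall>x\<in>span A. n x x \<le> c * d x x" by simp
  then obtain c where c: "c \<ge> 0" "\<forall>x\<in>span A. n x x \<le> c * d x x" by auto
  show ?thesis
    by (rule that[OF c(1)]) (rule bspec[OF c(2) subsetD[OF A(3)]])
qed

text \<open>Point evaluation on \<open>P\<close> embeds such a space into the functions supported on \<open>P\<close>.\<close>

lemma finite_dim_if_determined_by_values:
  fixes S :: "('a \<Rightarrow> real) set"
  assumes S: "subspace S" and P: "finite P"
    and det: "\<And>f. f \<in> S \<Longrightarrow> (\<And>x. x \<in> P \<Longrightarrow> f x = 0) \<Longrightarrow> f = 0"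
  obtains B where "finite B" "B \<subseteq> S" "S \<subseteq> span B"
proof -
  define L where "L f = (\<lambda>x. if x \<in> P then f x else 0)" for f :: "'a \<Rightarrow> real"
  have lin: "linear L"
    by (rule linearI) (simp_all add: L_def fun_eq_iff scaleR_fun_apply)
  obtain B where B: "B \<subseteq> S" "independent B" "S \<subseteq> span B"
    by (rule basis_exists[of S])
  \<comment> \<open>Being injective, \<open>L\<close> keeps the basis independent; its image lies in
    the span of finitely many unit functions, so the basis is finite.\<close>
  have inj: "inj_on L (span B)"
  proof -
    have "span B = S" using B S by (intro equalityI span_minimal)
    moreover have "inj_on L S"
    proof (rule inj_onI)
      fix f g assume fg: "f \<in> S" "g \<in> S" "L f = L g"
      have "f - g = 0"
      proof (rule det)
        show "f - g \<in> S" using fg S by (simp add: subspace_diff)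
        fix x assume "x \<in> P"
        then show "(f - g) x = 0" using fun_cong[OF fg(3), of x] by (simp add: L_def)
      qed
      then show "f = g" by simp
    qed
    ultimately show ?thesis by simp
  qed
  let ?E = "(\<lambda>p. (\<lambda>x. if x = p then 1 else 0 :: real)) ` P"
  have "L f \<in> span ?E" for f
  proof -
    have "L f = (\<Sum>p\<in>P. f p *\<^sub>R (\<lambda>x. if x = p then 1 else 0))"
      using P by (simp add: fun_eq_iff sum_fun_apply scaleR_fun_apply L_def if_distrib[of "(*) _"] cong: if_cong)
    also have "\<dots> \<in> span ?E"
      by (intro span_sum span_scale span_base) auto
    finally show ?thesis .
  qed
  then have "L ` B \<subseteq> span ?E" by auto
  moreover have "independent (L ` B)"
    using linear_independent_injective_image[OF lin B(2) inj] .
  ultimately have "finite (L ` B)"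
    using independent_span_bound[of ?E "L ` B"] P by auto
  moreover have "inj_on L B" using inj span_superset by (rule inj_on_subset)
  ultimately have "finite B" by (simp add: finite_image_iff)
  then show ?thesis by (rule that[OF _ B(1,3)])
qed

section \<open>Gradients\<close>

lemma GDERIV_unique:
  assumes "GDERIV q x :> D" "GDERIV q x :> D'"
  shows "D = D'"
proof -
  have "(\<lambda>h. inner h D) = (\<lambda>h. inner h D')"
    using has_derivative_unique assms unfolding gderiv_def by metis
  then have "inner (D - D') D = inner (D - D') D'" by metis
  then have "(D - D') \<bullet> (D - D') = 0" by (simp add: inner_diff_right)
  then show ?thesis by simp
qed

lemma grad_eqI: "GDERIV q x :> D \<Longrightarrow> grad q x = D"
  unfolding grad_def using GDERIV_unique by (intro the_equality) auto

lemma differentiable_imp_GDERIV: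
  assumes "q differentiable (at x)"
  shows "GDERIV q x :> grad q x"
proof -
  obtain f' where f': "(q has_derivative f') (at x)" using assms by (auto simp: differentiable_def)
  define D where "D = (\<Sum>b\<in>Basis. f' b *\<^sub>R b)"
  have "f' h = inner h D" for h
  proof -
    have lin: "linear f'" using f' by (rule has_derivative_linear)
    have "f' h = f' (\<Sum>b\<in>Basis. (h \<bullet> b) *\<^sub>R b)" by (simp add: euclidean_representation)
    also have "\<dots> = (\<Sum>b\<in>Basis. (h \<bullet> b) * f' b)"
      by (simp add: linear_sum[OF lin] linear_scale[OF lin])
    also have "\<dots> = inner h D" by (simp add: D_def inner_sum_right mult.commute)
    finally show ?thesis .
  qed
  then have "f' = (\<lambda>h. inner h D)" by (rule ext)
  then have "GDERIV q x :> D" using f' by (simp add: gderiv_def)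
  then show ?thesis using grad_eqI by metis
qed

lemma GDERIV_imp_differentiable: "GDERIV q x :> D \<Longrightarrow> q differentiable (at x)"
  by (auto simp: gderiv_def differentiable_def)

lemma GDERIV_lincomb:
  assumes "GDERIV p x :> D" "GDERIV q x :> E"
  shows "GDERIV (\<lambda>y. a * p y + b * q y) x :> a *\<^sub>R D + b *\<^sub>R E"
  using assms unfolding gderiv_def
  by (auto intro!: derivative_eq_intros simp: inner_add_right)

lemma GDERIV_cong_ev:
  assumes "GDERIV p x :> D" "eventually (\<lambda>y. p y = q y) (nhds x)"
  shows "GDERIV q x :> D"
proof -
  have "eventually (\<lambda>y. p y = q y) (at x)" "p x = q x"
    using assms(2) by (auto simp: eventually_at_filter dest: eventually_nhds_x_imp_x elim!: eventually_mono)
  then show ?thesis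
    using assms(1) unfolding gderiv_def
    by (subst has_derivative_transform_eventually[of p _ x UNIV q]) auto
qed

section \<open>Null sets and traces\<close>

lemma AE_lebesgue_not_in_negligible:
  "negligible N \<Longrightarrow> AE x in lebesgue. x \<notin> N"
  by (intro AE_not_in) (simp add: negligible_iff_null_sets)

definition MV :: "fractured_domain \<Rightarrow> R3 measure" where
  "MV G = lebesgue_on (cut_region G)"

definition frac_coords :: "fractured_domain \<Rightarrow> nat \<Rightarrow> (real^2) set" where
  "frac_coords G j = {\<xi>. chart G j \<xi> \<in> frac G j}"

definition MS :: "fractured_domain \<Rightarrow> nat \<Rightarrow> (real^2) measure" where
  "MS G j = lebesgue_on (frac_coords G j)"

text \<open>The parameter \<open>s\<close> treats both sides at once: \<open>s = -1\<close> is the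
  \<open>+\<close> side, whose outward normal is \<open>nrm\<close>, and \<open>s = 1\<close> is the
  \<open>-\<close> side.\<close>

definition side :: "fractured_domain \<Rightarrow> nat \<Rightarrow> real \<Rightarrow> R3 \<Rightarrow> R3 set" where
  "side G j s x = {y \<in> cut_region G. 0 < s * (nrm G j \<bullet> (y - x))}"

abbreviation side_filter :: "fractured_domain \<Rightarrow> nat \<Rightarrow> real \<Rightarrow> R3 \<Rightarrow> R3 filter" where
  "side_filter G j s x \<equiv> at x within side G j s x"

definition tr :: "fractured_domain \<Rightarrow> nat \<Rightarrow> real \<Rightarrow> (R3 \<Rightarrow> 'b::t2_space) \<Rightarrow> R3 \<Rightarrow> 'b" where
  "tr G j s v x = Lim (side_filter G j s x) v"

lemma trace_pos_eq: "trace_pos G j = tr G j (-1)"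
  by (simp add: fun_eq_iff trace_pos_def tr_def side_def)

lemma trace_neg_eq: "trace_neg G j = tr G j 1"
  by (simp add: fun_eq_iff trace_neg_def tr_def side_def)

section \<open>Geometry of the fractures\<close>

text \<open>The edge direction turned by a right angle within the fracture plane. It turns
  \<open>edge_fun\<close> in local coordinates into an affine function on space, whose zero set is
  the plane through the edge orthogonal to the fracture.\<close>

definition edge_normal :: "fractured_domain \<Rightarrow> nat \<Rightarrow> nat \<Rightarrow> R3" where
  "edge_normal G j r =
     (let d = edge_end (corner G j) r - edge_start (corner G j) r
      in (d \<bullet> tang1 G j) *\<^sub>R tang2 G j - (d \<bullet> tang2 G j) *\<^sub>R tang1 G j)"

lemma local_coords_nth:
  "local_coords G j x $ 1 = (x - origin G j) \<bullet> tang1 G j"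
  "local_coords G j x $ 2 = (x - origin G j) \<bullet> tang2 G j"
  by (simp_all add: local_coords_def)

lemma edge_fun_local_coords:
  "edge_fun G j r (local_coords G j x) = edge_normal G j r \<bullet> (x - edge_start (corner G j) r)"
  by (simp add: edge_fun_def edge_normal_def Let_def local_coords_nth inner_diff_left inner_diff_right
      inner_commute algebra_simps)

text \<open>A wall is a pair \<open>(a, b)\<close> representing the plane \<open>a \<bullet> (x - b) = 0\<close>. The enrichment functions
  are smooth away from the walls: the fracture planes and the planes through the
  fracture edges that are orthogonal to the fracture.\<close>

definition walls :: "fractured_domain \<Rightarrow> (R3 \<times> R3) set" where
  "walls G = (\<lambda>j. (nrm G j, origin G j)) ` fractures G \<union>
     (\<Union>j\<in>fractures G. (\<lambda>r. (edge_normal G j r, edge_start (corner G j) r)) ` {..<length (corner G j)})"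

definition off_walls :: "fractured_domain \<Rightarrow> R3 set" where
  "off_walls G = {x. \<forall>(a,b)\<in>walls G. a \<bullet> (x - b) \<noteq> 0}"

lemma finite_walls: "finite (walls G)"
  by (simp add: walls_def)

lemma continuous_chart: "continuous_on A (chart G j)"
  unfolding chart_def by (intro continuous_intros)

lemma continuous_local_coords: "continuous_on A (local_coords G j)"
proof -
  have "local_coords G j = (\<lambda>x. \<chi> i. if i = 1 then (x - origin G j) \<bullet> tang1 G j else (x - origin G j) \<bullet> tang2 G j)"
    by (simp add: fun_eq_iff vec_eq_iff forall_2 local_coords_nth)
  moreover have "continuous_on A (\<lambda>x. if i = 1 then (x - origin G j) \<bullet> tang1 G j else (x - origin G j) \<bullet> tang2 G j)"
    for i :: 2 by (cases "i = 1") (simp_all, (intro continuous_intros)+)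
  ultimately show ?thesis by (simp add: continuous_on_vec_lambda)
qed

lemma continuous_edge_fun: "continuous_on A (edge_fun G j r)"
  unfolding edge_fun_def Let_def by (intro continuous_intros)

locale fractured =
  fixes G :: fractured_domain
  assumes adm: "admissible G"
begin

lemma region: "open (region G)" "bounded (region G)" "region G \<noteq> {}"
  using adm by (auto simp: admissible_def)

lemma tets: "triangulation (tets G)" "\<And>K. K \<in> tets G \<Longrightarrow> 3 simplex K"
  "\<Union>(tets G) = closure (region G)"
  using adm by (auto simp: admissible_def)

lemma tris:
  assumes "j \<in> fractures G"
  shows "triangulation (tris G j)" "\<And>K. K \<in> tris G j \<Longrightarrow> 2 simplex K"
    "\<Union>(tris G j) = frac G j"
  using adm assms by (auto simp: admissible_def)

lemma frame:
  assumes "j \<in> fractures G"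
  shows "nrm G j \<bullet> nrm G j = 1" "tang1 G j \<bullet> tang1 G j = 1" "tang2 G j \<bullet> tang2 G j = 1"
    "nrm G j \<bullet> tang1 G j = 0" "nrm G j \<bullet> tang2 G j = 0" "tang1 G j \<bullet> tang2 G j = 0"
    "tang1 G j \<bullet> nrm G j = 0" "tang2 G j \<bullet> nrm G j = 0" "tang2 G j \<bullet> tang1 G j = 0"
  using adm assms by (auto simp: admissible_def norm_eq_1 inner_commute)

lemma fracture:
  assumes "j \<in> fractures G"
  shows "polygonal_region (frac G j) (corner G j)" "origin G j \<in> frac G j"
    "frac G j \<subseteq> frac_plane G j" "rel_interior (frac G j) \<subseteq> region G"
  using adm assms by (auto simp: admissible_def)

lemma fracture_disjoint:
  "i \<in> fractures G \<Longrightarrow> j \<in> fractures G \<Longrightarrow> i \<noteq> j \<Longrightarrow> frac G i \<inter> frac G j = {}"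
  using adm by (simp add: admissible_def)

lemma compact_frac: "j \<in> fractures G \<Longrightarrow> compact (frac G j)"
  using fracture(1) by (auto simp: polygonal_region_def)

lemma closed_frac: "j \<in> fractures G \<Longrightarrow> closed (frac G j)"
  using compact_frac compact_imp_closed by auto

lemma tip_exp_pos: "tip_exp G > 0"
  using adm by (simp add: admissible_def)

lemma tip_grad:
  assumes "j \<in> fractures G"
  shows "set_borel_measurable lebesgue (cut_region G) (grad (tip_fun G j))"
    "set_integrable lebesgue (cut_region G) (\<lambda>x. (norm (grad (tip_fun G j) x))\<^sup>2)"
  using adm assms by (auto simp: admissible_def)

text \<open>Three orthonormal vectors span the space; the difference of the two sides is orthogonal
  to each of them, hence to itself.\<close>

lemma frame_expand:
  assumes "j \<in> fractures G"
  shows "x = (nrm G j \<bullet> x) *\<^sub>R nrm G j + (x \<bullet> tang1 G j) *\<^sub>R tang1 G j + (x \<bullet> tang2 G j) *\<^sub>R tang2 G j"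
proof -
  let ?B = "{nrm G j, tang1 G j, tang2 G j}"
  note fr = frame[OF assms]
  have ne: "nrm G j \<noteq> tang1 G j" "nrm G j \<noteq> tang2 G j" "tang1 G j \<noteq> tang2 G j"
    using fr by auto
  have "pairwise orthogonal ?B" using fr by (auto simp: pairwise_def orthogonal_def)
  moreover have "0 \<notin> ?B" using fr by auto
  ultimately have ind: "independent ?B" by (rule pairwise_orthogonal_independent)
  have "card ?B = 3" using ne by simp
  then have "span ?B = UNIV"
    using card_ge_dim_independent[OF subset_UNIV ind] by (simp add: dim_UNIV top.extremum_unique)
  define y where "y = x - ((nrm G j \<bullet> x) *\<^sub>R nrm G j + (x \<bullet> tang1 G j) *\<^sub>R tang1 G j + (x \<bullet> tang2 G j) *\<^sub>R tang2 G j)"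
  have "orthogonal y b" if "b \<in> ?B" for b
    using that fr
    by (auto simp: y_def orthogonal_def inner_diff_left inner_add_left inner_commute[of "nrm G j" x])
  then have "orthogonal y y"
    using orthogonal_to_span[of y ?B y] \<open>span ?B = UNIV\<close> by auto
  then show ?thesis by (simp add: y_def orthogonal_def)
qed

lemma local_coords_chart:
  assumes "j \<in> fractures G"
  shows "local_coords G j (chart G j \<xi>) = \<xi>"
  using frame[OF assms] by (simp add: vec_eq_iff forall_2 local_coords_nth chart_def inner_add_left)

lemma chart_local_coords:
  assumes "j \<in> fractures G"
  shows "chart G j (local_coords G j x) = x - (nrm G j \<bullet> (x - origin G j)) *\<^sub>R nrm G j"
proof -
  have "x - origin G j = (nrm G j \<bullet> (x - origin G j)) *\<^sub>R nrm G j
    + ((x - origin G j) \<bullet> tang1 G j) *\<^sub>R tang1 G j + ((x - origin G j) \<bullet> tang2 G j) *\<^sub>R tang2 G j"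
    by (rule frame_expand[OF assms])
  moreover have "y + b + c = x - a" if "x - y = a + b + c" for y a b c :: R3
    using that by (simp add: algebra_simps)
  ultimately show ?thesis
    unfolding chart_def local_coords_nth by blast
qed

lemma chart_in_plane: "j \<in> fractures G \<Longrightarrow> chart G j \<xi> \<in> frac_plane G j"
  using frame[of j] by (simp add: frac_plane_def chart_def inner_add_right)

lemma plane_eq_chart: "j \<in> fractures G \<Longrightarrow> x \<in> frac_plane G j \<Longrightarrow> chart G j (local_coords G j x) = x"
  by (simp add: chart_local_coords frac_plane_def)

lemma dist_chart:
  assumes "j \<in> fractures G"
  shows "dist (chart G j \<xi>) (chart G j \<zeta>) = dist \<xi> \<zeta>"
proof -
  let ?d = "chart G j \<xi> - chart G j \<zeta>"
  have "?d = (\<xi>$1 - \<zeta>$1) *\<^sub>R tang1 G j + (\<xi>$2 - \<zeta>$2) *\<^sub>R tang2 G j"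
    by (simp add: chart_def algebra_simps)
  then have "?d \<bullet> ?d = (\<xi>$1 - \<zeta>$1) * (\<xi>$1 - \<zeta>$1) + (\<xi>$2 - \<zeta>$2) * (\<xi>$2 - \<zeta>$2)"
    using frame[OF assms] by (simp add: inner_add_left inner_add_right)
  also have "\<dots> = (\<xi> - \<zeta>) \<bullet> (\<xi> - \<zeta>)" by (simp add: inner_vec_def sum_2)
  finally have "?d \<bullet> ?d = (\<xi> - \<zeta>) \<bullet> (\<xi> - \<zeta>)" .
  then show ?thesis by (simp add: dist_norm norm_eq_sqrt_inner)
qed

lemma compact_frac_coords:
  assumes "j \<in> fractures G"
  shows "compact (frac_coords G j)"
proof -
  have "frac_coords G j = local_coords G j ` frac G j"
  proof (intro equalityI subsetI)
    fix \<xi> assume "\<xi> \<in> frac_coords G j"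
    then show "\<xi> \<in> local_coords G j ` frac G j"
      using local_coords_chart[OF assms, of \<xi>] by (intro image_eqI[of _ _ "chart G j \<xi>"]) (simp_all add: frac_coords_def)
  next
    fix \<xi> assume "\<xi> \<in> local_coords G j ` frac G j"
    then show "\<xi> \<in> frac_coords G j"
      using plane_eq_chart[OF assms] fracture(3)[OF assms] by (auto simp: frac_coords_def subset_iff)
  qed
  then show ?thesis
    using compact_frac[OF assms] by (simp add: compact_continuous_image continuous_local_coords)
qed

lemma edge_in_plane:
  assumes "j \<in> fractures G" "r < length (corner G j)"
  shows "edge (corner G j) r \<subseteq> frac_plane G j"
proof -
  have "edge (corner G j) r \<subseteq> rel_frontier (frac G j)"
    using fracture(1)[OF assms(1)] assms(2) by (auto simp: polygonal_region_def)
  also have "\<dots> \<subseteq> frac G j"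
    using closed_frac[OF assms(1)] by (auto simp: rel_frontier_def)
  finally show ?thesis using fracture(3)[OF assms(1)] by auto
qed

text \<open>Otherwise the edge direction would be orthogonal to both tangents and, the edge lying in
  the plane, also to the normal, although its two corners are distinct.\<close>

lemma edge_normal_nonzero:
  assumes "j \<in> fractures G" "r < length (corner G j)"
  shows "edge_normal G j r \<noteq> 0"
proof
  assume 0: "edge_normal G j r = 0"
  let ?ws = "corner G j"
  let ?d = "edge_end ?ws r - edge_start ?ws r"
  have "distinct ?ws" "3 \<le> length ?ws"
    using fracture(1)[OF assms(1)] by (auto simp: polygonal_region_def simple_polygon_def)
  moreover have "Suc r mod length ?ws \<noteq> r" "Suc r mod length ?ws < length ?ws"
    using assms(2) \<open>3 \<le> length ?ws\<close> by (auto simp: mod_Suc)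
  ultimately have ne: "?d \<noteq> 0"
    using assms(2) by (simp add: edge_end_def edge_start_def nth_eq_iff_index_eq)
  have "edge_start ?ws r \<in> edge ?ws r" "edge_end ?ws r \<in> edge ?ws r" by (auto simp: edge_def)
  then have "nrm G j \<bullet> ?d = 0"
    using edge_in_plane[OF assms] by (auto simp: frac_plane_def inner_diff_right subset_iff)
  moreover have "?d \<bullet> tang1 G j = 0" "?d \<bullet> tang2 G j = 0"
    using arg_cong[OF 0, of "\<lambda>v. v \<bullet> tang2 G j"] arg_cong[OF 0, of "\<lambda>v. v \<bullet> tang1 G j"] frame[OF assms(1)]
    by (simp_all add: edge_normal_def Let_def inner_diff_left)
  ultimately show False using frame_expand[OF assms(1), of ?d] ne by simp
qed

lemma nrm_nonzero: "j \<in> fractures G \<Longrightarrow> nrm G j \<noteq> 0"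
  by (metis frame(1) inner_zero_left zero_neq_one)

lemma wall_nonzero: "(a, b) \<in> walls G \<Longrightarrow> a \<noteq> 0"
  using edge_normal_nonzero nrm_nonzero by (auto simp: walls_def)

text \<open>A single triangle of the fracture mesh already has dimension 2, so the hull fills the
  plane. Relative interior of the fracture thus means interior within its plane.\<close>

lemma affine_hull_frac:
  assumes "j \<in> fractures G"
  shows "affine hull (frac G j) = frac_plane G j"
proof -
  have pl: "frac_plane G j = {x. nrm G j \<bullet> x = nrm G j \<bullet> origin G j}"
    by (auto simp: frac_plane_def inner_diff_right)
  have nz: "nrm G j \<noteq> 0" using frame(1)[OF assms] by auto
  have aff: "affine (frac_plane G j)" unfolding pl by (rule affine_hyperplane)
  have adp: "aff_dim (frac_plane G j) = 2"
    unfolding pl using nz by (simp add: aff_dim_hyperplane)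
  obtain K where K: "K \<in> tris G j"
    using tris(3)[OF assms] fracture(2)[OF assms] by auto
  have "aff_dim K = 2" using tris(2)[OF assms K] by (rule aff_dim_simplex)
  moreover have "K \<subseteq> frac G j" using K tris(3)[OF assms] by auto
  ultimately have "2 \<le> aff_dim (affine hull frac G j)" by (metis aff_dim_affine_hull aff_dim_subset)
  moreover have sub: "affine hull frac G j \<subseteq> frac_plane G j"
    using fracture(3)[OF assms] aff by (simp add: hull_minimal)
  ultimately have "aff_dim (affine hull frac G j) = aff_dim (frac_plane G j)"
    using aff_dim_subset[OF sub] adp by simp
  moreover have "affine hull frac G j \<noteq> {}" using fracture(2)[OF assms] by auto
  ultimately show ?thesis
    using affine_dim_equal[OF affine_affine_hull aff] sub by auto
qed

text \<open>The relative frontier consists of the edges, and on the whole line through an edge the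
  product with its normal vanishes.\<close>

lemma rel_interiorI:
  assumes "j \<in> fractures G" "x \<in> frac G j"
    "\<And>r. r < length (corner G j) \<Longrightarrow> edge_normal G j r \<bullet> (x - edge_start (corner G j) r) \<noteq> 0"
  shows "x \<in> rel_interior (frac G j)"
proof (rule ccontr)
  assume "x \<notin> rel_interior (frac G j)"
  then have "x \<in> rel_frontier (frac G j)"
    using assms(2) closure_subset by (auto simp: rel_frontier_def)
  then obtain r where r: "r < length (corner G j)" "x \<in> edge (corner G j) r"
    using fracture(1)[OF assms(1)] by (auto simp: polygonal_region_def)
  then obtain t where "x = (1 - t) *\<^sub>R edge_start (corner G j) r + t *\<^sub>R edge_end (corner G j) r"
    by (auto simp: edge_def in_segment)
  then have "x - edge_start (corner G j) r = t *\<^sub>R (edge_end (corner G j) r - edge_start (corner G j) r)"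
    by (simp add: algebra_simps)
  moreover have "edge_normal G j r \<bullet> (edge_end (corner G j) r - edge_start (corner G j) r) = 0"
    unfolding edge_normal_def Let_def inner_diff_left[of "_ *\<^sub>R _"] by (simp add: inner_commute)
  ultimately have "edge_normal G j r \<bullet> (x - edge_start (corner G j) r) = 0"
    by simp
  with assms(3)[OF r(1)] show False by simp
qed

text \<open>The chart is an isometry onto the plane, which is the affine hull of the fracture, so it
  carries relative interior points of the fracture back to interior points.\<close>

lemma frontier_frac_coords:
  assumes "j \<in> fractures G" "\<xi> \<in> frontier (frac_coords G j)"
  shows "\<exists>r<length (corner G j). edge_fun G j r \<xi> = 0"
proof (rule ccontr)
  assume "\<not> ?thesis"
  then have ne: "\<And>r. r < length (corner G j) \<Longrightarrow> edge_fun G j r (local_coords G j (chart G j \<xi>)) \<noteq> 0"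
    using local_coords_chart[OF assms(1)] by auto
  have "\<xi> \<in> frac_coords G j"
    using assms compact_frac_coords[OF assms(1)] compact_imp_closed frontier_subset_closed by blast
  then have "chart G j \<xi> \<in> rel_interior (frac G j)"
    using rel_interiorI[OF assms(1), of "chart G j \<xi>"] ne unfolding edge_fun_local_coords
    by (auto simp: frac_coords_def)
  then obtain e where e: "e > 0" "ball (chart G j \<xi>) e \<inter> frac_plane G j \<subseteq> frac G j"
    unfolding mem_rel_interior_ball affine_hull_frac[OF assms(1)] by auto
  have "ball \<xi> e \<subseteq> frac_coords G j"
  proof
    fix \<zeta> assume "\<zeta> \<in> ball \<xi> e"
    then have "chart G j \<zeta> \<in> ball (chart G j \<xi>) e" using dist_chart[OF assms(1)] by simp
    then show "\<zeta> \<in> frac_coords G j"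
      using e chart_in_plane[OF assms(1)] by (auto simp: frac_coords_def)
  qed
  then have "\<xi> \<in> interior (frac_coords G j)" using e by (auto simp: mem_interior)
  then show False using assms(2) by (simp add: frontier_def)
qed

end

section \<open>Almost everywhere transfer of measurability; regularity of the enrichments off the
  walls; good points\<close>

lemma complete_lebesgue_on:
  assumes "S \<in> sets lebesgue"
  shows "complete_measure (lebesgue_on S)"
proof
  fix A B :: "'a set"
  assume "B \<subseteq> A" "A \<in> null_sets (lebesgue_on S)"
  then have "A \<in> null_sets lebesgue" "A \<subseteq> S" using assms by (auto simp: null_sets_restrict_space)
  then have "B \<in> null_sets lebesgue" "B \<subseteq> S"
    using \<open>B \<subseteq> A\<close> completion.complete_measure_axioms null_sets_completion_subset by blast+
  then show "B \<in> sets (lebesgue_on S)"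
    using assms by (auto simp: sets_restrict_space_iff)
qed

text \<open>Gradients and traces are identified only almost everywhere; completeness lets them
  inherit measurability from explicit expressions.\<close>

lemma (in complete_measure) borel_measurable_AE_eq:
  assumes "f \<in> borel_measurable M" "AE x in M. f x = g x"
  shows "g \<in> borel_measurable M"
proof (rule measurableI)
  fix A :: "'b set" assume "A \<in> sets borel"
  then have "f -` A \<inter> space M \<in> sets M" using assms(1) by (rule_tac measurable_sets)
  moreover have "AE x in M. x \<in> f -` A \<inter> space M \<longleftrightarrow> x \<in> g -` A \<inter> space M"
    using assms(2) by (auto elim!: eventually_mono)
  ultimately show "g -` A \<inter> space M \<in> sets M"
    using in_sets_AE[of "f -` A \<inter> space M" "g -` A \<inter> space M"] by auto
qed simp

lemma tip_pow_continuous: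
  assumes "0 < p"
  shows "continuous_on UNIV (tip_pow p)"
proof (cases "p \<in> \<nat>")
  case True
  then have "tip_pow p = (\<lambda>t. t ^ nat \<lfloor>p\<rfloor>)" by (auto simp: tip_pow_def fun_eq_iff)
  then show ?thesis by (simp add: continuous_intros)
next
  case False
  then have "tip_pow p = (\<lambda>t. \<bar>t\<bar> powr p)" by (auto simp: tip_pow_def fun_eq_iff)
  moreover have "continuous_on UNIV (\<lambda>t::real. \<bar>t\<bar> powr p)"
    using assms by (intro continuous_on_powr') (auto intro!: continuous_intros)
  ultimately show ?thesis by simp
qed

lemma tip_pow_differentiable:
  assumes "t \<noteq> 0"
  shows "tip_pow p differentiable (at t)"
proof (cases "p \<in> \<nat>")
  case True
  then have "tip_pow p = (\<lambda>t. t ^ nat \<lfloor>p\<rfloor>)" by (auto simp: tip_pow_def fun_eq_iff)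
  then show ?thesis by simp
next
  case False
  then have "tip_pow p = (\<lambda>t. \<bar>t\<bar> powr p)" by (auto simp: tip_pow_def fun_eq_iff)
  \<comment> \<open>Squaring removes the kink of the absolute value: the new base is differentiable,
    and positive away from 0.\<close>
  also have "\<dots> = (\<lambda>t. (t\<^sup>2) powr (p / 2))"
  proof
    fix t :: real
    have "(t\<^sup>2) powr (p / 2) = (\<bar>t\<bar> powr 2) powr (p / 2)" by simp
    also have "\<dots> = \<bar>t\<bar> powr p" unfolding powr_powr by simp
    finally show "\<bar>t\<bar> powr p = (t\<^sup>2) powr (p / 2)" by simp
  qed
  finally have eq: "tip_pow p = (\<lambda>t. (t\<^sup>2) powr (p / 2))" .
  have "((\<lambda>t. t\<^sup>2) has_real_derivative 2 * t) (at t)"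
    by (auto intro!: derivative_eq_intros)
  from DERIV_fun_powr[OF this, of "p / 2"] assms
  show ?thesis unfolding eq by (auto simp: real_differentiable_def)
qed

text \<open>The factor of \<open>tip_fun\<close> free of cut-off and scaling. On each cell of the
  arrangement of walls \<open>tip_fun\<close> is a constant multiple of it.\<close>

definition tip_poly :: "fractured_domain \<Rightarrow> nat \<Rightarrow> real^2 \<Rightarrow> real" where
  "tip_poly G j \<xi> = (\<Prod>r\<in>interior_edges G j. tip_pow (tip_exp G) (edge_fun G j r \<xi>))"

text \<open>One-sided limits exist at good points because the two half balls separated by the fracture
  lie in single cells of the arrangement of walls; by \<open>AE_good\<close> below, almost every point of a
  fracture is good.\<close>

definition good :: "fractured_domain \<Rightarrow> nat \<Rightarrow> R3 \<Rightarrow> bool" where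
  "good G j x \<longleftrightarrow> (\<exists>e>0. ball x e \<subseteq> region G \<and>
     (\<forall>y\<in>ball x e. nrm G j \<bullet> (y - x) \<noteq> 0 \<longrightarrow> y \<in> off_walls G \<inter> cut_region G))"

context fractured
begin

lemma open_off_walls: "open (off_walls G)"
proof -
  have "off_walls G = (\<Inter>w\<in>walls G. {x. fst w \<bullet> (x - snd w) \<noteq> 0})"
    by (simp add: off_walls_def set_eq_iff split_beta)
  also have "open \<dots>"
    by (intro open_INT finite_walls ballI open_Collect_neq continuous_intros)
  finally show ?thesis .
qed

lemma edge_in_walls:
  "i \<in> fractures G \<Longrightarrow> r < length (corner G i) \<Longrightarrow> x \<in> off_walls G \<Longrightarrow>
    edge_fun G i r (local_coords G i x) \<noteq> 0"
  unfolding edge_fun_local_coords by (force simp: off_walls_def walls_def)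

text \<open>The plane of the fracture is itself a wall, and a connected set avoiding a plane stays
  on one side of it.\<close>

lemma heavi_const:
  assumes "i \<in> fractures G" "connected U" "U \<subseteq> off_walls G"
  obtains s where "\<And>x. x \<in> U \<Longrightarrow> heavi G i x = s"
proof (cases "U = {}")
  case False
  then obtain x0 where x0: "x0 \<in> U" by auto
  let ?f = "\<lambda>x. nrm G i \<bullet> (x - origin G i)"
  have nz: "?f x \<noteq> 0" if "x \<in> U" for x
    using assms(1,3) that by (force simp: off_walls_def walls_def)
  have no: False if "x \<in> U" "y \<in> U" "?f x < 0" "0 < ?f y" for x y
  proof -
    have "\<exists>z\<in>U. nrm G i \<bullet> z = nrm G i \<bullet> origin G i"
      using that by (intro connected_ivt_hyperplane[OF assms(2) that(1,2)]) (auto simp: inner_diff_right)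
    then show False using nz by (auto simp: inner_diff_right)
  qed
  have "heavi G i x = heavi G i x0" if "x \<in> U" for x
  proof -
    have "0 < ?f x \<longleftrightarrow> 0 < ?f x0"
      using nz[OF that] nz[OF x0] no[OF that x0] no[OF x0 that] by argo
    then show ?thesis using nz[OF that] nz[OF x0] by (simp add: heavi_def sgn_real_def)
  qed
  then show ?thesis by (rule that)
qed (use that in blast)

text \<open>The projection of \<open>U\<close> avoids the frontier of the fracture, whose points lie
  on edge lines and hence on walls; being connected, it is entirely inside or entirely outside. The
  constant is \<open>tip_scale\<close> inside, 0 outside, and 1 without interior edges, where the
  product is empty.\<close>

lemma tip_fun_form:
  assumes "i \<in> fractures G" "connected U" "U \<subseteq> off_walls G"
  obtains c where "\<And>x. x \<in> U \<Longrightarrow> tip_fun G i x = c * tip_poly G i (local_coords G i x)"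
proof -
  let ?L = "local_coords G i ` U"
  have "connected ?L" using assms(2) by (intro connected_continuous_image continuous_local_coords)
  moreover have "?L \<inter> frontier (frac_coords G i) = {}"
    using frontier_frac_coords[OF assms(1)] edge_in_walls[OF assms(1)] assms(3) by fastforce
  ultimately have dich: "?L \<inter> frac_coords G i = {} \<or> ?L \<subseteq> frac_coords G i"
    using connected_Int_frontier[of ?L "frac_coords G i"] by auto
  consider "interior_edges G i = {}" | "interior_edges G i \<noteq> {}" "?L \<inter> frac_coords G i = {}"
    | "interior_edges G i \<noteq> {}" "?L \<subseteq> frac_coords G i" using dich by blast
  then show ?thesis
  proof cases
    case 1
    then show ?thesis by (intro that[of 1]) (auto simp: tip_fun_def tip_poly_def)
  next
    case 2
    then show ?thesis by (intro that[of 0]) (auto simp: tip_fun_def frac_coords_def)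
  next
    case 3
    then show ?thesis
      by (intro that[of "tip_scale G i"]) (auto simp: tip_fun_def frac_coords_def tip_poly_def)
  qed
qed

lemma continuous_tip_poly: "continuous_on UNIV (tip_poly G i)"
  unfolding tip_poly_def
  by (intro continuous_on_prod continuous_on_compose2[OF tip_pow_continuous[OF tip_exp_pos]]
      continuous_edge_fun) auto

lemma tip_poly_differentiable:
  assumes "i \<in> fractures G" "x \<in> off_walls G"
  shows "(\<lambda>x. tip_poly G i (local_coords G i x)) differentiable (at x)"
proof -
  have "(\<lambda>x. tip_pow (tip_exp G) (edge_fun G i r (local_coords G i x))) differentiable (at x)"
    if "r \<in> interior_edges G i" for r
  proof -
    have r: "r < length (corner G i)" using that by (simp add: interior_edges_def)
    have "(\<lambda>x. edge_fun G i r (local_coords G i x)) differentiable (at x)"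
      unfolding edge_fun_local_coords by (auto intro!: derivative_intros)
    with tip_pow_differentiable[OF edge_in_walls[OF assms(1) r assms(2)]] show ?thesis
      by (rule differentiable_compose)
  qed
  then have "((\<lambda>x. tip_pow (tip_exp G) (edge_fun G i r (local_coords G i x))) has_derivative
      frechet_derivative (\<lambda>x. tip_pow (tip_exp G) (edge_fun G i r (local_coords G i x))) (at x)) (at x)"
    if "r \<in> interior_edges G i" for r
    using that frechet_derivative_works by auto
  from has_derivative_prod[of "interior_edges G i"
      "\<lambda>r x. tip_pow (tip_exp G) (edge_fun G i r (local_coords G i x))", OF this] show ?thesis
    by (auto simp: tip_poly_def differentiable_def)
qed

lemma AE_lebesgue_off_walls: "AE x in lebesgue. x \<in> off_walls G"
proof -
  have "negligible (\<Union>w\<in>walls G. {x. fst w \<bullet> x = fst w \<bullet> snd w})"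
    using finite_walls wall_nonzero by (intro negligible_Union) (auto intro!: negligible_hyperplane)
  from AE_lebesgue_not_in_negligible[OF this] show ?thesis
    by (rule eventually_mono) (auto simp: off_walls_def inner_diff_right)
qed

lemma nbhd_off_walls:
  assumes "x \<in> off_walls G"
  obtains e where "e > 0" "ball x e \<subseteq> off_walls G"
  using openE[OF open_off_walls assms] .

lemma AE_MS_iff:
  assumes "j \<in> fractures G"
  shows "(AE \<xi> in MS G j. P \<xi>) \<longleftrightarrow> (AE \<xi> in lebesgue. \<xi> \<in> frac_coords G j \<longrightarrow> P \<xi>)"
proof -
  have "frac_coords G j \<in> sets lebesgue"
    using lmeasurable_compact[OF compact_frac_coords[OF assms]] by auto
  then show ?thesis unfolding MS_def by (subst AE_restrict_space_iff) auto
qed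

lemma wall_parallel:
  assumes "j \<in> fractures G" "a \<bullet> tang1 G j = 0" "a \<bullet> tang2 G j = 0"
  shows "a = (nrm G j \<bullet> a) *\<^sub>R nrm G j"
  using frame_expand[OF assms(1), of a] assms by simp

text \<open>Walls not parallel to the fracture meet its plane in at most a line; these null sets are
  removed. A remaining wall through the point must be the fracture plane itself, so it misses all
  points off that plane. Every other wall and every other fracture keeps a positive
  distance.\<close>

lemma AE_good:
  assumes j: "j \<in> fractures G"
  shows "AE \<xi> in MS G j. good G j (chart G j \<xi>)"
proof -
  \<comment> \<open>The wall is parallel to the fracture: its normal is a multiple of
    \<open>nrm G j\<close>.\<close>
  define P where "P w \<longleftrightarrow> fst w \<bullet> tang1 G j = 0 \<and> fst w \<bullet> tang2 G j = 0" for w :: "R3 \<times> R3"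
  define N where "N = (\<Union>w\<in>{w\<in>walls G. \<not> P w}. {\<xi>. fst w \<bullet> (chart G j \<xi> - snd w) = 0})"
  have "negligible {\<xi>. fst w \<bullet> (chart G j \<xi> - snd w) = 0}" if "\<not> P w" for w
  proof -
    let ?v = "vector [fst w \<bullet> tang1 G j, fst w \<bullet> tang2 G j] :: real^2"
    have "?v \<noteq> 0" using that by (auto simp: P_def vec_eq_iff forall_2)
    moreover have "{\<xi>. fst w \<bullet> (chart G j \<xi> - snd w) = 0} = {\<xi>. ?v \<bullet> \<xi> = fst w \<bullet> snd w - fst w \<bullet> origin G j}"
      by (auto simp: chart_def inner_diff_right inner_add_right inner_vec_def[of ?v] sum_2 algebra_simps)
    ultimately show ?thesis by (simp add: negligible_hyperplane)
  qed
  then have "negligible N"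
    unfolding N_def using finite_walls by (intro negligible_Union) auto
  then have "AE \<xi> in lebesgue. \<xi> \<notin> N" by (rule AE_lebesgue_not_in_negligible)
  then show ?thesis
    unfolding AE_MS_iff[OF j]
  proof (rule eventually_mono, intro impI)
    fix \<xi> assume \<xi>: "\<xi> \<notin> N" "\<xi> \<in> frac_coords G j"
    let ?x = "chart G j \<xi>"
    have xF: "?x \<in> frac G j" using \<xi> by (simp add: frac_coords_def)
    \<comment> \<open>The walls through the edges are orthogonal to the fracture, hence among those
      removed; so the point is on no edge and lies in the region.\<close>
    have "?x \<in> rel_interior (frac G j)"
    proof (rule rel_interiorI[OF j xF])
      fix r assume r: "r < length (corner G j)"
      let ?w = "(edge_normal G j r, edge_start (corner G j) r)"
      have "?w \<in> walls G" using r j by (force simp: walls_def)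
      moreover have "\<not> P ?w"
      proof
        assume "P ?w"
        then have "edge_normal G j r = (nrm G j \<bullet> edge_normal G j r) *\<^sub>R nrm G j"
          by (intro wall_parallel[OF j]) (auto simp: P_def)
        moreover have "nrm G j \<bullet> edge_normal G j r = 0"
          using frame[OF j] by (simp add: edge_normal_def Let_def inner_diff_right)
        ultimately show False using edge_normal_nonzero[OF j r] by simp
      qed
      ultimately show "edge_normal G j r \<bullet> (?x - edge_start (corner G j) r) \<noteq> 0"
        using \<xi>(1) by (force simp: N_def)
    qed
    then have "?x \<in> region G" using fracture(4)[OF j] by auto
    then have ev1: "eventually (\<lambda>y. y \<in> region G) (nhds ?x)"
      using region(1) eventually_nhds by blast
    have "eventually (\<lambda>y. nrm G j \<bullet> (y - ?x) \<noteq> 0 \<longrightarrow> fst w \<bullet> (y - snd w) \<noteq> 0) (nhds ?x)"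
      if w: "w \<in> walls G" for w
    proof (cases "fst w \<bullet> (?x - snd w) = 0")
      case False
      have "open {y. fst w \<bullet> (y - snd w) \<noteq> 0}" by (intro open_Collect_neq continuous_intros)
      then have "eventually (\<lambda>y. y \<in> {y. fst w \<bullet> (y - snd w) \<noteq> 0}) (nhds ?x)"
        using False eventually_nhds by blast
      then show ?thesis by (rule eventually_mono) auto
    next
      case True
      then have "P w" using w \<xi>(1) by (cases w) (auto simp: N_def)
      then have a: "fst w = (nrm G j \<bullet> fst w) *\<^sub>R nrm G j"
        by (intro wall_parallel[OF j]) (auto simp: P_def)
      have nz: "nrm G j \<bullet> fst w \<noteq> 0"
        using a wall_nonzero[of "fst w" "snd w"] w by (metis prod.collapse scale_eq_0_iff)
      have "fst w \<bullet> (y - snd w) \<noteq> 0" if "nrm G j \<bullet> (y - ?x) \<noteq> 0" for y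
      proof -
        have "fst w \<bullet> (y - snd w) = fst w \<bullet> (y - ?x)" using True by (simp add: inner_diff_right)
        also have "\<dots> = (nrm G j \<bullet> fst w) * (nrm G j \<bullet> (y - ?x))"
          by (subst a) simp
        finally show ?thesis using nz that by simp
      qed
      then show ?thesis by (simp add: eventuallyI)
    qed
    then have ev2: "eventually (\<lambda>y. \<forall>w\<in>walls G. nrm G j \<bullet> (y - ?x) \<noteq> 0 \<longrightarrow> fst w \<bullet> (y - snd w) \<noteq> 0) (nhds ?x)"
      by (intro eventually_ball_finite finite_walls) auto
    have "eventually (\<lambda>y. i \<noteq> j \<longrightarrow> y \<notin> frac G i) (nhds ?x)" if "i \<in> fractures G" for i
    proof (cases "i = j")
      case False
      then have "?x \<in> - frac G i" using fracture_disjoint[OF that j] xF by auto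
      then have "eventually (\<lambda>y. y \<in> - frac G i) (nhds ?x)"
        using closed_frac[OF that] eventually_nhds by blast
      then show ?thesis by (rule eventually_mono) auto
    qed simp
    then have ev3: "eventually (\<lambda>y. \<forall>i\<in>fractures G. i \<noteq> j \<longrightarrow> y \<notin> frac G i) (nhds ?x)"
      by (intro eventually_ball_finite) auto
    have "eventually (\<lambda>y. y \<in> region G \<and> (nrm G j \<bullet> (y - ?x) \<noteq> 0 \<longrightarrow> y \<in> off_walls G \<inter> cut_region G)) (nhds ?x)"
      using ev1 ev2 ev3
    proof eventually_elim
      case (elim y)
      have "y \<notin> frac G j" if "nrm G j \<bullet> (y - ?x) \<noteq> 0"
      proof
        assume "y \<in> frac G j"
        then have "nrm G j \<bullet> (y - origin G j) = 0" "nrm G j \<bullet> (?x - origin G j) = 0"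
          using fracture(3)[OF j] xF by (auto simp: frac_plane_def)
        then show False using that by (simp add: inner_diff_right)
      qed
      then show ?case using elim by (auto simp: off_walls_def cut_region_def)
    qed
    then obtain e where "e > 0" "\<And>y. dist y ?x < e \<Longrightarrow>
       y \<in> region G \<and> (nrm G j \<bullet> (y - ?x) \<noteq> 0 \<longrightarrow> y \<in> off_walls G \<inter> cut_region G)"
      unfolding eventually_nhds_metric by auto
    then show "good G j ?x"
      unfolding good_def by (intro exI[of _ e]) (auto simp: dist_commute)
  qed
qed

text \<open>This sequence along the normal witnesses that the one-sided filter is nontrivial, so
  that \<open>Lim\<close> is determined; it also presents traces as sequential limits, from which
  their measurability follows.\<close>

lemma good_approach:
  assumes j: "j \<in> fractures G" and "good G j x" and s: "s \<in> {-1, 1}"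
  shows "filterlim (\<lambda>m. x + (s / real (Suc m)) *\<^sub>R nrm G j) (side_filter G j s x) sequentially"
proof -
  obtain e where e: "e > 0"
    "\<And>y. y \<in> ball x e \<Longrightarrow> nrm G j \<bullet> (y - x) \<noteq> 0 \<Longrightarrow> y \<in> off_walls G \<inter> cut_region G"
    using assms(2) unfolding good_def by blast
  let ?y = "\<lambda>m. x + (s / real (Suc m)) *\<^sub>R nrm G j"
  have "(\<lambda>m. s / real (Suc m)) \<longlonglongrightarrow> 0"
    using LIMSEQ_Suc[OF lim_const_over_n[of s]] by simp
  then have "?y \<longlonglongrightarrow> x + 0 *\<^sub>R nrm G j" by (intro tendsto_intros)
  then have lim: "?y \<longlonglongrightarrow> x" by simp
  have n: "nrm G j \<bullet> (?y m - x) = s / real (Suc m)" for m using frame(1)[OF j] by simp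
  have pos: "0 < s * (nrm G j \<bullet> (?y m - x))" for m
    unfolding n using s by (auto simp: field_simps)
  have "eventually (\<lambda>m. dist (?y m) x < e) sequentially"
    using tendstoD[OF lim e(1)] .
  then have "eventually (\<lambda>m. ?y m \<in> side G j s x \<and> ?y m \<noteq> x) sequentially"
  proof (rule eventually_mono)
    fix m assume d: "dist (?y m) x < e"
    have "nrm G j \<bullet> (?y m - x) \<noteq> 0" using pos[of m] by auto
    then have "?y m \<in> cut_region G" "?y m \<noteq> x"
      using e(2)[of "?y m"] d by (auto simp: dist_commute)
    then show "?y m \<in> side G j s x \<and> ?y m \<noteq> x" using pos[of m] by (simp add: side_def)
  qed
  then show ?thesis using lim by (simp add: filterlim_at)
qed

lemma good_nontrivial:
  assumes "j \<in> fractures G" "good G j x" "s \<in> {-1, 1}"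
  shows "side_filter G j s x \<noteq> bot"
proof
  assume "at x within side G j s x = bot"
  then have "filterlim (\<lambda>m. x + (s / real (Suc m)) *\<^sub>R nrm G j) bot sequentially"
    using good_approach[OF assms] by simp
  then show False by (auto simp: filterlim_iff dest: spec[of _ "\<lambda>_. False"])
qed

lemma tr_eq:
  assumes "j \<in> fractures G" "good G j x" "s \<in> {-1, 1}" "(q \<longlongrightarrow> l) (side_filter G j s x)"
  shows "tr G j s q x = l"
  unfolding tr_def using good_nontrivial[OF assms(1-3)] assms(4) by (rule tendsto_Lim)

lemma good_half_ball:
  assumes "j \<in> fractures G" "good G j x"
  obtains U where "convex U" "U \<subseteq> off_walls G"
    "eventually (\<lambda>y. y \<in> U) (side_filter G j s x)"
proof -
  obtain e where e: "e > 0"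
    "\<And>y. y \<in> ball x e \<Longrightarrow> nrm G j \<bullet> (y - x) \<noteq> 0 \<Longrightarrow> y \<in> off_walls G \<inter> cut_region G"
    using assms(2) unfolding good_def by blast
  let ?U = "ball x e \<inter> {y. 0 < s * (nrm G j \<bullet> (y - x))}"
  show ?thesis
  proof (rule that[of ?U])
    have "{y. 0 < s * (nrm G j \<bullet> (y - x))} = {y. (s *\<^sub>R nrm G j) \<bullet> y > (s *\<^sub>R nrm G j) \<bullet> x}"
      by (auto simp: inner_diff_right algebra_simps)
    then show "convex ?U"
      by (auto intro!: convex_Int convex_halfspace_gt simp del: inner_scaleR_left)
    show "?U \<subseteq> off_walls G" using e(2) by fastforce
    show "eventually (\<lambda>y. y \<in> ?U) (side_filter G j s x)"
      unfolding eventually_at using e(1)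
      by (intro exI[of _ e]) (auto simp: side_def dist_commute)
  qed
qed

end

section \<open>Piecewise linear functions\<close>

lemma P1_affine:
  assumes "q \<in> P1 T" "K \<in> T"
  obtains a b where "\<And>x. x \<in> K \<Longrightarrow> q x = a \<bullet> x + b"
proof -
  have "\<exists>a b. \<forall>x\<in>K. q x = a \<bullet> x + b" using assms by (simp add: P1_def)
  then show ?thesis using that by (elim exE) auto
qed

lemma subspace_P1: "subspace (P1 T)"
proof (rule subspaceI)
  show "0 \<in> P1 T" by (auto simp: P1_def zero_fun_def intro!: exI[of _ 0])
next
  fix f g assume fg: "f \<in> P1 T" "g \<in> P1 T"
  have "\<exists>a b. \<forall>x\<in>K. (f + g) x = a \<bullet> x + b" if K: "K \<in> T" for K
  proof -
    obtain a b where ab: "\<And>x. x \<in> K \<Longrightarrow> f x = a \<bullet> x + b" using P1_affine[OF fg(1) K] by auto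
    obtain a' b' where ab': "\<And>x. x \<in> K \<Longrightarrow> g x = a' \<bullet> x + b'" using P1_affine[OF fg(2) K] by auto
    show ?thesis
      by (rule exI[of _ "a + a'"], rule exI[of _ "b + b'"]) (simp add: ab ab' inner_add_left)
  qed
  then show "f + g \<in> P1 T" using fg by (auto simp: P1_def plus_fun_def intro: continuous_on_add)
next
  fix c f assume f: "f \<in> P1 T"
  have "\<exists>a b. \<forall>x\<in>K. (c *\<^sub>R f) x = a \<bullet> x + b" if K: "K \<in> T" for K
  proof -
    obtain a b where ab: "\<And>x. x \<in> K \<Longrightarrow> f x = a \<bullet> x + b" using P1_affine[OF f K] by auto
    show ?thesis
      by (rule exI[of _ "c *\<^sub>R a"], rule exI[of _ "c * b"]) (simp add: ab scaleR_fun_apply algebra_simps)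
  qed
  then show "c *\<^sub>R f \<in> P1 T"
    using f by (auto simp: P1_def scaleR_fun_def intro!: continuous_on_mult_left)
qed

lemma triangulation_compact:
  assumes "triangulation T"
  shows "finite T" "\<And>K. K \<in> T \<Longrightarrow> compact K" "\<And>K. K \<in> T \<Longrightarrow> convex K" "compact (\<Union>T)"
proof -
  show fin: "finite T" and *: "\<And>K. K \<in> T \<Longrightarrow> compact K" "\<And>K. K \<in> T \<Longrightarrow> convex K"
    using assms compact_simplex convex_simplex unfolding triangulation_def by blast+
  then show "compact (\<Union>T)" by (intro compact_Union) auto
qed

lemma P1_borel_bounded:
  assumes "triangulation T" "q \<in> P1 T"
  shows "q \<in> borel_measurable borel" "\<exists>B. \<forall>x. \<bar>q x\<bar> \<le> B"
proof -
  have c: "compact (\<Union>T)" using triangulation_compact[OF assms(1)] by simp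
  have q: "continuous_on (\<Union>T) q" "\<And>x. x \<notin> \<Union>T \<Longrightarrow> q x = 0" using assms(2) by (auto simp: P1_def)
  have "q = (\<lambda>x. if x \<in> \<Union>T then q x else 0)" using q(2) by (auto simp: fun_eq_iff)
  also have "\<dots> \<in> borel_measurable borel"
    using q(1) compact_imp_closed[OF c] by (intro borel_measurable_continuous_on_if) auto
  finally show "q \<in> borel_measurable borel" .
  have "bounded (q ` \<Union>T)" using compact_continuous_image[OF q(1) c] compact_imp_bounded by blast
  then obtain B where B: "\<And>x. x \<in> \<Union>T \<Longrightarrow> \<bar>q x\<bar> \<le> B" by (force simp: bounded_iff)
  have "\<bar>q x\<bar> \<le> max B 0" for x
    using B[of x] q(2)[of x] by (cases "x \<in> \<Union>T") (auto simp: max_def)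
  then show "\<exists>B. \<forall>x. \<bar>q x\<bar> \<le> B" by blast
qed

lemma finite_mesh_vertices:
  assumes "triangulation T"
  shows "finite (mesh_vertices T)"
proof -
  have "mesh_vertices T = (\<Union>K\<in>T. {x. x extreme_point_of K})" by (auto simp: mesh_vertices_def)
  moreover have "finite {x. x extreme_point_of K}" if "K \<in> T" for K
    using assms that finite_polyhedron_extreme_points simplex_imp_polyhedron
    unfolding triangulation_def by blast
  ultimately show ?thesis using triangulation_compact(1)[OF assms] by simp
qed

text \<open>On an element the function is affine, and the element is the convex hull of its extreme
  points by Krein-Milman, so vanishing there propagates to all of it.\<close>

lemma P1_determined_by_vertices:
  assumes T: "triangulation T" and q: "q \<in> P1 T" and 0: "\<And>x. x \<in> mesh_vertices T \<Longrightarrow> q x = 0"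
  shows "q = 0"
proof
  fix x
  show "q x = 0 x"
  proof (cases "x \<in> \<Union>T")
    case False
    then show ?thesis using q by (auto simp: P1_def)
  next
    case True
    then obtain K where K: "K \<in> T" "x \<in> K" by auto
    obtain a b where ab: "\<And>x. x \<in> K \<Longrightarrow> q x = a \<bullet> x + b" using P1_affine[OF q K(1)] by auto
    have KM: "K = convex hull {x. x extreme_point_of K}"
      using Krein_Milman_Minkowski triangulation_compact(2,3)[OF T K(1)] by blast
    have "{x. x extreme_point_of K} \<subseteq> {x. a \<bullet> x = - b}"
    proof
      fix y assume "y \<in> {x. x extreme_point_of K}"
      then have "y \<in> mesh_vertices T" "y \<in> K" using K by (auto simp: mesh_vertices_def extreme_point_of_def)
      then show "y \<in> {x. a \<bullet> x = - b}" using 0[of y] ab[of y] by simp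
    qed
    then have "K \<subseteq> {x. a \<bullet> x = - b}"
      using hull_minimal[of "{x. x extreme_point_of K}" "{x. a \<bullet> x = - b}" convex] KM
      by (simp add: convex_hyperplane)
    then show ?thesis using K ab by auto
  qed
qed

lemma P1_finite_dim:
  assumes "triangulation T"
  obtains B where "finite B" "P1 T \<subseteq> span B"
  by (rule finite_dim_if_determined_by_values[OF subspace_P1 finite_mesh_vertices[OF assms]
      P1_determined_by_vertices[OF assms]])

section \<open>Measures on the cut domain and on the fractures\<close>

lemma borel_measurable_lebesgue_on:
  "f \<in> borel_measurable borel \<Longrightarrow> f \<in> borel_measurable (lebesgue_on S)"
  by (simp add: measurable_completion measurable_restrict_space1)

text \<open>Meant for gradients of piecewise linear functions: they are constant on the interiors of
  the elements, which exhaust the domain up to a null set, and completeness ignores the values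
  elsewhere.\<close>

lemma piecewise_constant_measurable:
  fixes f :: "'a::euclidean_space \<Rightarrow> 'b::euclidean_space"
  assumes S: "S \<in> lmeasurable" and fin: "finite I" and U: "\<And>i. i \<in> I \<Longrightarrow> open (U i)"
    and c: "\<And>i x. i \<in> I \<Longrightarrow> x \<in> U i \<Longrightarrow> f x = c i"
    and ae: "AE x in lebesgue_on S. x \<in> (\<Union>i\<in>I. U i)"
  shows "f \<in> borel_measurable (lebesgue_on S)" "AE x in lebesgue_on S. norm (f x) \<le> (\<Sum>i\<in>I. norm (c i))"
    "sqint (lebesgue_on S) f"
proof -
  let ?U = "\<Union>i\<in>I. U i"
  let ?g = "\<lambda>x. if x \<in> ?U then f x else 0"
  interpret complete_measure "lebesgue_on S" using S by (intro complete_lebesgue_on) auto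
  have "continuous_on (U i) f" if "i \<in> I" for i
    using c[OF that] continuous_on_cong[of "U i" "U i" f "\<lambda>_. c i"] by simp
  then have "continuous_on ?U f" using U by (intro continuous_on_open_UN) auto
  then have "?g \<in> borel_measurable borel"
    using U by (intro borel_measurable_continuous_on_if borel_open open_UN) auto
  then have "?g \<in> borel_measurable (lebesgue_on S)" by (rule borel_measurable_lebesgue_on)
  then show meas: "f \<in> borel_measurable (lebesgue_on S)"
    by (rule borel_measurable_AE_eq) (use ae in \<open>auto elim!: eventually_mono\<close>)
  show bd: "AE x in lebesgue_on S. norm (f x) \<le> (\<Sum>i\<in>I. norm (c i))"
    using ae
  proof (rule eventually_mono)
    fix x assume "x \<in> ?U"
    then obtain i where i: "i \<in> I" "x \<in> U i" by auto
    show "norm (f x) \<le> (\<Sum>i\<in>I. norm (c i))"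
      using member_le_sum[OF i(1), of "\<lambda>i. norm (c i)"] fin c[OF i] by simp
  qed
  show "sqint (lebesgue_on S) f"
    using finite_measure_lebesgue_on[OF S] meas bd by (rule sqint_bounded)
qed

context fractured
begin

lemma cut_region_sets: "cut_region G \<in> sets borel" "cut_region G \<in> lmeasurable"
proof -
  have "closed (\<Union>j\<in>fractures G. frac G j)"
    using closed_frac by (intro closed_UN) auto
  then show *: "cut_region G \<in> sets borel"
    unfolding cut_region_def using region(1) by auto
  have "bounded (cut_region G)"
    using region(2) by (rule bounded_subset) (auto simp: cut_region_def)
  then show "cut_region G \<in> lmeasurable"
    using * by (intro bounded_set_imp_lmeasurable) auto
qed

lemma frac_coords_lmeasurable: "j \<in> fractures G \<Longrightarrow> frac_coords G j \<in> lmeasurable"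
  using lmeasurable_compact[OF compact_frac_coords] .

lemma finite_MV: "finite_measure (MV G)"
  unfolding MV_def using cut_region_sets(2) by (rule finite_measure_lebesgue_on)

lemma finite_MS: "j \<in> fractures G \<Longrightarrow> finite_measure (MS G j)"
  unfolding MS_def using frac_coords_lmeasurable by (rule finite_measure_lebesgue_on)

lemma complete_MV: "complete_measure (MV G)"
  unfolding MV_def using cut_region_sets(2) by (intro complete_lebesgue_on) auto

lemma complete_MS: "j \<in> fractures G \<Longrightarrow> complete_measure (MS G j)"
  unfolding MS_def using frac_coords_lmeasurable by (intro complete_lebesgue_on) auto

lemma vol_int_eq: "vol_int G f = (\<integral>x. f x \<partial>MV G)"
  unfolding vol_int_def MV_def set_lebesgue_integral_def
  using cut_region_sets(2) by (subst integral_restrict_space) auto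

lemma surf_int_eq: "j \<in> fractures G \<Longrightarrow> surf_int G j f = (\<integral>\<xi>. f (chart G j \<xi>) \<partial>MS G j)"
  unfolding surf_int_def MS_def set_lebesgue_integral_def
  using frac_coords_lmeasurable[of j] by (subst integral_restrict_space) (auto simp: frac_coords_def)

lemma AE_MV_iff: "(AE x in MV G. P x) \<longleftrightarrow> (AE x in lebesgue. x \<in> cut_region G \<longrightarrow> P x)"
  unfolding MV_def using cut_region_sets(2) by (subst AE_restrict_space_iff) auto

lemma borel_measurable_MV: "f \<in> borel_measurable borel \<Longrightarrow> f \<in> borel_measurable (MV G)"
  unfolding MV_def by (rule borel_measurable_lebesgue_on)

lemma chart_borel: "chart G j \<in> borel_measurable borel"
  by (rule borel_measurable_continuous_onI) (rule continuous_chart)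

lemma borel_measurable_MS:
  assumes "f \<in> borel_measurable borel"
  shows "(\<lambda>\<xi>. f (chart G j \<xi>)) \<in> borel_measurable (MS G j)"
  unfolding MS_def using measurable_compose[OF chart_borel assms]
  by (rule borel_measurable_lebesgue_on)

section \<open>An algebra of functions with traces and square integrable gradients\<close>

text \<open>Boundedness makes this a class closed under products, which the enrichments are: in the
  product rule each gradient meets a bounded factor. Borel rather than Lebesgue measurability is
  asked for because the functions are also evaluated on fracture planes, which are null sets in
  space.\<close>

definition W :: "(R3 \<Rightarrow> real) set" where
  "W = {q. q \<in> borel_measurable borel \<and> (\<exists>B. \<forall>x. \<bar>q x\<bar> \<le> B) \<and>
     (AE x in MV G. q differentiable (at x)) \<and> sqint (MV G) (grad q) \<and>
     (\<forall>j\<in>fractures G. \<forall>s\<in>{-1, 1}. AE \<xi> in MS G j.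
        \<exists>l. (q \<longlongrightarrow> l) (side_filter G j s (chart G j \<xi>)))}"

lemma W_D:
  assumes "q \<in> W"
  shows "q \<in> borel_measurable borel" "\<exists>B. \<forall>x. \<bar>q x\<bar> \<le> B" "AE x in MV G. q differentiable (at x)"
    "sqint (MV G) (grad q)"
    "\<And>j s. j \<in> fractures G \<Longrightarrow> s \<in> {-1, 1} \<Longrightarrow> AE \<xi> in MS G j.
        \<exists>l. (q \<longlongrightarrow> l) (side_filter G j s (chart G j \<xi>))"
  using assms unfolding W_def by blast+

lemma W_sqint:
  assumes "q \<in> W"
  shows "sqint (MV G) q"
proof -
  obtain B where "\<forall>x. \<bar>q x\<bar> \<le> B" using W_D(2)[OF assms] by blast
  then show ?thesis
    by (intro sqint_bounded[OF finite_MV borel_measurable_MV[OF W_D(1)[OF assms]], of B]) auto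
qed

lemma grad_lincomb:
  assumes "p \<in> W" "q \<in> W"
  shows "AE x in MV G. grad (a *\<^sub>R p + b *\<^sub>R q) x = a *\<^sub>R grad p x + b *\<^sub>R grad q x"
  using W_D(3)[OF assms(1)] W_D(3)[OF assms(2)]
proof eventually_elim
  case (elim x)
  then have "GDERIV (\<lambda>y. a * p y + b * q y) x :> a *\<^sub>R grad p x + b *\<^sub>R grad q x"
    by (intro GDERIV_lincomb differentiable_imp_GDERIV)
  moreover have "(\<lambda>y. a * p y + b * q y) = a *\<^sub>R p + b *\<^sub>R q"
    by (simp add: fun_eq_iff scaleR_fun_apply)
  ultimately show ?case using grad_eqI by metis
qed

lemma W_lincomb:
  assumes p: "p \<in> W" and q: "q \<in> W"
  shows "a *\<^sub>R p + b *\<^sub>R q \<in> W"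
proof -
  let ?f = "a *\<^sub>R p + b *\<^sub>R q"
  have f: "?f = (\<lambda>y. a * p y + b * q y)"
    by (simp add: fun_eq_iff scaleR_fun_apply)
  note [measurable] = W_D(1)[OF p] W_D(1)[OF q]
  obtain A B where AB: "\<forall>x. \<bar>p x\<bar> \<le> A" "\<forall>x. \<bar>q x\<bar> \<le> B" using W_D(2)[OF p] W_D(2)[OF q] by blast
  have "\<bar>?f x\<bar> \<le> \<bar>a\<bar> * A + \<bar>b\<bar> * B" for x
  proof -
    have "\<bar>?f x\<bar> \<le> \<bar>a\<bar> * \<bar>p x\<bar> + \<bar>b\<bar> * \<bar>q x\<bar>" unfolding f by (metis abs_mult abs_triangle_ineq)
    also have "\<dots> \<le> \<bar>a\<bar> * A + \<bar>b\<bar> * B" using AB by (intro add_mono mult_left_mono) auto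
    finally show ?thesis .
  qed
  moreover have "?f \<in> borel_measurable borel" unfolding f by measurable
  moreover have "AE x in MV G. ?f differentiable (at x)"
    using W_D(3)[OF p] W_D(3)[OF q]
  proof eventually_elim
    case (elim x)
    then show ?case unfolding f by simp
  qed
  moreover have "sqint (MV G) (grad ?f)"
  proof -
    have L: "sqint (MV G) (\<lambda>x. a *\<^sub>R grad p x + b *\<^sub>R grad q x)"
      by (rule sqint_lincomb[OF W_D(4)[OF p] W_D(4)[OF q]])
    have eq: "AE x in MV G. a *\<^sub>R grad p x + b *\<^sub>R grad q x = grad ?f x"
      using grad_lincomb[OF p q, of a b] by eventually_elim simp
    have "grad ?f \<in> borel_measurable (MV G)"
      using complete_measure.borel_measurable_AE_eq[OF complete_MV sqint_measurable[OF L] eq] .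
    from sqint_cong_AE[OF grad_lincomb[OF p q] this L] show ?thesis .
  qed
  moreover have "AE \<xi> in MS G j. \<exists>l. (?f \<longlongrightarrow> l) (side_filter G j s (chart G j \<xi>))"
    if js: "j \<in> fractures G" "s \<in> {-1, 1}" for j s
    using W_D(5)[OF p js] W_D(5)[OF q js]
  proof eventually_elim
    case (elim \<xi>)
    then obtain l m where "(p \<longlongrightarrow> l) (side_filter G j s (chart G j \<xi>))"
      "(q \<longlongrightarrow> m) (side_filter G j s (chart G j \<xi>))" by blast
    then have "(?f \<longlongrightarrow> a * l + b * m) (side_filter G j s (chart G j \<xi>))"
      unfolding f by (intro tendsto_intros)
    then show ?case by blast
  qed
  ultimately show ?thesis unfolding W_def by blast
qed

lemma W_mult:
  assumes p: "p \<in> W" and q: "q \<in> W"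
  shows "(\<lambda>x. p x * q x) \<in> W"
proof -
  let ?f = "\<lambda>x. p x * q x"
  note [measurable] = W_D(1)[OF p] W_D(1)[OF q]
  obtain A B where AB: "\<forall>x. \<bar>p x\<bar> \<le> A" "\<forall>x. \<bar>q x\<bar> \<le> B" using W_D(2)[OF p] W_D(2)[OF q] by blast
  have "\<bar>?f x\<bar> \<le> A * B" for x
    unfolding abs_mult using AB abs_ge_zero[of "p x"] by (intro mult_mono) (auto intro: order_trans)
  moreover have "?f \<in> borel_measurable borel" by measurable
  moreover have "AE x in MV G. ?f differentiable (at x)"
    using W_D(3)[OF p] W_D(3)[OF q] by eventually_elim simp
  moreover have "sqint (MV G) (grad ?f)"
  proof -
    have "sqint (MV G) (\<lambda>x. p x *\<^sub>R grad q x)" "sqint (MV G) (\<lambda>x. q x *\<^sub>R grad p x)"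
      using AB by (auto intro!: sqint_mult_bounded W_D(4)[OF p] W_D(4)[OF q] borel_measurable_MV)
    then have L: "sqint (MV G) (\<lambda>x. p x *\<^sub>R grad q x + q x *\<^sub>R grad p x)" by (rule sqint_add)
    have eq: "AE x in MV G. p x *\<^sub>R grad q x + q x *\<^sub>R grad p x = grad ?f x"
      using W_D(3)[OF p] W_D(3)[OF q]
    proof eventually_elim
      case (elim x)
      then show ?case
        by (intro grad_eqI[symmetric] GDERIV_mult differentiable_imp_GDERIV)
    qed
    have "grad ?f \<in> borel_measurable (MV G)"
      using complete_measure.borel_measurable_AE_eq[OF complete_MV sqint_measurable[OF L] eq] .
    moreover have "AE x in MV G. grad ?f x = p x *\<^sub>R grad q x + q x *\<^sub>R grad p x"
      using eq by eventually_elim simp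
    ultimately show ?thesis by (intro sqint_cong_AE[OF _ _ L])
  qed
  moreover have "AE \<xi> in MS G j. \<exists>l. (?f \<longlongrightarrow> l) (side_filter G j s (chart G j \<xi>))"
    if js: "j \<in> fractures G" "s \<in> {-1, 1}" for j s
    using W_D(5)[OF p js] W_D(5)[OF q js] by eventually_elim (blast intro: tendsto_mult)
  ultimately show ?thesis unfolding W_def by blast
qed

lemma W_const: "(\<lambda>x. c) \<in> W"
proof -
  have "grad (\<lambda>x. c) = (\<lambda>x. 0)" by (rule ext) (rule grad_eqI[OF GDERIV_const])
  then show ?thesis unfolding W_def by (auto simp: sqint_zero intro: tendsto_const)
qed

lemma subspace_W: "subspace W"
proof (rule subspaceI)
  show "0 \<in> W" using W_const[of 0] by (simp add: zero_fun_def)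
  show "f + g \<in> W" if "f \<in> W" "g \<in> W" for f g using W_lincomb[OF that, of 1 1] by simp
  show "c *\<^sub>R f \<in> W" if "f \<in> W" for c f using W_lincomb[OF that that, of c 0] by simp
qed

lemma tets_interior:
  "AE x in MV G. x \<in> (\<Union>K\<in>tets G. interior K)"
proof -
  have "negligible (\<Union>K\<in>tets G. frontier K)"
    using triangulation_compact[OF tets(1)]
    by (intro negligible_Union) (auto intro: negligible_convex_frontier)
  from AE_lebesgue_not_in_negligible[OF this] show ?thesis
    unfolding AE_MV_iff
  proof (rule eventually_mono, intro impI)
    fix x assume x: "x \<notin> (\<Union>K\<in>tets G. frontier K)" "x \<in> cut_region G"
    then have "x \<in> \<Union>(tets G)"
      using tets(3) closure_subset[of "region G"] by (auto simp: cut_region_def)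
    then obtain K where K: "K \<in> tets G" "x \<in> K" by auto
    then have "x \<in> interior K"
      using x(1) closure_subset[of K] by (auto simp: frontier_def)
    then show "x \<in> (\<Union>K\<in>tets G. interior K)" using K by auto
  qed
qed

lemma P1_GDERIV:
  assumes "q \<in> P1 (tets G)" "K \<in> tets G"
  obtains a where "\<And>x. x \<in> interior K \<Longrightarrow> GDERIV q x :> a"
proof -
  obtain a b where ab: "\<And>x. x \<in> K \<Longrightarrow> q x = a \<bullet> x + b" using P1_affine[OF assms] by auto
  have "GDERIV q x :> a" if "x \<in> interior K" for x
  proof (rule GDERIV_cong_ev)
    show "GDERIV (\<lambda>y. a \<bullet> y + b) x :> a"
      unfolding gderiv_def by (auto intro!: derivative_eq_intros simp: inner_commute)
    have "eventually (\<lambda>y. y \<in> interior K) (nhds x)"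
      using that open_interior eventually_nhds by blast
    then show "eventually (\<lambda>y. a \<bullet> y + b = q y) (nhds x)"
      by (rule eventually_mono) (use ab interior_subset in force)
  qed
  then show ?thesis by (rule that)
qed

lemma good_region: "good G j x \<Longrightarrow> x \<in> region G"
  unfolding good_def by (auto intro: subsetD[of "ball x _"])

lemma P1_in_W:
  assumes q: "q \<in> P1 (tets G)"
  shows "q \<in> W"
proof -
  have "\<forall>K\<in>tets G. \<exists>a. \<forall>x\<in>interior K. GDERIV q x :> a"
    using P1_GDERIV[OF q] by metis
  then obtain c where c: "\<And>K x. K \<in> tets G \<Longrightarrow> x \<in> interior K \<Longrightarrow> GDERIV q x :> c K" by metis
  have "AE x in MV G. q differentiable (at x)"
    using tets_interior by (rule eventually_mono) (use c GDERIV_imp_differentiable in blast)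
  moreover have "sqint (MV G) (grad q)"
    unfolding MV_def
  proof (rule piecewise_constant_measurable(3)[OF cut_region_sets(2)])
    show "finite (tets G)" using triangulation_compact[OF tets(1)] by simp
    show "grad q x = c K" if "K \<in> tets G" "x \<in> interior K" for K x
      using c[OF that] by (rule grad_eqI)
  qed (use tets_interior[unfolded MV_def] in auto)
  moreover have "AE \<xi> in MS G j. \<exists>l. (q \<longlongrightarrow> l) (side_filter G j s (chart G j \<xi>))"
    if js: "j \<in> fractures G" "s \<in> {-1, 1}" for j s
    using AE_good[OF js(1)]
  proof (rule eventually_mono)
    fix \<xi> assume "good G j (chart G j \<xi>)"
    then have "chart G j \<xi> \<in> region G" by (rule good_region)
    moreover have "continuous_on (closure (region G)) q"
      using q unfolding P1_def tets(3) by simp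
    then have "continuous_on (region G) q"
      using closure_subset by (rule continuous_on_subset)
    ultimately have "isCont q (chart G j \<xi>)" using region(1) continuous_on_eq_continuous_at by blast
    then show "\<exists>l. (q \<longlongrightarrow> l) (side_filter G j s (chart G j \<xi>))"
      using continuous_at_imp_continuous_within by (auto simp: continuous_within)
  qed
  ultimately show ?thesis
    unfolding W_def using P1_borel_bounded[OF tets(1) q] by blast
qed

lemma AE_MV_off_walls: "AE x in MV G. x \<in> off_walls G"
  unfolding AE_MV_iff using AE_lebesgue_off_walls by eventually_elim simp

text \<open>Locally constant off the walls. The gradient is the classical one, so the jump across
  the plane leaves no contribution on it.\<close>

lemma heavi_in_W:
  assumes i: "i \<in> fractures G"
  shows "heavi G i \<in> W"
proof -
  have b: "heavi G i \<in> borel_measurable borel"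
    unfolding heavi_def by measurable
  have bd: "\<bar>heavi G i x\<bar> \<le> 1" for x by (simp add: heavi_def sgn_real_def)
  have g: "AE x in MV G. GDERIV (heavi G i) x :> 0"
    using AE_MV_off_walls
  proof (rule eventually_mono)
    fix x assume "x \<in> off_walls G"
    then obtain e where e: "e > 0" "ball x e \<subseteq> off_walls G" by (rule nbhd_off_walls)
    obtain s where s: "\<And>y. y \<in> ball x e \<Longrightarrow> heavi G i y = s"
      using heavi_const[OF i connected_ball e(2)] by blast
    have "eventually (\<lambda>y. y \<in> ball x e) (nhds x)"
      using e(1) by (intro eventually_nhds_in_open) auto
    then have "eventually (\<lambda>y. s = heavi G i y) (nhds x)"
      by (rule eventually_mono) (use s in simp)
    with GDERIV_const show "GDERIV (heavi G i) x :> 0" by (rule GDERIV_cong_ev)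
  qed
  have g0: "AE x in MV G. grad (heavi G i) x = 0"
    using g by eventually_elim (rule grad_eqI)
  have "grad (heavi G i) \<in> borel_measurable (MV G)"
    using complete_measure.borel_measurable_AE_eq[OF complete_MV, of "\<lambda>_. 0"] g0
    by (auto elim!: eventually_mono)
  then have "sqint (MV G) (grad (heavi G i))"
    using sqint_cong_AE[OF g0 _ sqint_zero] by simp
  moreover have "AE x in MV G. heavi G i differentiable (at x)"
    using g by eventually_elim (rule GDERIV_imp_differentiable)
  moreover have "AE \<xi> in MS G j. \<exists>l. (heavi G i \<longlongrightarrow> l) (side_filter G j s (chart G j \<xi>))"
    if js: "j \<in> fractures G" "s \<in> {-1, 1}" for j s
    using AE_good[OF js(1)]
  proof (rule eventually_mono)
    fix \<xi> assume gd: "good G j (chart G j \<xi>)"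
    obtain U where U: "convex U" "U \<subseteq> off_walls G"
      "eventually (\<lambda>y. y \<in> U) (side_filter G j s (chart G j \<xi>))"
      using good_half_ball[OF js(1) gd] by blast
    obtain l where l: "\<And>y. y \<in> U \<Longrightarrow> heavi G i y = l"
      using heavi_const[OF i convex_connected[OF U(1)] U(2)] by blast
    have "(heavi G i \<longlongrightarrow> l) (side_filter G j s (chart G j \<xi>))"
      by (rule tendsto_eventually) (use U(3) l in \<open>auto elim!: eventually_mono\<close>)
    then show "\<exists>l. (heavi G i \<longlongrightarrow> l) (side_filter G j s (chart G j \<xi>))" by blast
  qed
  ultimately show ?thesis unfolding W_def using b bd by blast
qed

lemma tip_fun_borel_bounded:
  assumes i: "i \<in> fractures G"
  shows "tip_fun G i \<in> borel_measurable borel" "\<exists>B. \<forall>x. \<bar>tip_fun G i x\<bar> \<le> B"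
proof -
  have tp: "tip_fun G i x = (if interior_edges G i = {} then 1
      else if local_coords G i x \<in> frac_coords G i
      then tip_scale G i * tip_poly G i (local_coords G i x) else 0)" for x
    by (simp add: tip_fun_def frac_coords_def tip_poly_def)
  have lc: "local_coords G i \<in> borel_measurable borel"
    by (rule borel_measurable_continuous_onI) (rule continuous_local_coords)
  have "tip_poly G i \<in> borel_measurable borel"
    by (rule borel_measurable_continuous_onI) (rule continuous_tip_poly)
  from measurable_compose[OF lc this]
  have m1: "(\<lambda>x. tip_poly G i (local_coords G i x)) \<in> borel_measurable borel" .
  have "frac_coords G i \<in> sets borel" using compact_imp_closed[OF compact_frac_coords[OF i]] by (rule borel_closed)
  from measurable_sets[OF lc this]
  have m2: "{x. local_coords G i x \<in> frac_coords G i} \<in> sets borel" by (simp add: vimage_def)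
  show "tip_fun G i \<in> borel_measurable borel"
    unfolding tp[abs_def] using m1 m2 by (cases "interior_edges G i = {}") (auto intro!: measurable_If)
  have "bounded (tip_poly G i ` frac_coords G i)"
    using compact_continuous_image[OF continuous_on_subset[OF continuous_tip_poly subset_UNIV]
        compact_frac_coords[OF i]] by (rule compact_imp_bounded)
  then obtain B where B: "\<And>\<xi>. \<xi> \<in> frac_coords G i \<Longrightarrow> \<bar>tip_poly G i \<xi>\<bar> \<le> B" by (force simp: bounded_iff)
  have "\<bar>tip_fun G i x\<bar> \<le> max 1 (\<bar>tip_scale G i\<bar> * B)" for x
    using mult_left_mono[OF B[of "local_coords G i x"], of "\<bar>tip_scale G i\<bar>"]
    by (auto simp: tp abs_mult le_max_iff_disj)
  then show "\<exists>B. \<forall>x. \<bar>tip_fun G i x\<bar> \<le> B" by blast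
qed

text \<open>Near a point off the walls, and on the half balls at a good point, the function is a
  multiple of the continuous \<open>tip_poly\<close>. Square integrability of its gradient is the
  finite energy clause of \<open>admissible\<close>.\<close>

lemma tip_fun_in_W:
  assumes i: "i \<in> fractures G"
  shows "tip_fun G i \<in> W"
proof -
  have "AE x in MV G. tip_fun G i differentiable (at x)"
    using AE_MV_off_walls
  proof (rule eventually_mono)
    fix x assume x: "x \<in> off_walls G"
    then obtain e where e: "e > 0" "ball x e \<subseteq> off_walls G" by (rule nbhd_off_walls)
    obtain c where c: "\<And>y. y \<in> ball x e \<Longrightarrow> tip_fun G i y = c * tip_poly G i (local_coords G i y)"
      using tip_fun_form[OF i connected_ball e(2)] by blast
    have "(\<lambda>y. c * tip_poly G i (local_coords G i y)) differentiable (at x)"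
      using tip_poly_differentiable[OF i x] by simp
    from differentiable_imp_GDERIV[OF this] obtain D where
      D: "GDERIV (\<lambda>y. c * tip_poly G i (local_coords G i y)) x :> D" by blast
    have "eventually (\<lambda>y. y \<in> ball x e) (nhds x)"
      using e(1) by (intro eventually_nhds_in_open) auto
    then have "eventually (\<lambda>y. c * tip_poly G i (local_coords G i y) = tip_fun G i y) (nhds x)"
      by (rule eventually_mono) (use c in simp)
    with D have "GDERIV (tip_fun G i) x :> D" by (rule GDERIV_cong_ev)
    then show "tip_fun G i differentiable (at x)" by (rule GDERIV_imp_differentiable)
  qed
  moreover have "sqint (MV G) (grad (tip_fun G i))"
    unfolding sqint_def MV_def
  proof
    have S: "cut_region G \<inter> space lebesgue \<in> sets lebesgue" using cut_region_sets(2) by auto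
    show "grad (tip_fun G i) \<in> borel_measurable (lebesgue_on (cut_region G))"
      using tip_grad(1)[OF i] unfolding borel_measurable_restrict_space_iff[OF S]
      by (simp add: set_borel_measurable_def)
    show "integrable (lebesgue_on (cut_region G)) (\<lambda>x. (norm (grad (tip_fun G i) x))\<^sup>2)"
      using tip_grad(2)[OF i] unfolding integrable_restrict_space[OF S]
      by (simp add: set_integrable_def)
  qed
  moreover have "AE \<xi> in MS G j. \<exists>l. (tip_fun G i \<longlongrightarrow> l) (side_filter G j s (chart G j \<xi>))"
    if js: "j \<in> fractures G" "s \<in> {-1, 1}" for j s
    using AE_good[OF js(1)]
  proof (rule eventually_mono)
    fix \<xi> let ?x = "chart G j \<xi>"
    assume gd: "good G j ?x"
    obtain U where U: "convex U" "U \<subseteq> off_walls G"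
      "eventually (\<lambda>y. y \<in> U) (side_filter G j s ?x)"
      using good_half_ball[OF js(1) gd] by blast
    obtain c where c: "\<And>y. y \<in> U \<Longrightarrow> tip_fun G i y = c * tip_poly G i (local_coords G i y)"
      using tip_fun_form[OF i convex_connected[OF U(1)] U(2)] by blast
    have "continuous_on UNIV (\<lambda>y. c * tip_poly G i (local_coords G i y))"
      by (intro continuous_intros continuous_on_compose2[OF continuous_tip_poly] continuous_local_coords) auto
    then have "continuous (side_filter G j s ?x) (\<lambda>y. c * tip_poly G i (local_coords G i y))"
      by (auto simp: continuous_on_eq_continuous_within intro: continuous_within_subset)
    then have "((\<lambda>y. c * tip_poly G i (local_coords G i y)) \<longlongrightarrow> c * tip_poly G i (local_coords G i ?x))
        (side_filter G j s ?x)" by (simp add: continuous_within)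
    moreover have "eventually (\<lambda>y. c * tip_poly G i (local_coords G i y) = tip_fun G i y)
        (side_filter G j s ?x)"
      using U(3) by (rule eventually_mono) (use c in simp)
    ultimately have "(tip_fun G i \<longlongrightarrow> c * tip_poly G i (local_coords G i ?x)) (side_filter G j s ?x)"
      by (rule Lim_transform_eventually)
    then show "\<exists>l. (tip_fun G i \<longlongrightarrow> l) (side_filter G j s ?x)" by blast
  qed
  ultimately show ?thesis unfolding W_def using tip_fun_borel_bounded[OF i] by blast
qed

end

section \<open>Jacobians, strains and tangential derivatives\<close>

definition field_grad :: "(R3 \<Rightarrow> R3) \<Rightarrow> R3 \<Rightarrow> real^3^3" where
  "field_grad u x = (\<chi> i. grad (\<lambda>y. u y $ i) x)"

text \<open>\<open>frechet_derivative\<close> is an arbitrary choice where no derivative exists,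
  whereas the rows of \<open>field_grad\<close> are known to be square integrable; the comparison
  passes this on to the Jacobian.\<close>

lemma jacobian_eq_field_grad:
  assumes "\<And>i. (\<lambda>y. u y $ i) differentiable (at x)"
  shows "jacobian u (at x) = field_grad u x"
proof -
  have "(u has_derivative (\<lambda>h. field_grad u x *v h)) (at x)"
  proof (rule iffD2[OF has_derivative_componentwise_within], rule ballI)
    fix b :: R3 assume "b \<in> Basis"
    then obtain i where b: "b = axis i 1" by (auto simp: Basis_vec_def)
    have "((\<lambda>y. u y $ i) has_derivative (\<lambda>h. h \<bullet> grad (\<lambda>y. u y $ i) x)) (at x)"
      using differentiable_imp_GDERIV[OF assms] by (simp add: gderiv_def)
    moreover have "(field_grad u x *v h) \<bullet> b = h \<bullet> grad (\<lambda>y. u y $ i) x" for h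
      by (simp add: b inner_axis field_grad_def matrix_vector_mul_component inner_commute[of h])
    moreover have "u y \<bullet> b = u y $ i" for y by (simp add: b inner_axis)
    ultimately show "((\<lambda>y. u y \<bullet> b) has_derivative (\<lambda>h. (field_grad u x *v h) \<bullet> b)) (at x)"
      by simp
  qed
  then have "frechet_derivative u (at x) = (\<lambda>h. field_grad u x *v h)"
    using frechet_derivative_at by metis
  then show ?thesis by (simp add: jacobian_def)
qed

definition strain_map :: "real^3^3 \<Rightarrow> real^3^3" where
  "strain_map A = (1/2) *\<^sub>R (A + transpose A)"

lemma linear_strain_map: "linear strain_map"
  by (rule linearI) (simp_all add: strain_map_def vec_eq_iff transpose_def algebra_simps)

lemma linear_trace: "linear (trace :: real^3^3 \<Rightarrow> real)"
  by (rule linearI) (simp_all add: trace_def sum.distrib sum_distrib_left)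

lemma strain_eq: "strain u x = strain_map (jacobian u (at x))"
  by (simp add: strain_def strain_map_def)

lemma trace_strain: "trace (strain u x) = divergence u x"
  by (simp add: strain_def divergence_def trace_def transpose_def sum.distrib)

text \<open>Cauchy-Schwarz against the identity matrix, whose squared norm is the dimension
  3.\<close>

lemma trace_square_le: "(trace A)\<^sup>2 \<le> 3 * (norm A)\<^sup>2" for A :: "real^3^3"
proof -
  have "trace A = A \<bullet> mat 1"
    by (simp add: trace_def inner_vec_def mat_def sum_3)
  moreover have "(norm (mat 1 :: real^3^3))\<^sup>2 = 3"
    unfolding power2_norm_eq_inner by (simp add: inner_vec_def mat_def sum_3)
  moreover have "(A \<bullet> mat 1)\<^sup>2 \<le> (norm A)\<^sup>2 * (norm (mat 1 :: real^3^3))\<^sup>2"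
    using Cauchy_Schwarz_ineq[of A "mat 1 :: real^3^3"] by (simp add: power2_norm_eq_inner)
  ultimately show ?thesis by simp
qed

definition tan_deriv :: "fractured_domain \<Rightarrow> nat \<Rightarrow> (R3 \<Rightarrow> real) \<Rightarrow> R3 \<Rightarrow> R3 \<Rightarrow> bool" where
  "tan_deriv G j q x D \<longleftrightarrow> D \<bullet> nrm G j = 0 \<and>
     (q has_derivative (\<lambda>h. h \<bullet> D)) (at x within frac_plane G j)"

text \<open>The line through \<open>x\<close> in the direction of \<open>D - D'\<close> stays in the
  plane, because both vectors are orthogonal to the normal. Uniqueness of the derivative along this
  line makes the square of \<open>D - D'\<close> vanish.\<close>

lemma tan_deriv_unique:
  assumes x: "x \<in> frac_plane G j" and D: "tan_deriv G j q x D" "tan_deriv G j q x D'"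
  shows "D = D'"
proof -
  define E where "E = D - D'"
  have E: "nrm G j \<bullet> E = 0"
    using D by (simp add: E_def tan_deriv_def inner_diff_right inner_commute)
  let ?g = "\<lambda>t::real. x + t *\<^sub>R E"
  have sub: "range ?g \<subseteq> frac_plane G j"
    using x E by (auto simp: frac_plane_def inner_diff_right inner_add_right)
  have g: "(?g has_derivative (\<lambda>t. t *\<^sub>R E)) (at 0)"
    by (auto intro!: derivative_eq_intros)
  have *: "((\<lambda>t. q (?g t)) has_derivative (\<lambda>t. (t *\<^sub>R E) \<bullet> F)) (at 0)" if "tan_deriv G j q x F" for F
  proof (rule has_derivative_in_compose[OF g, where g=q and g'="\<lambda>h. h \<bullet> F"])
    show "(q has_derivative (\<lambda>h. h \<bullet> F)) (at (?g 0) within range ?g)"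
      using that sub by (auto simp: tan_deriv_def intro: has_derivative_subset)
  qed
  have "(\<lambda>t. (t *\<^sub>R E) \<bullet> D) = (\<lambda>t. (t *\<^sub>R E) \<bullet> D')"
    using *[OF D(1)] *[OF D(2)] by (rule has_derivative_unique)
  from fun_cong[OF this, of 1] have "E \<bullet> E = 0" by (simp add: E_def inner_diff_right)
  then show ?thesis by (simp add: E_def)
qed

lemma tan_grad_eqI:
  assumes "x \<in> frac_plane G j" "tan_deriv G j q x D"
  shows "tan_grad G j q x = D"
proof -
  have "(THE D. tan_deriv G j q x D) = D"
    by (rule the_equality[where P="tan_deriv G j q x", OF assms(2)])
      (rule tan_deriv_unique[OF assms(1) _ assms(2)])
  then show ?thesis by (simp add: tan_grad_def tan_deriv_def)
qed

lemma tan_deriv_lincomb: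
  assumes "tan_deriv G j p x D" "tan_deriv G j q x E"
  shows "tan_deriv G j (a *\<^sub>R p + b *\<^sub>R q) x (a *\<^sub>R D + b *\<^sub>R E)"
proof -
  have f: "a *\<^sub>R p + b *\<^sub>R q = (\<lambda>y. a * p y + b * q y)" by (simp add: fun_eq_iff scaleR_fun_apply)
  have "((\<lambda>y. a * p y + b * q y) has_derivative (\<lambda>h. a * (h \<bullet> D) + b * (h \<bullet> E))) (at x within frac_plane G j)"
    using assms by (intro has_derivative_add has_derivative_mult_right) (simp_all add: tan_deriv_def)
  then show ?thesis
    using assms by (simp add: tan_deriv_def f inner_add_left inner_add_right)
qed

lemma subspace_componentwise:
  fixes S :: "(R3 \<Rightarrow> real) set"
  assumes S: "subspace S"
  shows "subspace {v :: R3 \<Rightarrow> R3. \<forall>i. (\<lambda>x. v x $ i) \<in> S}"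
proof (rule subspaceI)
  have eqs: "(\<lambda>x. (f + g) x $ i) = (\<lambda>x. f x $ i) + (\<lambda>x. g x $ i)"
    "(\<lambda>x. (c *\<^sub>R f) x $ i) = c *\<^sub>R (\<lambda>x. f x $ i)" "(\<lambda>x. (0::R3 \<Rightarrow> R3) x $ i) = 0"
    for f g :: "R3 \<Rightarrow> R3" and c i by (simp_all add: fun_eq_iff scaleR_fun_apply)
  show "0 \<in> {v :: R3 \<Rightarrow> R3. \<forall>i. (\<lambda>x. v x $ i) \<in> S}"
    unfolding mem_Collect_eq eqs using subspace_0[OF S] by simp
  show "f + g \<in> {v. \<forall>i. (\<lambda>x. v x $ i) \<in> S}"
    if "f \<in> {v. \<forall>i. (\<lambda>x. v x $ i) \<in> S}" "g \<in> {v. \<forall>i. (\<lambda>x. v x $ i) \<in> S}" for f g :: "R3 \<Rightarrow> R3"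
    using that unfolding mem_Collect_eq eqs by (intro allI subspace_add[OF S]) simp_all
  show "c *\<^sub>R f \<in> {v. \<forall>i. (\<lambda>x. v x $ i) \<in> S}"
    if "f \<in> {v. \<forall>i. (\<lambda>x. v x $ i) \<in> S}" for f :: "R3 \<Rightarrow> R3" and c
    using that unfolding mem_Collect_eq eqs by (intro allI subspace_scale[OF S]) simp_all
qed

lemma lincomb_component:
  "(\<lambda>x. (a *\<^sub>R u + b *\<^sub>R v) x $ i) = a *\<^sub>R (\<lambda>x. u x $ i) + b *\<^sub>R (\<lambda>x. v x $ i)"
  for u v :: "R3 \<Rightarrow> R3"
  by (simp add: fun_eq_iff scaleR_fun_apply)

lemma sqint_vecI:
  fixes f :: "'a \<Rightarrow> 'b::euclidean_space ^ 'n"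
  assumes "\<And>i. sqint M (\<lambda>x. f x $ i)"
  shows "sqint M f"
proof (rule sqint_componentwise)
  fix b :: "'b ^ 'n" assume "b \<in> Basis"
  then obtain i c where b: "b = axis i c" "c \<in> Basis" by (auto simp: Basis_vec_def)
  show "sqint M (\<lambda>x. f x \<bullet> b)"
    unfolding b inner_axis
    by (rule sqint_bounded_linear[OF assms bounded_linear_inner_left])
qed

section \<open>The discrete spaces\<close>

lemma subspace_xfem: "subspace (xfem G GD)"
  unfolding xfem_def fun_span_eq_span by (rule subspace_span)

lemma subspace_V_f: "subspace (V_f G)"
  unfolding V_f_def by (rule subspace_xfem)

lemma subspace_V_m: "subspace (V_m G)"
  unfolding V_m_def by (rule subspace_componentwise[OF subspace_xfem])

lemma subspace_V_F: "subspace (V_F G j)"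
proof -
  have "V_F G j = P1 (tris G j) \<inter> {q. \<forall>x\<in>gammaD G j. q x = 0}" by (auto simp: V_F_def)
  moreover have "subspace {q :: R3 \<Rightarrow> real. \<forall>x\<in>gammaD G j. q x = 0}"
    by (rule subspaceI) (auto simp: scaleR_fun_apply)
  ultimately show ?thesis by (simp add: subspace_inter subspace_P1)
qed

lemma subspace_Q_m: "subspace (Q_m G j)"
  unfolding Q_m_def by (rule subspace_componentwise[OF subspace_P1])

lemma V_F_normal_in_Q_m:
  assumes "q \<in> V_F G j"
  shows "(\<lambda>x. (a * q x) *\<^sub>R n) \<in> Q_m G j"
proof -
  have "(\<lambda>x. ((a * q x) *\<^sub>R n) $ i) = (a * n $ i) *\<^sub>R q" for i
    by (simp add: fun_eq_iff scaleR_fun_apply)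
  then show ?thesis
    using assms subspace_scale[OF subspace_P1] by (auto simp: Q_m_def V_F_def)
qed

lemma mesh_vertices_mono: "S \<subseteq> T \<Longrightarrow> mesh_vertices S \<subseteq> mesh_vertices T"
  by (auto simp: mesh_vertices_def)

context fractured
begin

lemma enrichments_subset_W: "enrichments G GD \<subseteq> W"
proof
  fix q assume "q \<in> enrichments G GD"
  then consider \<phi> j v where "j \<in> fractures G" "is_hat (tets G) v \<phi>"
      "q = (\<lambda>x. \<phi> x * (heavi G j x * tip_fun G j x - heavi G j v * tip_fun G j v))"
    | \<phi> j v where "j \<in> fractures G" "is_hat (tets G) v \<phi>"
      "q = (\<lambda>x. \<phi> x * (heavi G j x - heavi G j v))"
    unfolding enrichments_def by auto
  then show "q \<in> W"
  proof cases
    case 1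
    have "(\<lambda>x. heavi G j x * tip_fun G j x) - (\<lambda>x. heavi G j v * tip_fun G j v) \<in> W"
      using 1(1) by (intro subspace_diff[OF subspace_W] W_mult W_const heavi_in_W tip_fun_in_W)
    moreover have "\<phi> \<in> W" using 1(2) P1_in_W by (simp add: is_hat_def)
    ultimately show ?thesis using W_mult unfolding 1(3) by force
  next
    case 2
    have "heavi G j - (\<lambda>x. heavi G j v) \<in> W"
      using 2(1) by (intro subspace_diff[OF subspace_W] W_const heavi_in_W)
    moreover have "\<phi> \<in> W" using 2(2) P1_in_W by (simp add: is_hat_def)
    ultimately show ?thesis using W_mult unfolding 2(3) by force
  qed
qed

lemma xfem_subset_W: "xfem G GD \<subseteq> W"
  unfolding xfem_def fun_span_eq_span
  using enrichments_subset_W P1_in_W by (intro span_minimal subspace_W) auto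

lemma V_f_W: "q \<in> V_f G \<Longrightarrow> q \<in> W"
  using xfem_subset_W by (auto simp: V_f_def)

lemma V_m_W: "v \<in> V_m G \<Longrightarrow> (\<lambda>x. v x $ i) \<in> W"
  using xfem_subset_W by (auto simp: V_m_def)

text \<open>A vertex has at most one hat function, since vertex values determine it; so there are
  finitely many triples of hat function, fracture and vertex.\<close>

lemma finite_enrichments: "finite (enrichments G GD)"
proof -
  let ?V = "mesh_vertices (tets G)"
  have finV: "finite ?V" using finite_mesh_vertices[OF tets(1)] .
  define H where "H = (\<Union>v\<in>?V. {\<phi>. is_hat (tets G) v \<phi>})"
  have "finite {\<phi>. is_hat (tets G) v \<phi>}" for v
  proof (cases "{\<phi>. is_hat (tets G) v \<phi>} = {}")
    case False
    then obtain \<phi> where \<phi>: "is_hat (tets G) v \<phi>" by auto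
    have "\<psi> = \<phi>" if \<psi>: "is_hat (tets G) v \<psi>" for \<psi>
    proof -
      have "\<psi> - \<phi> = 0"
        using \<phi> \<psi> by (intro P1_determined_by_vertices[OF tets(1)])
          (auto simp: is_hat_def intro: subspace_diff[OF subspace_P1])
      then show ?thesis by simp
    qed
    then have "{\<phi>. is_hat (tets G) v \<phi>} \<subseteq> {\<phi>}" by auto
    then show ?thesis by (rule finite_subset) simp
  qed simp
  then have finH: "finite H" unfolding H_def using finV by auto
  let ?E1 = "(\<lambda>(\<phi>, j, v). \<lambda>x. \<phi> x * (heavi G j x * tip_fun G j x - heavi G j v * tip_fun G j v)) ` (H \<times> fractures G \<times> ?V)"
  let ?E2 = "(\<lambda>(\<phi>, j, v). \<lambda>x. \<phi> x * (heavi G j x - heavi G j v)) ` (H \<times> fractures G \<times> ?V)"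
  have mono: "mesh_vertices (tets_E G j) \<subseteq> ?V" "mesh_vertices (tets_H G j) \<subseteq> ?V" for j
    by (rule mesh_vertices_mono; auto simp: tets_E_def tets_H_def)+
  have "enrichments G GD \<subseteq> ?E1 \<union> ?E2"
  proof
    fix q assume "q \<in> enrichments G GD"
    then consider \<phi> j v where "j \<in> fractures G" "is_hat (tets G) v \<phi>" "v \<in> mesh_vertices (tets_E G j)"
        "q = (\<lambda>x. \<phi> x * (heavi G j x * tip_fun G j x - heavi G j v * tip_fun G j v))"
      | \<phi> j v where "j \<in> fractures G" "is_hat (tets G) v \<phi>" "v \<in> mesh_vertices (tets_H G j)"
        "q = (\<lambda>x. \<phi> x * (heavi G j x - heavi G j v))"
      unfolding enrichments_def by auto
    then show "q \<in> ?E1 \<union> ?E2"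
    proof cases
      case 1
      then have "v \<in> ?V" using mono by auto
      with 1 show ?thesis by (intro UnI1 image_eqI[of _ _ "(\<phi>, j, v)"]) (auto simp: H_def)
    next
      case 2
      then have "v \<in> ?V" using mono by auto
      with 2 show ?thesis by (intro UnI2 image_eqI[of _ _ "(\<phi>, j, v)"]) (auto simp: H_def)
    qed
  qed
  then show ?thesis by (rule finite_subset) (use finH finV in auto)
qed

lemma V_f_finite_dim:
  obtains B where "finite B" "V_f G \<subseteq> span B"
proof -
  obtain B where B: "finite B" "P1 (tets G) \<subseteq> span B" by (rule P1_finite_dim[OF tets(1)])
  let ?B = "B \<union> enrichments G (GammaD_f G)"
  have "{q \<in> P1 (tets G). \<forall>x\<in>GammaD_f G. q x = 0} \<subseteq> span ?B"
    using B(2) span_mono[of B ?B] by auto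
  moreover have "enrichments G (GammaD_f G) \<subseteq> span ?B" using span_superset[of ?B] by auto
  ultimately have "V_f G \<subseteq> span ?B"
    unfolding V_f_def xfem_def fun_span_eq_span by (intro span_minimal) auto
  then show ?thesis using B(1) finite_enrichments by (intro that[of ?B]) auto
qed

section \<open>Traces\<close>

text \<open>Replaces the description \<open>Lim\<close> by genuine convergence, which makes traces
  linear; goodness is kept because it makes limits unique.\<close>

lemma tr_W:
  assumes q: "q \<in> W" and js: "j \<in> fractures G" "s \<in> {-1, 1}"
  shows "AE \<xi> in MS G j. good G j (chart G j \<xi>) \<and>
    (q \<longlongrightarrow> tr G j s q (chart G j \<xi>)) (side_filter G j s (chart G j \<xi>))"
  using AE_good[OF js(1)] W_D(5)[OF q js]
proof eventually_elim
  case (elim \<xi>)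
  then show ?case using tr_eq[OF js(1) _ js(2)] by auto
qed

lemma tr_lincomb:
  assumes "p \<in> W" "q \<in> W" and js: "j \<in> fractures G" "s \<in> {-1, 1}"
  shows "AE \<xi> in MS G j. tr G j s (a *\<^sub>R p + b *\<^sub>R q) (chart G j \<xi>) =
    a *\<^sub>R tr G j s p (chart G j \<xi>) + b *\<^sub>R tr G j s q (chart G j \<xi>)"
  using tr_W[OF assms(1) js] tr_W[OF assms(2) js]
proof eventually_elim
  case (elim \<xi>)
  show ?case
    unfolding plus_fun_def scaleR_fun_def
    by (rule tr_eq[OF js(1) _ js(2)]) (use elim in \<open>auto intro!: tendsto_intros\<close>)
qed

text \<open>The trace is almost everywhere the limit of the restrictions of \<open>q\<close> to
  planes shifted along the normal. These are measurable and share the bound of \<open>q\<close>;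
  \<open>lim\<close> is measurable even if the sequence diverges on a null set.\<close>

lemma tr_sqint:
  assumes q: "q \<in> W" and js: "j \<in> fractures G" "s \<in> {-1, 1}"
  shows "sqint (MS G j) (\<lambda>\<xi>. tr G j s q (chart G j \<xi>))"
proof -
  let ?y = "\<lambda>m \<xi>. chart G j \<xi> + (s / real (Suc m)) *\<^sub>R nrm G j"
  let ?L = "\<lambda>\<xi>. lim (\<lambda>m. q (?y m \<xi>))"
  obtain B where B: "\<And>x. \<bar>q x\<bar> \<le> B" using W_D(2)[OF q] by blast
  have conv: "AE \<xi> in MS G j. (\<lambda>m. q (?y m \<xi>)) \<longlonglongrightarrow> tr G j s q (chart G j \<xi>)"
    using tr_W[OF q js]
  proof eventually_elim
    case (elim \<xi>)
    then show ?case
      using filterlim_compose[OF conjunct2[OF elim] good_approach[OF js(1) _ js(2)]] by blast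
  qed
  have m: "(\<lambda>\<xi>. q (?y m \<xi>)) \<in> borel_measurable (MS G j)" for m
  proof -
    have "(\<lambda>x. q (x + (s / real (Suc m)) *\<^sub>R nrm G j)) \<in> borel_measurable borel"
      using W_D(1)[OF q] by (rule measurable_compose[rotated]) measurable
    then show ?thesis by (rule borel_measurable_MS)
  qed
  have "?L \<in> borel_measurable (MS G j)"
    using m by (rule borel_measurable_lim_metric)
  moreover have "AE \<xi> in MS G j. ?L \<xi> = tr G j s q (chart G j \<xi>)"
    using conv by eventually_elim (rule limI)
  ultimately have meas: "(\<lambda>\<xi>. tr G j s q (chart G j \<xi>)) \<in> borel_measurable (MS G j)"
    by (rule complete_measure.borel_measurable_AE_eq[OF complete_MS[OF js(1)]])
  have "AE \<xi> in MS G j. norm (tr G j s q (chart G j \<xi>)) \<le> B"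
    using conv
  proof eventually_elim
    case (elim \<xi>)
    then show ?case
      by (intro LIMSEQ_le_const2[OF tendsto_norm]) (use B in auto)
  qed
  with finite_MS[OF js(1)] meas show ?thesis by (rule sqint_bounded)
qed

text \<open>A nonzero trace at a good point would keep \<open>q\<close> away from 0 on an open half
  ball of the cut region, which has positive measure.\<close>

lemma tr_zero:
  assumes q: "q \<in> W" and 0: "ip (MV G) q q = 0" and js: "j \<in> fractures G" "s \<in> {-1, 1}"
  shows "AE \<xi> in MS G j. tr G j s q (chart G j \<xi>) = 0"
  using tr_W[OF q js]
proof eventually_elim
  case (elim \<xi>)
  let ?x = "chart G j \<xi>"
  have ae: "AE x in lebesgue. x \<in> cut_region G \<longrightarrow> q x = 0"
    using ip_self_zero_AE[OF W_sqint[OF q] 0] by (simp add: AE_MV_iff)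
  show ?case
  proof (rule ccontr)
    assume ne: "tr G j s q ?x \<noteq> 0"
    have "eventually (\<lambda>y. q y \<noteq> 0) (side_filter G j s ?x)"
      using tendsto_imp_eventually_ne[OF conjunct2[OF elim] ne] .
    then obtain d where d: "d > 0" "\<And>y. y \<in> side G j s ?x \<Longrightarrow> y \<noteq> ?x \<Longrightarrow> dist y ?x < d \<Longrightarrow> q y \<noteq> 0"
      unfolding eventually_at by blast
    obtain e where e: "e > 0"
      "\<And>y. y \<in> ball ?x e \<Longrightarrow> nrm G j \<bullet> (y - ?x) \<noteq> 0 \<Longrightarrow> y \<in> off_walls G \<inter> cut_region G"
      using conjunct1[OF elim] unfolding good_def by blast
    \<comment> \<open>Within radius \<open>d\<close> the function does not vanish; within radius
      \<open>e\<close> the half ball lies in the cut region.\<close>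
    define U where "U = ball ?x (min d e) \<inter> {y. 0 < s * (nrm G j \<bullet> (y - ?x))}"
    have "open U"
      unfolding U_def by (intro open_Int open_ball open_Collect_less continuous_intros)
    moreover have "U \<noteq> {}"
    proof -
      define t where "t = min d e / 2"
      have t: "t > 0" "t < min d e" using d(1) e(1) by (auto simp: t_def)
      have "?x + (t * s) *\<^sub>R nrm G j \<in> U"
        using t frame(1)[OF js(1)] js(2) by (auto simp: U_def dist_norm norm_eq_sqrt_inner)
      then show ?thesis by auto
    qed
    moreover have "AE y in lebesgue. y \<notin> U"
      using ae
    proof eventually_elim
      case (elim y)
      show ?case
      proof
        assume y: "y \<in> U"
        then have "nrm G j \<bullet> (y - ?x) \<noteq> 0" "y \<in> ball ?x e" "dist y ?x < d" by (auto simp: U_def dist_commute)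
        moreover from this have "y \<in> cut_region G" "y \<noteq> ?x" using e(2)[of y] by auto
        moreover have "y \<in> side G j s ?x" using y \<open>y \<in> cut_region G\<close> by (auto simp: U_def side_def)
        ultimately show False using d(2)[of y] elim by auto
      qed
    qed
    then have "negligible U"
      using \<open>open U\<close> by (auto simp: negligible_iff_null_sets AE_iff_null_sets)
    ultimately show False using open_not_negligible by blast
  qed
qed

section \<open>Displacement fields and fracture functions\<close>

lemma V_m_jacobian: "u \<in> V_m G \<Longrightarrow> AE x in MV G. jacobian u (at x) = field_grad u x"
proof -
  assume u: "u \<in> V_m G"
  have "AE x in MV G. \<forall>i\<in>UNIV. (\<lambda>y. u y $ i) differentiable (at x)"
    using W_D(3)[OF V_m_W[OF u]] by (intro AE_finite_allI) auto
  then show ?thesis by eventually_elim (rule jacobian_eq_field_grad, simp)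
qed

lemma field_grad_sqint:
  assumes u: "u \<in> V_m G"
  shows "sqint (MV G) (field_grad u)"
  unfolding field_grad_def by (rule sqint_vecI) (simp add: W_D(4)[OF V_m_W[OF u]])

lemma jacobian_sqint:
  assumes u: "u \<in> V_m G"
  shows "sqint (MV G) (\<lambda>x. jacobian u (at x))"
proof -
  have "AE x in MV G. field_grad u x = jacobian u (at x)"
    using V_m_jacobian[OF u] by eventually_elim simp
  then have "(\<lambda>x. jacobian u (at x)) \<in> borel_measurable (MV G)"
    by (rule complete_measure.borel_measurable_AE_eq[OF complete_MV sqint_measurable[OF field_grad_sqint[OF u]]])
  from sqint_cong_AE[OF V_m_jacobian[OF u] this field_grad_sqint[OF u]] show ?thesis .
qed

lemma jacobian_lincomb:
  assumes "u \<in> V_m G" "v \<in> V_m G"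
  shows "AE x in MV G. jacobian (a *\<^sub>R u + b *\<^sub>R v) (at x) = a *\<^sub>R jacobian u (at x) + b *\<^sub>R jacobian v (at x)"
proof -
  have w: "a *\<^sub>R u + b *\<^sub>R v \<in> V_m G" using assms by (intro subspace_lincomb_mem subspace_V_m)
  have "AE x in MV G. \<forall>i\<in>UNIV. grad (\<lambda>y. (a *\<^sub>R u + b *\<^sub>R v) y $ i) x =
      a *\<^sub>R grad (\<lambda>y. u y $ i) x + b *\<^sub>R grad (\<lambda>y. v y $ i) x"
    unfolding lincomb_component
    by (intro AE_finite_allI grad_lincomb V_m_W assms) auto
  then show ?thesis
    using V_m_jacobian[OF assms(1)] V_m_jacobian[OF assms(2)] V_m_jacobian[OF w]
    by eventually_elim (simp add: field_grad_def vec_eq_iff)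
qed

lemma strain_sqint: "u \<in> V_m G \<Longrightarrow> sqint (MV G) (strain u)"
  unfolding strain_eq[abs_def] using linear_strain_map
  by (intro sqint_bounded_linear[OF jacobian_sqint]) (simp_all add: linear_conv_bounded_linear)

lemma divergence_sqint: "u \<in> V_m G \<Longrightarrow> sqint (MV G) (divergence u)"
  unfolding divergence_def[abs_def] using linear_trace
  by (intro sqint_bounded_linear[OF jacobian_sqint]) (simp_all add: linear_conv_bounded_linear)

lemma strain_lincomb:
  assumes "u \<in> V_m G" "v \<in> V_m G"
  shows "AE x in MV G. strain (a *\<^sub>R u + b *\<^sub>R v) x = a *\<^sub>R strain u x + b *\<^sub>R strain v x"
  using jacobian_lincomb[OF assms, of a b]
  by eventually_elim (simp add: strain_eq linear_add[OF linear_strain_map] linear_scale[OF linear_strain_map])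

lemma divergence_lincomb:
  assumes "u \<in> V_m G" "v \<in> V_m G"
  shows "AE x in MV G. divergence (a *\<^sub>R u + b *\<^sub>R v) x = a *\<^sub>R divergence u x + b *\<^sub>R divergence v x"
  using jacobian_lincomb[OF assms, of a b]
  by eventually_elim (simp add: divergence_def linear_add[OF linear_trace] linear_scale[OF linear_trace])

lemma tr_field:
  assumes u: "u \<in> V_m G" and js: "j \<in> fractures G" "s \<in> {-1, 1}"
  shows "AE \<xi> in MS G j. good G j (chart G j \<xi>) \<and>
    (u \<longlongrightarrow> tr G j s u (chart G j \<xi>)) (side_filter G j s (chart G j \<xi>))"
    "AE \<xi> in MS G j. tr G j s u (chart G j \<xi>) = (\<chi> i. tr G j s (\<lambda>x. u x $ i) (chart G j \<xi>))"
proof -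
  let ?v = "\<lambda>\<xi>. \<chi> i. tr G j s (\<lambda>x. u x $ i) (chart G j \<xi>)"
  have "AE \<xi> in MS G j. \<forall>i\<in>UNIV. good G j (chart G j \<xi>) \<and>
      ((\<lambda>x. u x $ i) \<longlongrightarrow> tr G j s (\<lambda>x. u x $ i) (chart G j \<xi>)) (side_filter G j s (chart G j \<xi>))"
    using tr_W[OF V_m_W[OF u] js] by (intro AE_finite_allI) auto
  then have ev: "AE \<xi> in MS G j. good G j (chart G j \<xi>) \<and>
      (u \<longlongrightarrow> ?v \<xi>) (side_filter G j s (chart G j \<xi>))"
  proof eventually_elim
    case (elim \<xi>)
    then show ?case by (auto intro!: vec_tendstoI)
  qed
  then show eq: "AE \<xi> in MS G j. tr G j s u (chart G j \<xi>) = ?v \<xi>"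
    by eventually_elim (use tr_eq[OF js(1) _ js(2)] in auto)
  show "AE \<xi> in MS G j. good G j (chart G j \<xi>) \<and>
    (u \<longlongrightarrow> tr G j s u (chart G j \<xi>)) (side_filter G j s (chart G j \<xi>))"
    using ev eq by eventually_elim simp
qed

lemma tr_field_sqint:
  assumes u: "u \<in> V_m G" and js: "j \<in> fractures G" "s \<in> {-1, 1}"
  shows "sqint (MS G j) (\<lambda>\<xi>. tr G j s u (chart G j \<xi>))"
proof -
  have L: "sqint (MS G j) (\<lambda>\<xi>. \<chi> i. tr G j s (\<lambda>x. u x $ i) (chart G j \<xi>))"
    by (rule sqint_vecI) (simp only: vec_lambda_beta tr_sqint[OF V_m_W[OF u] js])
  have "AE \<xi> in MS G j. (\<chi> i. tr G j s (\<lambda>x. u x $ i) (chart G j \<xi>)) = tr G j s u (chart G j \<xi>)"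
    using tr_field(2)[OF u js] by eventually_elim simp
  from complete_measure.borel_measurable_AE_eq[OF complete_MS[OF js(1)] sqint_measurable[OF L] this]
  show ?thesis by (intro sqint_cong_AE[OF tr_field(2)[OF u js] _ L])
qed

lemma tr_field_lincomb:
  assumes "u \<in> V_m G" "v \<in> V_m G" and js: "j \<in> fractures G" "s \<in> {-1, 1}"
  shows "AE \<xi> in MS G j. tr G j s (a *\<^sub>R u + b *\<^sub>R v) (chart G j \<xi>) =
    a *\<^sub>R tr G j s u (chart G j \<xi>) + b *\<^sub>R tr G j s v (chart G j \<xi>)"
  using tr_field(1)[OF assms(1) js] tr_field(1)[OF assms(2) js]
proof eventually_elim
  case (elim \<xi>)
  show ?case
    unfolding plus_fun_def scaleR_fun_def
    by (rule tr_eq[OF js(1) _ js(2)]) (use elim in \<open>auto intro!: tendsto_intros\<close>)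
qed

lemma P1_tris_sqint:
  assumes j: "j \<in> fractures G" and q: "q \<in> P1 (tris G j)"
  shows "sqint (MS G j) (\<lambda>\<xi>. q (chart G j \<xi>))"
proof -
  note bb = P1_borel_bounded[OF tris(1)[OF j] q]
  obtain B where "\<forall>x. \<bar>q x\<bar> \<le> B" using bb(2) by blast
  then show ?thesis
    by (intro sqint_bounded[OF finite_MS[OF j] borel_measurable_MS[OF bb(1)], of B]) auto
qed

lemma V_F_sqint: "j \<in> fractures G \<Longrightarrow> q \<in> V_F G j \<Longrightarrow> sqint (MS G j) (\<lambda>\<xi>. q (chart G j \<xi>))"
  by (rule P1_tris_sqint) (auto simp: V_F_def)

lemma Q_m_sqint:
  assumes "j \<in> fractures G" "t \<in> Q_m G j"
  shows "sqint (MS G j) (\<lambda>\<xi>. t (chart G j \<xi>))"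
  using assms by (intro sqint_vecI P1_tris_sqint[OF assms(1)]) (auto simp: Q_m_def)

text \<open>In local coordinates the triangles are images of convex sets under an affine map, so
  their frontiers are null sets.\<close>

lemma tris_interior:
  assumes j: "j \<in> fractures G"
  shows "AE \<xi> in MS G j. \<xi> \<in> (\<Union>K\<in>tris G j. interior (local_coords G j ` K))"
proof -
  note T = triangulation_compact[OF tris(1)[OF j]]
  have cvx: "convex (local_coords G j ` K)" if K: "K \<in> tris G j" for K
  proof -
    have "local_coords G j ` K = (\<lambda>x. vector [x \<bullet> tang1 G j, x \<bullet> tang2 G j]) ` ((+) (- origin G j) ` K)"
      by (force simp: local_coords_def image_image)
    moreover have "linear (\<lambda>x. vector [x \<bullet> tang1 G j, x \<bullet> tang2 G j] :: real^2)"
      by (rule linearI) (simp_all add: vec_eq_iff forall_2 inner_add_left)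
    ultimately show ?thesis
      using T(3)[OF K] by (simp add: convex_linear_image convex_translation)
  qed
  have "negligible (\<Union>K\<in>tris G j. frontier (local_coords G j ` K))"
    using T(1) cvx by (intro negligible_Union) (auto intro: negligible_convex_frontier)
  from AE_lebesgue_not_in_negligible[OF this] show ?thesis
    unfolding AE_MS_iff[OF j]
  proof (rule eventually_mono, intro impI)
    fix \<xi> assume \<xi>: "\<xi> \<notin> (\<Union>K\<in>tris G j. frontier (local_coords G j ` K))" "\<xi> \<in> frac_coords G j"
    then have "chart G j \<xi> \<in> \<Union>(tris G j)" using tris(3)[OF j] by (simp add: frac_coords_def)
    then obtain K where K: "K \<in> tris G j" "chart G j \<xi> \<in> K" by auto
    then have "\<xi> \<in> local_coords G j ` K" using local_coords_chart[OF j, of \<xi>] by (metis imageI)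
    then have "\<xi> \<in> interior (local_coords G j ` K)"
      using \<xi>(1) K(1) closure_subset[of "local_coords G j ` K"] by (auto simp: frontier_def)
    then show "\<xi> \<in> (\<Union>K\<in>tris G j. interior (local_coords G j ` K))" using K by auto
  qed
qed

lemma P1_tan_deriv:
  assumes j: "j \<in> fractures G" and q: "q \<in> P1 (tris G j)" and K: "K \<in> tris G j"
  obtains D where "\<And>\<xi>. \<xi> \<in> interior (local_coords G j ` K) \<Longrightarrow> tan_deriv G j q (chart G j \<xi>) D"
proof -
  obtain a b where ab: "\<And>x. x \<in> K \<Longrightarrow> q x = a \<bullet> x + b" using P1_affine[OF q K] by auto
  \<comment> \<open>The tangential part of \<open>a\<close>: displacements within the plane do not
    see the normal part, and a tangential gradient has to be orthogonal to the normal.\<close>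
  define D where "D = a - (nrm G j \<bullet> a) *\<^sub>R nrm G j"
  have Dn: "D \<bullet> nrm G j = 0"
    using frame(1)[OF j] by (simp add: D_def inner_diff_left inner_commute[of a])
  have Kp: "K \<subseteq> frac_plane G j" using K tris(3)[OF j] fracture(3)[OF j] by auto
  have mem: "chart G j \<zeta> \<in> K" if "\<zeta> \<in> local_coords G j ` K" for \<zeta>
    using that plane_eq_chart[OF j] Kp by auto
  have "tan_deriv G j q (chart G j \<xi>) D" if \<xi>: "\<xi> \<in> interior (local_coords G j ` K)" for \<xi>
    unfolding tan_deriv_def
  proof (intro conjI Dn)
    let ?x = "chart G j \<xi>"
    have xK: "?x \<in> K" using mem interior_subset \<xi> by blast
    obtain e where e: "e > 0" "ball \<xi> e \<subseteq> local_coords G j ` K" using \<xi> by (auto simp: mem_interior)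
    have "((\<lambda>y. q ?x + (y - ?x) \<bullet> D) has_derivative (\<lambda>h. h \<bullet> D)) (at ?x within frac_plane G j)"
      by (auto intro!: derivative_eq_intros)
    then show "(q has_derivative (\<lambda>h. h \<bullet> D)) (at ?x within frac_plane G j)"
    proof (rule has_derivative_transform_within[OF _ e(1)])
      show "?x \<in> frac_plane G j" by (rule chart_in_plane[OF j])
      fix y assume y: "y \<in> frac_plane G j" "dist y ?x < e"
      have "dist (chart G j (local_coords G j y)) ?x < e" using y plane_eq_chart[OF j] by simp
      then have "local_coords G j y \<in> ball \<xi> e" by (simp add: dist_chart[OF j] dist_commute)
      then have "chart G j (local_coords G j y) \<in> K" using e(2) mem by blast
      then have yK: "y \<in> K" using plane_eq_chart[OF j y(1)] by simp
      have "nrm G j \<bullet> (y - ?x) = 0"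
        using y(1) chart_in_plane[OF j, of \<xi>] by (simp add: frac_plane_def inner_diff_right)
      then have "(y - ?x) \<bullet> D = (y - ?x) \<bullet> a"
        by (simp add: D_def inner_diff_right[of _ a] inner_commute[of _ "nrm G j"])
      then show "q ?x + (y - ?x) \<bullet> D = q y"
        by (simp add: ab[OF xK] ab[OF yK] inner_diff_right inner_commute)
    qed
  qed
  then show ?thesis by (rule that)
qed

lemma P1_tan_grad:
  assumes j: "j \<in> fractures G" and q: "q \<in> P1 (tris G j)"
  shows "AE \<xi> in MS G j. tan_deriv G j q (chart G j \<xi>) (tan_grad G j q (chart G j \<xi>))"
    "sqint (MS G j) (\<lambda>\<xi>. tan_grad G j q (chart G j \<xi>))"
proof -
  have "\<forall>K\<in>tris G j. \<exists>D. \<forall>\<xi>\<in>interior (local_coords G j ` K). tan_deriv G j q (chart G j \<xi>) D"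
  proof
    fix K assume "K \<in> tris G j"
    then obtain D where "\<And>\<xi>. \<xi> \<in> interior (local_coords G j ` K) \<Longrightarrow> tan_deriv G j q (chart G j \<xi>) D"
      using P1_tan_deriv[OF j q] by auto
    then show "\<exists>D. \<forall>\<xi>\<in>interior (local_coords G j ` K). tan_deriv G j q (chart G j \<xi>) D" by auto
  qed
  then obtain D where D: "\<And>K \<xi>. K \<in> tris G j \<Longrightarrow> \<xi> \<in> interior (local_coords G j ` K) \<Longrightarrow>
      tan_deriv G j q (chart G j \<xi>) (D K)"
    by (auto dest!: bchoice)
  have eq: "tan_grad G j q (chart G j \<xi>) = D K"
    if "K \<in> tris G j" "\<xi> \<in> interior (local_coords G j ` K)" for K \<xi>
    using tan_grad_eqI[OF chart_in_plane[OF j] D[OF that]] .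
  show "AE \<xi> in MS G j. tan_deriv G j q (chart G j \<xi>) (tan_grad G j q (chart G j \<xi>))"
    using tris_interior[OF j]
  proof eventually_elim
    case (elim \<xi>)
    then obtain K where K: "K \<in> tris G j" "\<xi> \<in> interior (local_coords G j ` K)" by auto
    show ?case using D[OF K] by (simp add: eq[OF K])
  qed
  show "sqint (MS G j) (\<lambda>\<xi>. tan_grad G j q (chart G j \<xi>))"
    unfolding MS_def
  proof (rule piecewise_constant_measurable(3)[OF frac_coords_lmeasurable[OF j]])
    show "finite (tris G j)" using triangulation_compact[OF tris(1)[OF j]] by simp
  qed (use eq tris_interior[OF j, unfolded MS_def] in auto)
qed

lemma V_F_P1: "q \<in> V_F G j \<Longrightarrow> q \<in> P1 (tris G j)"
  by (simp add: V_F_def)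

lemma tan_grad_lincomb:
  assumes j: "j \<in> fractures G" and "p \<in> V_F G j" "q \<in> V_F G j"
  shows "AE \<xi> in MS G j. tan_grad G j (a *\<^sub>R p + b *\<^sub>R q) (chart G j \<xi>) =
    a *\<^sub>R tan_grad G j p (chart G j \<xi>) + b *\<^sub>R tan_grad G j q (chart G j \<xi>)"
  using P1_tan_grad(1)[OF j V_F_P1[OF assms(2)]] P1_tan_grad(1)[OF j V_F_P1[OF assms(3)]]
  by eventually_elim (intro tan_grad_eqI chart_in_plane[OF j] tan_deriv_lincomb)

end

section \<open>Almost everywhere linear maps into L2 and the poroelastic coefficients\<close>

definition L2lin :: "'a measure \<Rightarrow> 'v::real_vector set \<Rightarrow> ('v \<Rightarrow> 'a \<Rightarrow> 'b::euclidean_space) \<Rightarrow> bool" where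
  "L2lin M S D \<longleftrightarrow> (\<forall>x\<in>S. sqint M (D x)) \<and>
     (\<forall>a b. \<forall>x\<in>S. \<forall>y\<in>S. AE \<xi> in M. D (a *\<^sub>R x + b *\<^sub>R y) \<xi> = a *\<^sub>R D x \<xi> + b *\<^sub>R D y \<xi>)"

lemma L2lin_sqint: "L2lin M S D \<Longrightarrow> x \<in> S \<Longrightarrow> sqint M (D x)"
  by (simp add: L2lin_def)

text \<open>An exception set depending on the arguments is harmless here: only the integrals have to
  be linear, and they ignore null sets.\<close>

lemma L2lin_ip:
  assumes "L2lin M S D" "subspace S" "x \<in> S" "y \<in> S" "sqint M h"
  shows "ip M (D (a *\<^sub>R x + b *\<^sub>R y)) h = a * ip M (D x) h + b * ip M (D y) h"
    "ip M h (D (a *\<^sub>R x + b *\<^sub>R y)) = a * ip M h (D x) + b * ip M h (D y)"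
proof -
  have ae: "AE \<xi> in M. D (a *\<^sub>R x + b *\<^sub>R y) \<xi> = a *\<^sub>R D x \<xi> + b *\<^sub>R D y \<xi>"
    using assms by (simp add: L2lin_def)
  have m: "D (a *\<^sub>R x + b *\<^sub>R y) \<in> borel_measurable M"
    using assms by (intro sqint_measurable L2lin_sqint[OF assms(1)] subspace_lincomb_mem)
  show "ip M (D (a *\<^sub>R x + b *\<^sub>R y)) h = a * ip M (D x) h + b * ip M (D y) h"
    "ip M h (D (a *\<^sub>R x + b *\<^sub>R y)) = a * ip M h (D x) + b * ip M h (D y)"
    using ip_lincomb_AE[OF ae m L2lin_sqint[OF assms(1,3)] L2lin_sqint[OF assms(1,4)] assms(5)] .
qed

lemma L2lin_psd:
  assumes "L2lin M S D" "subspace S"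
  shows "psd_on S (\<lambda>x y. ip M (D x) (D y))"
  unfolding psd_on_def
proof (intro conjI ballI allI)
  show "ip M (D (a *\<^sub>R x + b *\<^sub>R y)) (D z) = a * ip M (D x) (D z) + b * ip M (D y) (D z)"
    if "x \<in> S" "y \<in> S" "z \<in> S" for a b x y z
    using assms that(1,2) L2lin_sqint[OF assms(1) that(3)] by (rule L2lin_ip(1))
qed (rule ip_commute ip_self_nonneg)+

lemma psd_on_add:
  assumes "psd_on S d" "psd_on S e"
  shows "psd_on S (\<lambda>x y. d x y + e x y)"
  unfolding psd_on_def
proof (intro conjI ballI allI)
  show "d x y + e x y = d y x + e y x" if "x \<in> S" "y \<in> S" for x y
    using psd_on_commute[OF assms(1) that] psd_on_commute[OF assms(2) that] by simp
  show "0 \<le> d x x + e x x" if "x \<in> S" for x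
    using psd_on_nonneg[OF assms(1) that] psd_on_nonneg[OF assms(2) that] by simp
  show "d (a *\<^sub>R x + b *\<^sub>R y) z + e (a *\<^sub>R x + b *\<^sub>R y) z = a * (d x z + e x z) + b * (d y z + e y z)"
    if "x \<in> S" "y \<in> S" "z \<in> S" for a b x y z
    using psd_on_lincomb[OF assms(1) that] psd_on_lincomb[OF assms(2) that] by (simp add: algebra_simps)
qed

locale poroelastic = fractured G for G :: fractured_domain +
  fixes C :: poro_coeffs
  assumes coeffs: "admissible_coeffs G C"
begin

lemma pos: "alpha C > 0" "lam C > 0" "mu C > 0" "invM C \<ge> 0" "KD C \<ge> 0" "dt C > 0"
  "\<And>j. j \<in> fractures G \<Longrightarrow> eta C j > 0" "\<And>j. j \<in> fractures G \<Longrightarrow> KF C j \<ge> 0" "K_dr C > 0"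
  using coeffs by (auto simp: admissible_coeffs_def K_dr_def)

definition T :: "nat \<Rightarrow> real \<Rightarrow> (R3 \<Rightarrow> real) \<Rightarrow> real^2 \<Rightarrow> real" where
  "T j s q \<xi> = tr G j s q (chart G j \<xi>)"

definition jump :: "nat \<Rightarrow> (R3 \<Rightarrow> R3) \<Rightarrow> real^2 \<Rightarrow> R3" where
  "jump j v \<xi> = tr G j 1 v (chart G j \<xi>) - tr G j (-1) v (chart G j \<xi>)"

definition on_frac :: "nat \<Rightarrow> (R3 \<Rightarrow> 'b) \<Rightarrow> real^2 \<Rightarrow> 'b" where
  "on_frac j q \<xi> = q (chart G j \<xi>)"

definition TG :: "nat \<Rightarrow> (R3 \<Rightarrow> real) \<Rightarrow> real^2 \<Rightarrow> R3" where
  "TG j q \<xi> = tan_grad G j q (chart G j \<xi>)"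

lemma L_id: "L2lin (MV G) (V_f G) (\<lambda>q. q)"
  using W_sqint[OF V_f_W] by (auto simp: L2lin_def scaleR_fun_apply)

lemma L_grad: "L2lin (MV G) (V_f G) grad"
  using W_D(4)[OF V_f_W] grad_lincomb[OF V_f_W V_f_W] by (simp add: L2lin_def)

lemma L_div: "L2lin (MV G) (V_m G) divergence"
  using divergence_sqint divergence_lincomb by (simp add: L2lin_def)

lemma L_strain: "L2lin (MV G) (V_m G) strain"
  using strain_sqint strain_lincomb by (simp add: L2lin_def)

lemma L_T: "j \<in> fractures G \<Longrightarrow> s \<in> {-1, 1} \<Longrightarrow> L2lin (MS G j) (V_f G) (T j s)"
  unfolding L2lin_def T_def[abs_def] using tr_sqint[OF V_f_W] tr_lincomb[OF V_f_W V_f_W] by blast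

lemma L_jump:
  assumes j: "j \<in> fractures G"
  shows "L2lin (MS G j) (V_m G) (jump j)"
  unfolding L2lin_def
proof (intro conjI ballI allI)
  fix v assume "v \<in> V_m G"
  then show "sqint (MS G j) (jump j v)"
    unfolding jump_def[abs_def] using j by (intro sqint_diff tr_field_sqint) auto
next
  fix a b v w assume vw: "v \<in> V_m G" "w \<in> V_m G"
  have "AE \<xi> in MS G j. tr G j 1 (a *\<^sub>R v + b *\<^sub>R w) (chart G j \<xi>) =
      a *\<^sub>R tr G j 1 v (chart G j \<xi>) + b *\<^sub>R tr G j 1 w (chart G j \<xi>)"
    using tr_field_lincomb[OF vw j] by simp
  moreover have "AE \<xi> in MS G j. tr G j (-1) (a *\<^sub>R v + b *\<^sub>R w) (chart G j \<xi>) =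
      a *\<^sub>R tr G j (-1) v (chart G j \<xi>) + b *\<^sub>R tr G j (-1) w (chart G j \<xi>)"
    using tr_field_lincomb[OF vw j] by simp
  ultimately show "AE \<xi> in MS G j. jump j (a *\<^sub>R v + b *\<^sub>R w) \<xi> = a *\<^sub>R jump j v \<xi> + b *\<^sub>R jump j w \<xi>"
    by eventually_elim (simp add: jump_def algebra_simps)
qed

lemma L_F: "j \<in> fractures G \<Longrightarrow> L2lin (MS G j) (V_F G j) (on_frac j)"
  using V_F_sqint by (auto simp: L2lin_def on_frac_def[abs_def] scaleR_fun_apply)

lemma L_Q: "j \<in> fractures G \<Longrightarrow> L2lin (MS G j) (Q_m G j) (on_frac j)"
  using Q_m_sqint by (auto simp: L2lin_def on_frac_def[abs_def] scaleR_fun_apply)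

lemma L_TG: "j \<in> fractures G \<Longrightarrow> L2lin (MS G j) (V_F G j) (TG j)"
  using P1_tan_grad(2)[OF _ V_F_P1] tan_grad_lincomb by (simp add: L2lin_def TG_def[abs_def])

section \<open>The bilinear forms of the discrete problems\<close>

definition mass where "mass p q = ip (MV G) p q"
definition stiff where "stiff p q = ip (MV G) (grad p) (grad q)"
definition dvg where "dvg u q = ip (MV G) (divergence u) q"
definition el where
  "el u v = lam C * ip (MV G) (divergence u) (divergence v) + 2 * mu C * ip (MV G) (strain u) (strain v)"
definition trf where "trf j p q = ip (MS G j) (T j (-1) p) (T j (-1) q) + ip (MS G j) (T j 1 p) (T j 1 q)"
definition cpl where "cpl j p r = ip (MS G j) (T j (-1) p) (on_frac j r) + ip (MS G j) (T j 1 p) (on_frac j r)"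
definition frm where
  "frm j r t = KF C j * ip (MS G j) (TG j r) (TG j t) + 2 * eta C j * ip (MS G j) (on_frac j r) (on_frac j t)"
definition mult where "mult j L v = ip (MS G j) (on_frac j L) (jump j v)"

lemma s_mem: "-1 \<in> {-1, 1::real}" "1 \<in> {-1, 1::real}" by simp_all

text \<open>The order matters, since later proofs cite by position: pressure, gradient, divergence,
  strain, traces from the \<open>+\<close> and the \<open>-\<close> side, jump, fracture function,
  multiplier, tangential gradient.\<close>

lemmas L_sqint = L2lin_sqint[OF L_id] L2lin_sqint[OF L_grad] L2lin_sqint[OF L_div] L2lin_sqint[OF L_strain]
  L2lin_sqint[OF L_T[OF _ s_mem(1)]] L2lin_sqint[OF L_T[OF _ s_mem(2)]] L2lin_sqint[OF L_jump]
  L2lin_sqint[OF L_F] L2lin_sqint[OF L_Q] L2lin_sqint[OF L_TG]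

lemmas L_ip = L2lin_ip[OF L_id subspace_V_f] L2lin_ip[OF L_grad subspace_V_f]
  L2lin_ip[OF L_div subspace_V_m] L2lin_ip[OF L_strain subspace_V_m]
  L2lin_ip[OF L_T[OF _ s_mem(1)] subspace_V_f] L2lin_ip[OF L_T[OF _ s_mem(2)] subspace_V_f]
  L2lin_ip[OF L_jump subspace_V_m] L2lin_ip[OF L_F subspace_V_F] L2lin_ip[OF L_Q subspace_Q_m]
  L2lin_ip[OF L_TG subspace_V_F]

lemma mass_lin:
  assumes "p \<in> V_f G" "p' \<in> V_f G" "q \<in> V_f G"
  shows "mass (a *\<^sub>R p + b *\<^sub>R p') q = a * mass p q + b * mass p' q"
    "mass q (a *\<^sub>R p + b *\<^sub>R p') = a * mass q p + b * mass q p'"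
  unfolding mass_def using assms by (simp_all only: L_ip L_sqint)

lemma stiff_lin:
  assumes "p \<in> V_f G" "p' \<in> V_f G" "q \<in> V_f G"
  shows "stiff (a *\<^sub>R p + b *\<^sub>R p') q = a * stiff p q + b * stiff p' q"
  unfolding stiff_def using assms by (simp_all only: L_ip L_sqint)

lemma dvg_lin:
  assumes "u \<in> V_m G" "u' \<in> V_m G" "q \<in> V_f G" "q' \<in> V_f G"
  shows "dvg (a *\<^sub>R u + b *\<^sub>R u') q = a * dvg u q + b * dvg u' q"
    "dvg u (a *\<^sub>R q + b *\<^sub>R q') = a * dvg u q + b * dvg u q'"
  unfolding dvg_def using assms by (simp_all only: L_ip L_sqint)

lemma el_lin:
  assumes "u \<in> V_m G" "u' \<in> V_m G" "v \<in> V_m G"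
  shows "el (a *\<^sub>R u + b *\<^sub>R u') v = a * el u v + b * el u' v"
  unfolding el_def using assms by (simp only: L_ip L_sqint) (simp add: algebra_simps)

lemma trf_lin:
  assumes "j \<in> fractures G" "p \<in> V_f G" "p' \<in> V_f G" "q \<in> V_f G"
  shows "trf j (a *\<^sub>R p + b *\<^sub>R p') q = a * trf j p q + b * trf j p' q"
  unfolding trf_def using assms by (simp only: L_ip L_sqint) (simp add: algebra_simps)

lemma cpl_lin:
  assumes "j \<in> fractures G" "p \<in> V_f G" "p' \<in> V_f G" "r \<in> V_F G j" "r' \<in> V_F G j"
  shows "cpl j (a *\<^sub>R p + b *\<^sub>R p') r = a * cpl j p r + b * cpl j p' r"
    "cpl j p (a *\<^sub>R r + b *\<^sub>R r') = a * cpl j p r + b * cpl j p r'"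
  unfolding cpl_def using assms by (simp_all only: L_ip L_sqint) (simp_all add: algebra_simps)

lemma frm_lin:
  assumes "j \<in> fractures G" "r \<in> V_F G j" "r' \<in> V_F G j" "t \<in> V_F G j"
  shows "frm j (a *\<^sub>R r + b *\<^sub>R r') t = a * frm j r t + b * frm j r' t"
  unfolding frm_def using assms by (simp only: L_ip L_sqint) (simp add: algebra_simps)

lemma mult_lin:
  assumes "j \<in> fractures G" "L \<in> Q_m G j" "L' \<in> Q_m G j" "v \<in> V_m G" "v' \<in> V_m G"
  shows "mult j (a *\<^sub>R L + b *\<^sub>R L') v = a * mult j L v + b * mult j L' v"
    "mult j L (a *\<^sub>R v + b *\<^sub>R v') = a * mult j L v + b * mult j L v'"
  unfolding mult_def using assms by (simp_all only: L_ip L_sqint)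

text \<open>The fracture pressure load in the mechanics equation is absorbed into the multiplier \<open>L\<close>;
  this is possible because \<open>Q_m\<close> contains the fracture pressures times the normal.\<close>

definition mech :: "(R3 \<Rightarrow> real) \<Rightarrow> (R3 \<Rightarrow> R3) \<Rightarrow> bool" where
  "mech p u \<longleftrightarrow> u \<in> V_m G \<and> (\<forall>j\<in>fractures G. \<forall>t\<in>Q_m G j. mult j t u = 0) \<and>
     (\<exists>L. (\<forall>j\<in>fractures G. L j \<in> Q_m G j) \<and>
       (\<forall>v\<in>V_m G. el u v + (\<Sum>j\<in>fractures G. mult j (L j) v) = alpha C * dvg v p))"

definition ffrac :: "(R3 \<Rightarrow> real) \<Rightarrow> (nat \<Rightarrow> R3 \<Rightarrow> real) \<Rightarrow> bool" where
  "ffrac p r \<longleftrightarrow> (\<forall>j\<in>fractures G. r j \<in> V_F G j \<and> (\<forall>t\<in>V_F G j. frm j (r j) t = eta C j * cpl j p t))"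

definition flow :: "(R3 \<Rightarrow> real) \<Rightarrow> (nat \<Rightarrow> R3 \<Rightarrow> real) \<Rightarrow> (R3 \<Rightarrow> real) \<Rightarrow> real" where
  "flow p r q = KD C * stiff p q + (\<Sum>j\<in>fractures G. eta C j * trf j p q) -
     (\<Sum>j\<in>fractures G. eta C j * cpl j q (r j))"

definition load :: "(R3 \<Rightarrow> real) \<Rightarrow> (R3 \<Rightarrow> R3) \<Rightarrow> (R3 \<Rightarrow> real) \<Rightarrow> (R3 \<Rightarrow> real) \<Rightarrow> real" where
  "load g up pp q = 1 / dt C * vol_int G (\<lambda>x. (invM C * pp x + alpha C * divergence up x) * q x) +
     vol_int G (\<lambda>x. g x * q x)"

definition acoef :: real where "acoef = (alpha C)\<^sup>2 / K_dr C"

text \<open>The error equation of the flow half step, multiplied by the time step: \<open>x\<close>,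
  \<open>u\<close> are the old errors, \<open>y\<close>, \<open>r\<close> the new ones. Source and
  previous time step have cancelled. It is a relation, as is \<open>mech\<close>, because the
  argument does not go through solution operators.\<close>

definition fstep :: "(R3 \<Rightarrow> real) \<Rightarrow> (R3 \<Rightarrow> R3) \<Rightarrow> (R3 \<Rightarrow> real) \<Rightarrow> (nat \<Rightarrow> R3 \<Rightarrow> real) \<Rightarrow> bool" where
  "fstep x u y r \<longleftrightarrow> ffrac y r \<and> (\<forall>q\<in>V_f G.
     (invM C + acoef) * mass y q + dt C * flow y r q = acoef * mass x q - alpha C * dvg u q)"

lemma mech_lincomb:
  assumes "mech p u" "mech p' u'" "p \<in> V_f G" "p' \<in> V_f G"
  shows "mech (a *\<^sub>R p + b *\<^sub>R p') (a *\<^sub>R u + b *\<^sub>R u')"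
proof -
  obtain L where L: "u \<in> V_m G" "\<forall>j\<in>fractures G. \<forall>t\<in>Q_m G j. mult j t u = 0"
    "\<forall>j\<in>fractures G. L j \<in> Q_m G j"
    "\<forall>v\<in>V_m G. el u v + (\<Sum>j\<in>fractures G. mult j (L j) v) = alpha C * dvg v p"
    using assms(1) unfolding mech_def by auto
  obtain L' where L': "u' \<in> V_m G" "\<forall>j\<in>fractures G. \<forall>t\<in>Q_m G j. mult j t u' = 0"
    "\<forall>j\<in>fractures G. L' j \<in> Q_m G j"
    "\<forall>v\<in>V_m G. el u' v + (\<Sum>j\<in>fractures G. mult j (L' j) v) = alpha C * dvg v p'"
    using assms(2) unfolding mech_def by auto
  show ?thesis
    unfolding mech_def
  proof (intro conjI ballI exI[of _ "\<lambda>j. a *\<^sub>R L j + b *\<^sub>R L' j"])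
    show "a *\<^sub>R u + b *\<^sub>R u' \<in> V_m G" using L L' by (intro subspace_lincomb_mem subspace_V_m)
    show "mult j t (a *\<^sub>R u + b *\<^sub>R u') = 0" if "j \<in> fractures G" "t \<in> Q_m G j" for j t
      using L(2) L'(2) that by (simp add: mult_lin(2)[OF that that(2) L(1) L'(1)])
    show "a *\<^sub>R L j + b *\<^sub>R L' j \<in> Q_m G j" if "j \<in> fractures G" for j
      using L L' that by (intro subspace_lincomb_mem subspace_Q_m) auto
    fix v assume v: "v \<in> V_m G"
    have "(\<Sum>j\<in>fractures G. mult j (a *\<^sub>R L j + b *\<^sub>R L' j) v) =
        a * (\<Sum>j\<in>fractures G. mult j (L j) v) + b * (\<Sum>j\<in>fractures G. mult j (L' j) v)"
      unfolding sum_distrib_left sum.distrib[symmetric]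
      using L(3) L'(3) v by (intro sum.cong refl mult_lin(1)[where v'=v]) auto
    moreover have "el (a *\<^sub>R u + b *\<^sub>R u') v = a * el u v + b * el u' v"
      using L(1) L'(1) v by (rule el_lin)
    moreover have "dvg v (a *\<^sub>R p + b *\<^sub>R p') = a * dvg v p + b * dvg v p'"
      using v v assms(3,4) by (rule dvg_lin(2))
    moreover have "a * (el u v + (\<Sum>j\<in>fractures G. mult j (L j) v)) = a * (alpha C * dvg v p)"
      "b * (el u' v + (\<Sum>j\<in>fractures G. mult j (L' j) v)) = b * (alpha C * dvg v p')"
      using L(4) L'(4) v by simp_all
    ultimately show "el (a *\<^sub>R u + b *\<^sub>R u') v + (\<Sum>j\<in>fractures G. mult j (a *\<^sub>R L j + b *\<^sub>R L' j) v) =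
        alpha C * dvg v (a *\<^sub>R p + b *\<^sub>R p')"
      by (simp add: algebra_simps)
  qed
qed

lemma ffrac_lincomb:
  assumes "ffrac p r" "ffrac p' r'" "p \<in> V_f G" "p' \<in> V_f G"
  shows "ffrac (a *\<^sub>R p + b *\<^sub>R p') (\<lambda>j. a *\<^sub>R r j + b *\<^sub>R r' j)"
  unfolding ffrac_def
proof (intro ballI conjI)
  fix j assume j: "j \<in> fractures G"
  have r: "r j \<in> V_F G j" "r' j \<in> V_F G j" using assms(1,2) j by (auto simp: ffrac_def)
  then show "a *\<^sub>R r j + b *\<^sub>R r' j \<in> V_F G j" by (intro subspace_lincomb_mem subspace_V_F)
  fix t assume t: "t \<in> V_F G j"
  have "frm j (r j) t = eta C j * cpl j p t" "frm j (r' j) t = eta C j * cpl j p' t"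
    using assms(1,2) j t by (auto simp: ffrac_def)
  then show "frm j (a *\<^sub>R r j + b *\<^sub>R r' j) t = eta C j * cpl j (a *\<^sub>R p + b *\<^sub>R p') t"
    unfolding frm_lin[OF j r t] cpl_lin(1)[OF j assms(3,4) t t] by (simp add: algebra_simps)
qed

lemma flow_lincomb:
  assumes "p \<in> V_f G" "p' \<in> V_f G" "q \<in> V_f G" "\<And>j. j \<in> fractures G \<Longrightarrow> r j \<in> V_F G j"
    "\<And>j. j \<in> fractures G \<Longrightarrow> r' j \<in> V_F G j"
  shows "flow (a *\<^sub>R p + b *\<^sub>R p') (\<lambda>j. a *\<^sub>R r j + b *\<^sub>R r' j) q = a * flow p r q + b * flow p' r' q"
proof -
  have "(\<Sum>j\<in>fractures G. eta C j * trf j (a *\<^sub>R p + b *\<^sub>R p') q) =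
      a * (\<Sum>j\<in>fractures G. eta C j * trf j p q) + b * (\<Sum>j\<in>fractures G. eta C j * trf j p' q)"
    unfolding sum_distrib_left sum.distrib[symmetric]
    by (intro sum.cong refl) (simp only: trf_lin assms, simp add: algebra_simps)
  moreover have "(\<Sum>j\<in>fractures G. eta C j * cpl j q (a *\<^sub>R r j + b *\<^sub>R r' j)) =
      a * (\<Sum>j\<in>fractures G. eta C j * cpl j q (r j)) + b * (\<Sum>j\<in>fractures G. eta C j * cpl j q (r' j))"
    unfolding sum_distrib_left sum.distrib[symmetric]
    by (intro sum.cong refl, subst cpl_lin(2)[where p'=q]) (simp_all add: assms algebra_simps)
  moreover have "stiff (a *\<^sub>R p + b *\<^sub>R p') q = a * stiff p q + b * stiff p' q"
    using assms(1-3) by (rule stiff_lin)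
  ultimately show ?thesis unfolding flow_def by (simp add: algebra_simps)
qed

lemma fstep_lincomb:
  assumes "fstep x u y r" "fstep x' u' y' r'" "x \<in> V_f G" "x' \<in> V_f G" "y \<in> V_f G" "y' \<in> V_f G"
    "u \<in> V_m G" "u' \<in> V_m G"
  shows "fstep (a *\<^sub>R x + b *\<^sub>R x') (a *\<^sub>R u + b *\<^sub>R u') (a *\<^sub>R y + b *\<^sub>R y') (\<lambda>j. a *\<^sub>R r j + b *\<^sub>R r' j)"
  unfolding fstep_def
proof (intro conjI ballI)
  have f: "ffrac y r" "ffrac y' r'" using assms(1,2) by (auto simp: fstep_def)
  then show "ffrac (a *\<^sub>R y + b *\<^sub>R y') (\<lambda>j. a *\<^sub>R r j + b *\<^sub>R r' j)"
    using assms by (intro ffrac_lincomb)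
  fix q assume q: "q \<in> V_f G"
  have r: "\<And>j. j \<in> fractures G \<Longrightarrow> r j \<in> V_F G j" "\<And>j. j \<in> fractures G \<Longrightarrow> r' j \<in> V_F G j"
    using f by (auto simp: ffrac_def)
  have fl: "flow (a *\<^sub>R y + b *\<^sub>R y') (\<lambda>j. a *\<^sub>R r j + b *\<^sub>R r' j) q = a * flow y r q + b * flow y' r' q"
    by (rule flow_lincomb) (use assms q r in auto)
  have "a * ((invM C + acoef) * mass y q + dt C * flow y r q) = a * (acoef * mass x q - alpha C * dvg u q)"
    "b * ((invM C + acoef) * mass y' q + dt C * flow y' r' q) = b * (acoef * mass x' q - alpha C * dvg u' q)"
    using assms(1,2) q by (auto simp: fstep_def)
  then show "(invM C + acoef) * mass (a *\<^sub>R y + b *\<^sub>R y') q +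
      dt C * flow (a *\<^sub>R y + b *\<^sub>R y') (\<lambda>j. a *\<^sub>R r j + b *\<^sub>R r' j) q =
      acoef * mass (a *\<^sub>R x + b *\<^sub>R x') q - alpha C * dvg (a *\<^sub>R u + b *\<^sub>R u') q"
    unfolding fl mass_lin(1)[OF assms(5,6) q] mass_lin(1)[OF assms(3,4) q]
      dvg_lin(1)[OF assms(7,8) q q]
    by (simp add: algebra_simps)
qed

section \<open>Translation of the discrete problems\<close>

lemma elasticity_inner:
  "elasticity l m (strain u x) \<bullet> strain v x = l * (divergence u x * divergence v x) + 2 * m * (strain u x \<bullet> strain v x)"
proof -
  have "(mat 1 :: real^3^3) \<bullet> A = trace A" for A
    by (simp add: trace_def inner_vec_def mat_def sum_3)
  then show ?thesis by (simp add: elasticity_def inner_add_left trace_strain)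
qed

lemma vol_int_mass:
  assumes "p \<in> V_f G" "q \<in> V_f G"
  shows "vol_int G (\<lambda>x. c * p x * q x) = c * mass p q"
  unfolding vol_int_eq mass_def ip_def by (simp add: mult.assoc)

lemma vol_int_storage:
  assumes "p \<in> V_f G" "u \<in> V_m G" "q \<in> V_f G"
  shows "vol_int G (\<lambda>x. (c * p x + d * divergence u x) * q x) = c * mass p q + d * dvg u q"
  unfolding vol_int_eq mass_def dvg_def ip_def
  using integrable_inner[OF L_sqint(1)[OF assms(1)] L_sqint(1)[OF assms(3)]]
    integrable_inner[OF L_sqint(3)[OF assms(2)] L_sqint(1)[OF assms(3)]]
  by (simp add: algebra_simps)

lemma vol_int_div: "vol_int G (\<lambda>x. c * divergence u x * q x) = c * dvg u q"
  "vol_int G (\<lambda>x. c * q x * divergence u x) = c * dvg u q"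
proof -
  show *: "vol_int G (\<lambda>x. c * divergence u x * q x) = c * dvg u q"
    unfolding vol_int_eq dvg_def ip_def by (simp add: mult.assoc)
  have "(\<lambda>x. c * q x * divergence u x) = (\<lambda>x. c * divergence u x * q x)" by (simp add: fun_eq_iff)
  then show "vol_int G (\<lambda>x. c * q x * divergence u x) = c * dvg u q" using * by simp
qed

lemma vol_int_stiff: "vol_int G (\<lambda>x. c * (grad p x \<bullet> grad q x)) = c * stiff p q"
  unfolding vol_int_eq stiff_def ip_def by simp

lemma vol_int_el:
  assumes "u \<in> V_m G" "v \<in> V_m G"
  shows "vol_int G (\<lambda>x. elasticity (lam C) (mu C) (strain u x) \<bullet> strain v x) = el u v"
  unfolding vol_int_eq el_def ip_def elasticity_inner
  using integrable_inner[OF L_sqint(3)[OF assms(1)] L_sqint(3)[OF assms(2)]]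
    integrable_inner[OF L_sqint(4)[OF assms(1)] L_sqint(4)[OF assms(2)]]
  by (simp add: algebra_simps)

lemma surf_int_trf:
  assumes j: "j \<in> fractures G" and pq: "p \<in> V_f G" "q \<in> V_f G"
  shows "surf_int G j (\<lambda>x. c * (trace_pos G j p x * trace_pos G j q x + trace_neg G j p x * trace_neg G j q x))
    = c * trf j p q"
  unfolding surf_int_eq[OF j] trf_def ip_def trace_pos_eq trace_neg_eq
  using integrable_inner[OF L_sqint(5)[OF j pq(1)] L_sqint(5)[OF j pq(2)]]
    integrable_inner[OF L_sqint(6)[OF j pq(1)] L_sqint(6)[OF j pq(2)]]
  by (simp add: T_def[abs_def] distrib_left)

lemma surf_int_cpl:
  assumes j: "j \<in> fractures G" and pr: "p \<in> V_f G" "r \<in> V_F G j"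
  shows "surf_int G j (\<lambda>x. c * r x * (trace_pos G j p x + trace_neg G j p x)) = c * cpl j p r"
    "surf_int G j (\<lambda>x. c * (trace_pos G j p x + trace_neg G j p x) * r x) = c * cpl j p r"
proof -
  show "surf_int G j (\<lambda>x. c * (trace_pos G j p x + trace_neg G j p x) * r x) = c * cpl j p r"
    unfolding surf_int_eq[OF j] cpl_def ip_def trace_pos_eq trace_neg_eq
    using integrable_inner[OF L_sqint(5)[OF j pr(1)] L_sqint(8)[OF j pr(2)]]
      integrable_inner[OF L_sqint(6)[OF j pr(1)] L_sqint(8)[OF j pr(2)]]
    by (simp add: T_def[abs_def] on_frac_def[abs_def] distrib_left distrib_right mult.assoc)
  then show "surf_int G j (\<lambda>x. c * r x * (trace_pos G j p x + trace_neg G j p x)) = c * cpl j p r"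
    by (simp add: mult.assoc mult.commute[of "r _"])
qed

text \<open>\<open>X\<close> stands for the storage term in front: sums associate to the left, so
  the flow terms form no subterm of their own in the discrete equations.\<close>

lemma flow_eq:
  assumes "p \<in> V_f G" "q \<in> V_f G" "\<forall>j\<in>fractures G. r j \<in> V_F G j"
  shows "X + vol_int G (\<lambda>x. KD C * (grad p x \<bullet> grad q x))
      + (\<Sum>j\<in>fractures G. surf_int G j (\<lambda>x. eta C j *
           (trace_pos G j p x * trace_pos G j q x + trace_neg G j p x * trace_neg G j q x)))
      - (\<Sum>j\<in>fractures G. surf_int G j (\<lambda>x. eta C j * r j x *
           (trace_pos G j q x + trace_neg G j q x))) = X + flow p r q"
proof -
  have "(\<Sum>j\<in>fractures G. surf_int G j (\<lambda>x. eta C j *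
           (trace_pos G j p x * trace_pos G j q x + trace_neg G j p x * trace_neg G j q x)))
      = (\<Sum>j\<in>fractures G. eta C j * trf j p q)"
    by (intro sum.cong refl surf_int_trf assms(1,2))
  moreover have "(\<Sum>j\<in>fractures G. surf_int G j (\<lambda>x. eta C j * r j x *
           (trace_pos G j q x + trace_neg G j q x))) = (\<Sum>j\<in>fractures G. eta C j * cpl j q (r j))"
    using assms(3) by (intro sum.cong refl surf_int_cpl(1) assms(2)) auto
  ultimately show ?thesis by (simp add: vol_int_stiff flow_def)
qed

lemma surf_int_frm:
  assumes j: "j \<in> fractures G"
  shows "surf_int G j (\<lambda>x. KF C j * (tan_grad G j r x \<bullet> tan_grad G j t x)) +
    surf_int G j (\<lambda>x. 2 * eta C j * r x * t x) = frm j r t"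
  unfolding surf_int_eq[OF j] frm_def ip_def by (simp add: TG_def on_frac_def mult.assoc)

lemma surf_int_mult:
  assumes j: "j \<in> fractures G"
  shows "surf_int G j (\<lambda>x. L x \<bullet> (trace_neg G j v x - trace_pos G j v x)) = mult j L v"
    "surf_int G j (\<lambda>x. (trace_neg G j v x - trace_pos G j v x) \<bullet> L x) = mult j L v"
  unfolding surf_int_eq[OF j] mult_def ip_def trace_pos_eq trace_neg_eq
  by (simp_all add: jump_def on_frac_def inner_commute)

lemma fracture_flow_iff:
  assumes "p \<in> V_f G" "\<And>j. j \<in> fractures G \<Longrightarrow> r j \<in> V_F G j"
  shows "fracture_flow_eq G C p r \<longleftrightarrow> ffrac p r"
  unfolding fracture_flow_eq_def ffrac_def
proof (rule ball_cong[OF refl])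
  fix j assume j: "j \<in> fractures G"
  show "(\<forall>q\<in>V_F G j. surf_int G j (\<lambda>x. KF C j * (tan_grad G j (r j) x \<bullet> tan_grad G j q x))
      + surf_int G j (\<lambda>x. 2 * eta C j * r j x * q x)
      - surf_int G j (\<lambda>x. eta C j * (trace_pos G j p x + trace_neg G j p x) * q x) = 0) \<longleftrightarrow>
    (r j \<in> V_F G j \<and> (\<forall>t\<in>V_F G j. frm j (r j) t = eta C j * cpl j p t))"
    unfolding surf_int_frm[OF j] using assms(2)[OF j] by (simp add: surf_int_cpl(2)[OF j assms(1)])
qed

lemma constraint_iff: "constraint_eq G u \<longleftrightarrow> (\<forall>j\<in>fractures G. \<forall>t\<in>Q_m G j. mult j t u = 0)"
  unfolding constraint_eq_def by (simp add: surf_int_mult)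

end

lemma nonneg_contraction_tendsto_0:
  fixes N :: "nat \<Rightarrow> real"
  assumes "0 \<le> r" "r < 1" "\<And>i. 0 \<le> N i" "\<And>i. N (Suc i) \<le> r * N i"
  shows "N \<longlonglongrightarrow> 0"
proof -
  have le: "N i \<le> r ^ i * N 0" for i
  proof (induction i)
    case (Suc i)
    have "N (Suc i) \<le> r * N i" by (rule assms)
    also have "\<dots> \<le> r * (r ^ i * N 0)" using Suc assms(1) by (rule mult_left_mono)
    finally show ?case by simp
  qed simp
  have "(\<lambda>i. r ^ i * N 0) \<longlonglongrightarrow> 0 * N 0"
    using assms(1,2) by (intro tendsto_mult LIMSEQ_power_zero tendsto_const) auto
  then have "(\<lambda>i. r ^ i * N 0) \<longlonglongrightarrow> 0" by simp
  then show ?thesis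
    by (rule tendsto_sandwich[OF _ _ tendsto_const, rotated 2]) (use le assms(3) in auto)
qed

context poroelastic
begin

lemma mech_multiplier:
  assumes "mech p u"
  obtains L where "\<And>j. j \<in> fractures G \<Longrightarrow> L j \<in> Q_m G j"
    "\<And>v. v \<in> V_m G \<Longrightarrow> el u v + (\<Sum>j\<in>fractures G. mult j (L j) v) = alpha C * dvg v p"
proof -
  have "\<exists>L. (\<forall>j\<in>fractures G. L j \<in> Q_m G j) \<and>
      (\<forall>v\<in>V_m G. el u v + (\<Sum>j\<in>fractures G. mult j (L j) v) = alpha C * dvg v p)"
    using assms by (simp only: mech_def)
  then obtain L where L: "(\<forall>j\<in>fractures G. L j \<in> Q_m G j) \<and>
      (\<forall>v\<in>V_m G. el u v + (\<Sum>j\<in>fractures G. mult j (L j) v) = alpha C * dvg v p)" by (rule exE)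
  show ?thesis by (rule that[of L]) (use L in simp_all)
qed

lemma BE_imp:
  assumes "BE_solution G C g up pp u p r \<Lambda>"
  shows "u \<in> V_m G" "p \<in> V_f G" "mech p u" "ffrac p r"
    "\<And>q. q \<in> V_f G \<Longrightarrow> 1 / dt C * (invM C * mass p q + alpha C * dvg u q) + flow p r q = load g up pp q"
proof -
  show u: "u \<in> V_m G" and p: "p \<in> V_f G" using assms by (auto simp: BE_solution_def)
  have r: "\<And>j. j \<in> fractures G \<Longrightarrow> r j \<in> V_F G j" "\<And>j. j \<in> fractures G \<Longrightarrow> \<Lambda> j \<in> Q_m G j"
    "\<forall>j\<in>fractures G. r j \<in> V_F G j"
    using assms by (auto simp: BE_solution_def)
  show "ffrac p r"
    using assms fracture_flow_iff[OF p r(1)] by (simp add: BE_solution_def)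
  let ?L = "\<lambda>j x. \<Lambda> j x - (alpha C * r j x) *\<^sub>R nrm G j"
  have L: "?L j \<in> Q_m G j" if "j \<in> fractures G" for j
    using subspace_diff[OF subspace_Q_m r(2)[OF that] V_F_normal_in_Q_m[OF r(1)[OF that], of "alpha C" "nrm G j"]]
    by (simp add: fun_diff_def)
  have "el u v + (\<Sum>j\<in>fractures G. mult j (?L j) v) = alpha C * dvg v p" if v: "v \<in> V_m G" for v
  proof -
    have "- vol_int G (\<lambda>x. alpha C * p x * divergence v x)
        + vol_int G (\<lambda>x. elasticity (lam C) (mu C) (strain u x) \<bullet> strain v x)
        + (\<Sum>j\<in>fractures G. surf_int G j (\<lambda>x. ?L j x \<bullet> (trace_neg G j v x - trace_pos G j v x))) = 0"
      using assms v by (simp only: BE_solution_def)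
    moreover have "(\<Sum>j\<in>fractures G. surf_int G j (\<lambda>x. ?L j x \<bullet> (trace_neg G j v x - trace_pos G j v x)))
        = (\<Sum>j\<in>fractures G. mult j (?L j) v)"
      by (intro sum.cong refl surf_int_mult(1))
    ultimately show ?thesis
      unfolding vol_int_div(2) vol_int_el[OF u v] by linarith
  qed
  moreover have "constraint_eq G u" using assms by (simp add: BE_solution_def)
  ultimately show "mech p u"
    unfolding mech_def constraint_iff using u L by (intro conjI exI[of _ ?L]) auto
  fix q assume q: "q \<in> V_f G"
  show "1 / dt C * (invM C * mass p q + alpha C * dvg u q) + flow p r q = load g up pp q"
    using assms[unfolded BE_solution_def, THEN conjunct2, THEN conjunct2, THEN conjunct2, THEN conjunct1, THEN bspec, OF q]
    by (simp only: vol_int_storage[OF p u q] flow_eq[OF p q r(3)] load_def)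
qed

text \<open>Needed to manufacture a second solution in the uniqueness argument. The physical
  multiplier is recovered by adding the fracture pressure load back.\<close>

lemma BE_intro:
  assumes u: "u \<in> V_m G" and p: "p \<in> V_f G" and m: "mech p u" and f: "ffrac p r"
    and fl: "\<And>q. q \<in> V_f G \<Longrightarrow> 1 / dt C * (invM C * mass p q + alpha C * dvg u q) + flow p r q = load g up pp q"
  obtains \<Lambda> where "BE_solution G C g up pp u p r \<Lambda>"
proof -
  have r: "\<And>j. j \<in> fractures G \<Longrightarrow> r j \<in> V_F G j" and r': "\<forall>j\<in>fractures G. r j \<in> V_F G j"
    using f by (auto simp: ffrac_def)
  obtain L where L: "\<And>j. j \<in> fractures G \<Longrightarrow> L j \<in> Q_m G j"
    "\<And>v. v \<in> V_m G \<Longrightarrow> el u v + (\<Sum>j\<in>fractures G. mult j (L j) v) = alpha C * dvg v p"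
    using mech_multiplier[OF m] by metis
  define \<Lambda> where "\<Lambda> = (\<lambda>j x. L j x + (alpha C * r j x) *\<^sub>R nrm G j)"
  have \<Lambda>: "\<Lambda> j \<in> Q_m G j" if "j \<in> fractures G" for j
    using subspace_add[OF subspace_Q_m L(1)[OF that] V_F_normal_in_Q_m[OF r[OF that], of "alpha C" "nrm G j"]]
    by (simp add: \<Lambda>_def plus_fun_def)
  have \<Lambda>L: "\<Lambda> j x - (alpha C * r j x) *\<^sub>R nrm G j = L j x" for j x by (simp add: \<Lambda>_def)
  have "BE_solution G C g up pp u p r \<Lambda>"
    unfolding BE_solution_def
  proof (intro conjI ballI, goal_cases)
    case (5 q)
    then show ?case
      using fl[OF 5] by (simp only: vol_int_storage[OF p u 5] flow_eq[OF p 5 r'] load_def)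
  next
    case (7 v)
    have "(\<Sum>j\<in>fractures G. surf_int G j (\<lambda>x. L j x \<bullet> (trace_neg G j v x - trace_pos G j v x))) =
        (\<Sum>j\<in>fractures G. mult j (L j) v)"
      by (intro sum.cong refl surf_int_mult(1))
    then show ?case
      using L(2)[OF 7] unfolding \<Lambda>L vol_int_div(2) vol_int_el[OF u 7] by linarith
  qed (use u p r m f \<Lambda> fracture_flow_iff[OF p r] in \<open>auto simp: constraint_iff mech_def\<close>)
  then show ?thesis by (rule that)
qed

lemma FS_mech_imp:
  assumes "FS_mech G C p r u \<Lambda>" and r: "\<And>j. j \<in> fractures G \<Longrightarrow> r j \<in> V_F G j"
  shows "mech p u"
proof -
  have u: "u \<in> V_m G" and \<Lambda>: "\<And>j. j \<in> fractures G \<Longrightarrow> \<Lambda> j \<in> Q_m G j"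
    using assms by (auto simp: FS_mech_def)
  define N where "N = (\<lambda>j x. (alpha C * r j x) *\<^sub>R nrm G j)"
  have N: "N j \<in> Q_m G j" if "j \<in> fractures G" for j
    unfolding N_def by (rule V_F_normal_in_Q_m[OF r[OF that]])
  let ?L = "\<lambda>j. 1 *\<^sub>R \<Lambda> j + (-1) *\<^sub>R N j"
  have L: "?L j \<in> Q_m G j" if "j \<in> fractures G" for j
    using \<Lambda>[OF that] N[OF that] by (intro subspace_lincomb_mem subspace_Q_m)
  have "el u v + (\<Sum>j\<in>fractures G. mult j (?L j) v) = alpha C * dvg v p" if v: "v \<in> V_m G" for v
  proof -
    have "vol_int G (\<lambda>x. elasticity (lam C) (mu C) (strain u x) \<bullet> strain v x)
        + (\<Sum>j\<in>fractures G. surf_int G j (\<lambda>x. \<Lambda> j x \<bullet> (trace_neg G j v x - trace_pos G j v x)))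
        = vol_int G (\<lambda>x. alpha C * p x * divergence v x)
          + (\<Sum>j\<in>fractures G. surf_int G j (\<lambda>x. N j x \<bullet> (trace_neg G j v x - trace_pos G j v x)))"
      using assms(1) v unfolding N_def by (simp only: FS_mech_def)
    moreover have "(\<Sum>j\<in>fractures G. surf_int G j (\<lambda>x. F j x \<bullet> (trace_neg G j v x - trace_pos G j v x)))
        = (\<Sum>j\<in>fractures G. mult j (F j) v)" for F
      by (intro sum.cong refl surf_int_mult(1))
    moreover have "(\<Sum>j\<in>fractures G. mult j (?L j) v) =
        (\<Sum>j\<in>fractures G. mult j (\<Lambda> j) v) - (\<Sum>j\<in>fractures G. mult j (N j) v)"
      unfolding sum_subtractf[symmetric]
      by (intro sum.cong refl, subst mult_lin(1)[where v'=v]) (simp_all add: \<Lambda> N v)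
    ultimately show ?thesis
      unfolding vol_int_div(2) vol_int_el[OF u v] by simp
  qed
  moreover have "constraint_eq G u" using assms by (simp add: FS_mech_def)
  ultimately show "mech p u"
    unfolding mech_def constraint_iff using u L by (intro conjI exI[of _ ?L]) auto
qed

lemma FS_flow_imp:
  assumes "FS_flow G C g up pp uit pit p r" "uit \<in> V_m G" "pit \<in> V_f G"
  shows "p \<in> V_f G" "ffrac p r"
    "\<And>q. q \<in> V_f G \<Longrightarrow> 1 / dt C * ((invM C + acoef) * mass p q) + flow p r q =
       load g up pp q - 1 / dt C * (alpha C * dvg uit q) + 1 / dt C * (acoef * mass pit q)"
proof -
  show p: "p \<in> V_f G" using assms by (auto simp: FS_flow_def)
  have r: "\<forall>j\<in>fractures G. r j \<in> V_F G j" using assms by (auto simp: FS_flow_def)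
  show "ffrac p r"
    using assms r fracture_flow_iff[OF p, of r] by (simp add: FS_flow_def)
  fix q assume q: "q \<in> V_f G"
  show "1 / dt C * ((invM C + acoef) * mass p q) + flow p r q =
       load g up pp q - 1 / dt C * (alpha C * dvg uit q) + 1 / dt C * (acoef * mass pit q)"
    using assms(1)[unfolded FS_flow_def, folded acoef_def, THEN conjunct2, THEN conjunct2, THEN conjunct1, THEN bspec, OF q]
    by (simp only: vol_int_mass[OF p q] vol_int_mass[OF assms(3) q] vol_int_div(1) flow_eq[OF p q r] load_def)
qed

text \<open>At the first time step the previous values are the zero initial data, for which no
  coupled equation is given. The initial guess has to satisfy the mechanics equation all the same,
  since the first contraction estimate uses it.\<close>

lemma mech_zero: "mech 0 0"
proof -
  have 0: "0 \<in> V_m G" "0 \<in> V_f G" "\<And>j. 0 \<in> Q_m G j"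
    using subspace_0[OF subspace_V_m] subspace_0[OF subspace_V_f] subspace_0[OF subspace_Q_m] by auto
  have "el 0 v = 0" "dvg v 0 = 0" if "v \<in> V_m G" for v
    using el_lin[OF 0(1) 0(1) that, of 0 0] dvg_lin(2)[OF that that 0(2,2), of 0 0] by simp_all
  moreover have "mult j 0 v = 0" if "j \<in> fractures G" "v \<in> V_m G" for j v
    using mult_lin(1)[OF that(1) 0(3,3) that(2,2), of 0 0] by simp
  moreover have "mult j t 0 = 0" if "j \<in> fractures G" "t \<in> Q_m G j" for j t
    using mult_lin(2)[OF that(1,2,2) 0(1,1), of 0 0] by simp
  ultimately show ?thesis
    unfolding mech_def using 0 by (intro conjI exI[of _ "\<lambda>j. 0"] ballI) (auto intro!: sum.neutral)
qed

section \<open>Energy estimates\<close>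

lemma vol_norm_square: "(vol_norm G f)\<^sup>2 = ip (MV G) f f" for f :: "R3 \<Rightarrow> 'b::euclidean_space"
  unfolding vol_norm_def vol_int_eq ip_self_norm by simp

lemma el_self: "el u u = lam C * (vol_norm G (divergence u))\<^sup>2 + 2 * mu C * (vol_norm G (strain u))\<^sup>2"
  by (simp add: el_def vol_norm_square)

lemma mass_self: "mass p p = (vol_norm G p)\<^sup>2"
  by (simp add: mass_def vol_norm_square)

lemma stiff_self: "stiff p p = (vol_norm G (grad p))\<^sup>2"
  unfolding stiff_def vol_norm_def vol_int_eq ip_self_norm by simp

lemma frm_self:
  assumes j: "j \<in> fractures G"
  shows "frm j r r = KF C j * (surf_norm G j (tan_grad G j r))\<^sup>2 + 2 * eta C j * (surf_norm G j r)\<^sup>2"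
  unfolding frm_def surf_norm_def surf_int_eq[OF j] ip_self_norm TG_def on_frac_def by simp

lemma trf_self:
  assumes j: "j \<in> fractures G" and p: "p \<in> V_f G"
  shows "trf j p p = surf_int G j (\<lambda>x. (trace_pos G j p x)\<^sup>2 + (trace_neg G j p x)\<^sup>2)"
  using surf_int_trf[OF j p p, of 1] by (simp add: power2_eq_square)

lemma el_nonneg: "0 \<le> el u u"
  unfolding el_self using pos by simp

text \<open>Here \<open>K_dr = lam + 2/3 * mu\<close> enters, through \<open>(tr E)\<^sup>2 \<le> 3 |E|\<^sup>2\<close>.\<close>

lemma K_dr_div_le:
  assumes u: "u \<in> V_m G"
  shows "K_dr C * ip (MV G) (divergence u) (divergence u) \<le> el u u"
proof -
  have "ip (MV G) (divergence u) (divergence u) \<le> (\<integral>x. 3 * (strain u x \<bullet> strain u x) \<partial>MV G)"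
    unfolding ip_def
  proof (rule integral_mono)
    show "integrable (MV G) (\<lambda>x. divergence u x \<bullet> divergence u x)"
      by (rule integrable_inner[OF L_sqint(3)[OF u] L_sqint(3)[OF u]])
    show "integrable (MV G) (\<lambda>x. 3 * (strain u x \<bullet> strain u x))"
      using integrable_inner[OF L_sqint(4)[OF u] L_sqint(4)[OF u]] by simp
    show "divergence u x \<bullet> divergence u x \<le> 3 * (strain u x \<bullet> strain u x)" for x
      using trace_square_le[of "strain u x"]
      by (simp add: trace_strain power2_eq_square flip: power2_norm_eq_inner)
  qed
  also have "\<dots> = 3 * ip (MV G) (strain u) (strain u)" by (simp add: ip_def)
  finally have "2 / 3 * mu C * ip (MV G) (divergence u) (divergence u) \<le> 2 / 3 * mu C * (3 * ip (MV G) (strain u) (strain u))"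
    using pos(3) by (intro mult_left_mono) auto
  then show ?thesis by (simp add: el_def K_dr_def algebra_simps)
qed

lemma acoef_pos: "acoef > 0"
  using pos by (simp add: acoef_def)

lemma mech_energy:
  assumes "mech p u"
  shows "u \<in> V_m G" "el u u = alpha C * dvg u p"
proof -
  show u: "u \<in> V_m G" using assms by (simp add: mech_def)
  obtain L where L: "\<And>j. j \<in> fractures G \<Longrightarrow> L j \<in> Q_m G j"
    "\<And>v. v \<in> V_m G \<Longrightarrow> el u v + (\<Sum>j\<in>fractures G. mult j (L j) v) = alpha C * dvg v p"
    using mech_multiplier[OF assms] by metis
  have "(\<Sum>j\<in>fractures G. mult j (L j) u) = 0"
    using assms L(1) by (intro sum.neutral) (auto simp: mech_def)
  then show "el u u = alpha C * dvg u p" using L(2)[OF u] by simp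
qed

lemma mech_estimate:
  assumes m: "mech p u" and p: "p \<in> V_f G"
  shows "el u u \<le> acoef * mass p p"
proof -
  note u = mech_energy(1)[OF m]
  \<comment> \<open>With this weight, multiplication by \<open>alpha C\<close> leaves exactly
    \<open>K_dr\<close> times the squared divergence. That is at most \<open>el u u\<close> and is
    absorbed by the doubled left-hand side.\<close>
  have "2 * dvg u p \<le> K_dr C / alpha C * ip (MV G) (divergence u) (divergence u) + mass p p / (K_dr C / alpha C)"
    unfolding dvg_def mass_def using pos by (intro ip_young L_sqint(3)[OF u] L_sqint(1)[OF p]) auto
  then have "alpha C * (2 * dvg u p) \<le>
      alpha C * (K_dr C / alpha C * ip (MV G) (divergence u) (divergence u) + mass p p / (K_dr C / alpha C))"
    using pos(1) by (intro mult_left_mono) auto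
  also have "\<dots> = K_dr C * ip (MV G) (divergence u) (divergence u) + acoef * mass p p"
    using pos(1,9) by (simp add: acoef_def field_simps power2_eq_square)
  finally show ?thesis using K_dr_div_le[OF u] mech_energy(2)[OF m] by simp
qed

text \<open>Test with \<open>r j\<close> itself and apply Young's inequality with weight 1 on each
  side: twice the coupling is at most \<open>trf j p p\<close> plus twice the squared norm of
  \<open>r j\<close>. After scaling by \<open>eta\<close> the latter is absorbed into
  \<open>frm\<close>.\<close>

lemma ffrac_estimate:
  assumes f: "ffrac p r" and p: "p \<in> V_f G" and j: "j \<in> fractures G"
  shows "frm j (r j) (r j) \<le> eta C j * trf j p p" "eta C j * cpl j p (r j) \<le> eta C j * trf j p p"
    "2 * eta C j * (surf_norm G j (r j))\<^sup>2 \<le> eta C j * trf j p p"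
proof -
  have r: "r j \<in> V_F G j" and eq: "frm j (r j) (r j) = eta C j * cpl j p (r j)"
    using f j by (auto simp: ffrac_def)
  let ?R = "ip (MS G j) (on_frac j (r j)) (on_frac j (r j))"
  have "2 * cpl j p (r j) \<le> trf j p p + 2 * ?R"
    using ip_young[OF L_sqint(5)[OF j p] L_sqint(8)[OF j r], of 1]
      ip_young[OF L_sqint(6)[OF j p] L_sqint(8)[OF j r], of 1]
    by (simp add: cpl_def trf_def)
  then have "eta C j * (2 * cpl j p (r j)) \<le> eta C j * (trf j p p + 2 * ?R)"
    using pos(7)[OF j] by (intro mult_left_mono) auto
  moreover have "2 * eta C j * ?R \<le> frm j (r j) (r j)"
    using pos(8)[OF j] by (simp add: frm_def ip_self_nonneg)
  ultimately show *: "frm j (r j) (r j) \<le> eta C j * trf j p p"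
    using eq by (simp add: algebra_simps)
  then show "eta C j * cpl j p (r j) \<le> eta C j * trf j p p" using eq by simp
  show "2 * eta C j * (surf_norm G j (r j))\<^sup>2 \<le> eta C j * trf j p p"
    using * pos(8)[OF j] unfolding frm_self[OF j]
    by (smt (verit) mult_nonneg_nonneg zero_le_power2)
qed

text \<open>The exchange between matrix and fractures only dissipates: by
  \<open>ffrac_estimate\<close> the coupling is dominated by the trace terms.\<close>

lemma flow_self_ge:
  assumes "ffrac p r" "p \<in> V_f G"
  shows "KD C * stiff p p \<le> flow p r p"
proof -
  have "(\<Sum>j\<in>fractures G. eta C j * cpl j p (r j)) \<le> (\<Sum>j\<in>fractures G. eta C j * trf j p p)"
    by (intro sum_mono ffrac_estimate(2)[OF assms])
  then show ?thesis by (simp add: flow_def)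
qed

text \<open>Testing with \<open>y\<close> and completing the square, the mechanics equation tested
  with \<open>u\<close> supplies \<open>alpha C * dvg u x = el u u\<close>. One of the two copies of
  the energy pays for the divergence term, the other remains on the left.\<close>

lemma step_estimate:
  assumes m: "mech x u" and st: "fstep x u y r" and x: "x \<in> V_f G" and y: "y \<in> V_f G"
  shows "(invM C + acoef / 2) * mass y y + dt C * (KD C * stiff y y) + el u u / 2 \<le> acoef / 2 * mass x x"
proof -
  note u = mech_energy(1)[OF m]
  \<comment> \<open>The right-hand side as a single L2 function, so that one application of Young's
    inequality treats old pressure and divergence together.\<close>
  define w where "w = (\<lambda>z. acoef *\<^sub>R x z + (- alpha C) *\<^sub>R divergence u z)"
  have w: "sqint (MV G) w" unfolding w_def by (rule sqint_lincomb[OF L_sqint(1)[OF x] L_sqint(3)[OF u]])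
  have "ip (MV G) w y = acoef * mass x y + (- alpha C) * dvg u y"
    unfolding mass_def dvg_def w_def by (rule ip_lincomb_left[OF L_sqint(1)[OF x] L_sqint(3)[OF u] L_sqint(1)[OF y]])
  then have wy: "acoef * mass x y - alpha C * dvg u y = ip (MV G) y w" by (simp add: ip_commute)
  have "2 * ip (MV G) y w \<le> acoef * mass y y + ip (MV G) w w / acoef"
    unfolding mass_def using acoef_pos by (intro ip_young L_sqint(1)[OF y] w)
  also have "ip (MV G) w w = acoef\<^sup>2 * mass x x + 2 * acoef * (- alpha C) * dvg u x
      + (- alpha C)\<^sup>2 * ip (MV G) (divergence u) (divergence u)"
    unfolding mass_def dvg_def ip_commute[of _ "divergence u" x] w_def
    by (rule ip_self_lincomb[OF L_sqint(1)[OF x] L_sqint(3)[OF u]])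
  also have "\<dots> / acoef = acoef * mass x x - 2 * (alpha C * dvg u x) + K_dr C * ip (MV G) (divergence u) (divergence u)"
    using pos(1,9) by (simp add: acoef_def field_simps power2_eq_square)
  finally have 0: "2 * ip (MV G) y w \<le> acoef * mass y y +
      (acoef * mass x x - 2 * (alpha C * dvg u x) + K_dr C * ip (MV G) (divergence u) (divergence u))" .
  have 1: "2 * (acoef * mass x y - alpha C * dvg u y) \<le> acoef * mass y y + acoef * mass x x - el u u"
  proof -
    have "2 * W \<le> Y + X - E" if "2 * V \<le> Y + (X - 2 * F + K)" "K \<le> E" "E = F" "W = V" for E F K V W X Y :: real
      using that by linarith
    from this[OF 0 K_dr_div_le[OF u] mech_energy(2)[OF m] wy] show ?thesis .
  qed
  have "(invM C + acoef) * mass y y + dt C * flow y r y = acoef * mass x y - alpha C * dvg u y"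
    using st y by (simp add: fstep_def)
  moreover have "dt C * (KD C * stiff y y) \<le> dt C * flow y r y"
    using flow_self_ge[of y r] st y pos(6) by (intro mult_left_mono) (auto simp: fstep_def)
  ultimately show ?thesis using 1 by (simp add: algebra_simps)
qed

text \<open>Rewriting \<open>alpha C * dvg u y\<close> as \<open>el u u\<close> minus its value on
  \<open>x - y\<close> leaves only the increment to be bounded. Polarization of
  \<open>mass x y\<close> then turns the resulting inequality into a loss of norm.\<close>

lemma increment_estimate:
  assumes m: "mech x u" and st: "fstep x u y r" and x: "x \<in> V_f G" and y: "y \<in> V_f G"
  shows "mass (x - y) (x - y) \<le> 2 * (mass x x - mass y y)"
proof -
  note u = mech_energy(1)[OF m]
  let ?d = "x - y"
  have d: "?d \<in> V_f G" using x y subspace_diff[OF subspace_V_f] by auto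
  have dd: "?d = 1 *\<^sub>R x + (-1) *\<^sub>R y" by simp
  have mdd: "mass ?d ?d = mass x x - 2 * mass x y + mass y y"
    unfolding dd mass_def using ip_self_lincomb[OF L_sqint(1)[OF x] L_sqint(1)[OF y], of 1 "-1"]
    by (simp add: lincomb_fun_eq[symmetric] fun_diff_def scaleR_fun_def plus_fun_def)
  have dud: "dvg u ?d = dvg u x - dvg u y"
    unfolding dd using dvg_lin(2)[OF u u x y, of 1 "-1"] by simp
  have nn: "0 \<le> invM C * mass y y" "0 \<le> dt C * (KD C * stiff y y)"
    using pos by (auto simp: mass_def stiff_def ip_self_nonneg)
  \<comment> \<open>Twice the weight of \<open>mech_estimate\<close> spends the whole elastic energy
    and leaves only a quarter of \<open>acoef\<close> on the increment, less than the half that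
    polarization provides.\<close>
  have "2 * dvg u ?d \<le> (2 * K_dr C / alpha C) * ip (MV G) (divergence u) (divergence u) + mass ?d ?d / (2 * K_dr C / alpha C)"
    unfolding dvg_def mass_def using pos by (intro ip_young L_sqint(3)[OF u] L_sqint(1)[OF d]) auto
  then have "alpha C * (2 * dvg u ?d) \<le> alpha C * ((2 * K_dr C / alpha C) * ip (MV G) (divergence u) (divergence u) + mass ?d ?d / (2 * K_dr C / alpha C))"
    using pos(1) by (intro mult_left_mono) auto
  also have "\<dots> = 2 * (K_dr C * ip (MV G) (divergence u) (divergence u)) + acoef / 2 * mass ?d ?d"
    using pos(1,9) by (simp add: acoef_def field_simps power2_eq_square)
  finally have cross: "alpha C * dvg u ?d \<le> el u u + acoef / 4 * mass ?d ?d"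
    using K_dr_div_le[OF u] by simp
  have "(invM C + acoef) * mass y y + dt C * flow y r y = acoef * mass x y - alpha C * dvg u y"
    using st y by (simp add: fstep_def)
  moreover have "dt C * (KD C * stiff y y) \<le> dt C * flow y r y"
    using flow_self_ge[of y r] st y pos(6) by (intro mult_left_mono) (auto simp: fstep_def)
  ultimately have "acoef * mass y y \<le> acoef * mass x y - alpha C * dvg u y"
    using nn by (simp add: algebra_simps)
  also have "alpha C * dvg u y = el u u - alpha C * dvg u ?d"
    unfolding dud using mech_energy(2)[OF m] by (simp add: algebra_simps)
  finally have "acoef * mass y y \<le> acoef * mass x y + acoef / 4 * mass ?d ?d"
    using cross by linarith
  then have "acoef * mass y y \<le> acoef * (mass x y + mass ?d ?d / 4)" by (simp add: distrib_left)
  then have A: "mass y y \<le> mass x y + mass ?d ?d / 4"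
    using acoef_pos by (simp only: mult_le_cancel_left_pos)
  then show ?thesis unfolding mdd by (simp add: field_simps)
qed

end

section \<open>Contraction of the pressure errors and convergence\<close>

lemma psd_on_vimage:
  assumes "psd_on S d" "linear f" "\<And>z. z \<in> R \<Longrightarrow> f z \<in> S"
  shows "psd_on R (\<lambda>x y. d (f x) (f y))"
  unfolding psd_on_def
proof (intro conjI ballI allI)
  show "d (f x) (f y) = d (f y) (f x)" if "x \<in> R" "y \<in> R" for x y
    using assms that by (intro psd_on_commute[OF assms(1)]) auto
  show "0 \<le> d (f x) (f x)" if "x \<in> R" for x
    using psd_on_nonneg[OF assms(1) assms(3)[OF that]] .
  show "d (f (a *\<^sub>R x + b *\<^sub>R y)) (f z) = a * d (f x) (f z) + b * d (f y) (f z)"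
    if "x \<in> R" "y \<in> R" "z \<in> R" for a b x y z
    using psd_on_lincomb[OF assms(1) assms(3)[OF that(1)] assms(3)[OF that(2)] assms(3)[OF that(3)]]
    by (simp add: linear_add[OF assms(2)] linear_scale[OF assms(2)])
qed

lemma tendsto_0_if_square_le:
  fixes f N :: "nat \<Rightarrow> real"
  assumes "N \<longlonglongrightarrow> 0" "\<And>i. 0 \<le> f i" "eventually (\<lambda>i. (f i)\<^sup>2 \<le> c * N i) sequentially"
  shows "f \<longlonglongrightarrow> 0"
proof -
  have "(\<lambda>i. sqrt (c * N i)) \<longlonglongrightarrow> sqrt (c * 0)"
    using assms(1) by (intro tendsto_real_sqrt tendsto_mult tendsto_const)
  then have lim: "(\<lambda>i. sqrt (c * N i)) \<longlonglongrightarrow> 0" by simp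
  have ev: "eventually (\<lambda>i. f i \<le> sqrt (c * N i)) sequentially"
    using assms(3) by eventually_elim (rule real_le_rsqrt)
  show ?thesis
    by (rule tendsto_sandwich[OF _ ev tendsto_const lim]) (simp add: assms(2))
qed

context poroelastic
begin

lemma psd_mass: "psd_on (V_f G) mass"
  using L2lin_psd[OF L_id subspace_V_f] by (simp add: mass_def[abs_def])

lemma mass_nonneg: "0 \<le> mass p p"
  by (simp add: mass_def ip_self_nonneg)

lemma vol_norm_nonneg: "0 \<le> vol_norm G f"
  unfolding vol_norm_def vol_int_eq by simp

lemma surf_norm_nonneg: "j \<in> fractures G \<Longrightarrow> 0 \<le> surf_norm G j f"
  unfolding surf_norm_def by (simp add: surf_int_eq)

lemma trf_nonneg: "0 \<le> trf j p p"
  by (simp add: trf_def ip_self_nonneg)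

text \<open>The fracture pressure error is controlled by traces only, while the contraction concerns
  the L2 norm over the domain. In the finite-dimensional space the former are bounded by the latter,
  as \<open>tr_zero\<close> says that L2-null functions have null traces.\<close>

lemma trace_inequality:
  assumes j: "j \<in> fractures G"
  obtains c where "c \<ge> 0" "\<And>p. p \<in> V_f G \<Longrightarrow> trf j p p \<le> c * mass p p"
proof -
  obtain B where B: "finite B" "V_f G \<subseteq> span B" by (rule V_f_finite_dim)
  have "psd_on (V_f G) (trf j)"
    using psd_on_add[OF L2lin_psd[OF L_T[OF j s_mem(1)] subspace_V_f] L2lin_psd[OF L_T[OF j s_mem(2)] subspace_V_f]]
    by (simp add: trf_def[abs_def])
  moreover have "trf j p p = 0" if p: "p \<in> V_f G" "mass p p = 0" for p
  proof -
    have "ip (MS G j) (T j s p) (T j s p) = 0" if s: "s \<in> {-1, 1}" for s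
      unfolding ip_def
    proof (rule integral_eq_zero_AE)
      show "AE \<xi> in MS G j. T j s p \<xi> \<bullet> T j s p \<xi> = 0"
        using tr_zero[OF V_f_W[OF p(1)] p(2)[unfolded mass_def] j s]
        by eventually_elim (simp add: T_def)
    qed
    then show ?thesis by (simp add: trf_def)
  qed
  ultimately show ?thesis
    using that by (rule psd_dominated[OF subspace_V_f B psd_mass])
qed

text \<open>Pairs of successive pressure errors. If the two components agree, the pair solves the
  homogeneous coupled problem.\<close>

definition step_pairs :: "((R3 \<Rightarrow> real) \<times> (R3 \<Rightarrow> real)) set" where
  "step_pairs = {(x, y). x \<in> V_f G \<and> y \<in> V_f G \<and> (\<exists>u r. mech x u \<and> fstep x u y r)}"

lemma step_pairs_lincomb:
  assumes "z \<in> step_pairs" "z' \<in> step_pairs"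
  shows "a *\<^sub>R z + b *\<^sub>R z' \<in> step_pairs"
proof -
  obtain x y u r where z: "z = (x, y)" "x \<in> V_f G" "y \<in> V_f G" "mech x u" "fstep x u y r"
    using assms(1) by (auto simp: step_pairs_def)
  obtain x' y' u' r' where z': "z' = (x', y')" "x' \<in> V_f G" "y' \<in> V_f G" "mech x' u'" "fstep x' u' y' r'"
    using assms(2) by (auto simp: step_pairs_def)
  have "a *\<^sub>R x + b *\<^sub>R x' \<in> V_f G" "a *\<^sub>R y + b *\<^sub>R y' \<in> V_f G"
    using z z' by (intro subspace_lincomb_mem subspace_V_f; simp)+
  moreover have "mech (a *\<^sub>R x + b *\<^sub>R x') (a *\<^sub>R u + b *\<^sub>R u')"
    using z z' by (intro mech_lincomb)
  moreover have "fstep (a *\<^sub>R x + b *\<^sub>R x') (a *\<^sub>R u + b *\<^sub>R u') (a *\<^sub>R y + b *\<^sub>R y') (\<lambda>j. a *\<^sub>R r j + b *\<^sub>R r' j)"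
    using z z' mech_energy(1)[OF z(4)] mech_energy(1)[OF z'(4)] by (intro fstep_lincomb)
  ultimately show ?thesis unfolding z(1) z'(1) by (auto simp: step_pairs_def)
qed

lemma subspace_step_pairs:
  assumes "step_pairs \<noteq> {}"
  shows "subspace step_pairs"
proof -
  obtain z where z: "z \<in> step_pairs" using assms by auto
  show ?thesis
  proof (rule subspaceI)
    show "0 \<in> step_pairs" using step_pairs_lincomb[OF z z, of 0 0] by simp
    show "x + y \<in> step_pairs" if "x \<in> step_pairs" "y \<in> step_pairs" for x y
      using step_pairs_lincomb[OF that, of 1 1] by simp
    show "c *\<^sub>R x \<in> step_pairs" if "x \<in> step_pairs" for c x
      using step_pairs_lincomb[OF that that, of c 0] by simp
  qed
qed

lemma step_pairs_finite_dim:
  obtains B where "finite B" "step_pairs \<subseteq> span B"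
proof -
  obtain B where B: "finite B" "V_f G \<subseteq> span B" by (rule V_f_finite_dim)
  let ?l = "\<lambda>b. (b, 0) :: (R3 \<Rightarrow> real) \<times> (R3 \<Rightarrow> real)" and ?r = "\<lambda>b. (0, b) :: (R3 \<Rightarrow> real) \<times> (R3 \<Rightarrow> real)"
  have lin: "linear ?l" "linear ?r" by (rule linearI; simp)+
  have "(x, y) \<in> span (?l ` B \<union> ?r ` B)" if "x \<in> V_f G" "y \<in> V_f G" for x y
  proof -
    have "?l x \<in> span (?l ` B)" "?r y \<in> span (?r ` B)"
      using that B(2) by (auto simp: linear_span_image[OF lin(1)] linear_span_image[OF lin(2)])
    then have "?l x \<in> span (?l ` B \<union> ?r ` B)" "?r y \<in> span (?l ` B \<union> ?r ` B)"
      using span_mono[of "?l ` B" "?l ` B \<union> ?r ` B"] span_mono[of "?r ` B" "?l ` B \<union> ?r ` B"] by auto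
    then have "?l x + ?r y \<in> span (?l ` B \<union> ?r ` B)" by (rule span_add)
    then show ?thesis by simp
  qed
  then show ?thesis using B(1) by (intro that[of "?l ` B \<union> ?r ` B"]) (auto simp: step_pairs_def)
qed

text \<open>Uniqueness is assumed for the given data, not for zero data; so the homogeneous solution
  is added to the given solution to obtain a competitor.\<close>

lemma step_pairs_kernel:
  assumes sol: "BE_solution G C g up pp uk pk rk \<Lambda>k" and uniq: "BE_pressure_unique G C g up pp"
    and xy: "(x, y) \<in> step_pairs" and 0: "mass (x - y) (x - y) = 0"
  shows "mass x x = 0"
proof -
  obtain u r where x: "x \<in> V_f G" and y: "y \<in> V_f G" and m: "mech x u" and st: "fstep x u y r"
    using xy by (auto simp: step_pairs_def)
  have d: "x - y \<in> V_f G" using x y by (rule subspace_diff[OF subspace_V_f])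
  have u: "u \<in> V_m G" using mech_energy(1)[OF m] .
  have dec: "x - y = 1 *\<^sub>R x + (-1) *\<^sub>R y" by simp
  have dvg_eq: "dvg v x = dvg v y" if v: "v \<in> V_m G" for v
  proof -
    have "dvg v (x - y) = 0"
      unfolding dvg_def by (rule ip_zero_right[OF L_sqint(3)[OF v] L_sqint(1)[OF d] 0[unfolded mass_def]])
    then show ?thesis unfolding dec using dvg_lin(2)[OF v v x y, of 1 "-1"] by simp
  qed
  have mass_eq: "mass q x = mass q y" if q: "q \<in> V_f G" for q
  proof -
    have "mass q (x - y) = 0"
      unfolding mass_def by (rule ip_zero_right[OF L_sqint(1)[OF q] L_sqint(1)[OF d] 0[unfolded mass_def]])
    then show ?thesis unfolding dec using mass_lin(2)[OF x y q, of 1 "-1"] by simp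
  qed
  have comm: "mass p q = mass q p" for p q by (simp add: mass_def ip_commute)
  \<comment> \<open>\<open>x\<close> and \<open>y\<close> agree only up to a null function, which
    the load of the mechanics equation cannot see.\<close>
  have my: "mech y u"
    using m unfolding mech_def by (simp add: dvg_eq)
  have fy: "ffrac y r" using st by (simp add: fstep_def)
  note k = BE_imp[OF sol]
  let ?p = "1 *\<^sub>R pk + 1 *\<^sub>R y" and ?u = "1 *\<^sub>R uk + 1 *\<^sub>R u" and ?r = "\<lambda>j. 1 *\<^sub>R rk j + 1 *\<^sub>R r j"
  obtain \<Lambda> where sol': "BE_solution G C g up pp ?u ?p
      ?r \<Lambda>"
  proof (rule BE_intro)
    show "?u \<in> V_m G" using k(1) u by (intro subspace_lincomb_mem subspace_V_m)
    show "?p \<in> V_f G" using k(2) y by (intro subspace_lincomb_mem subspace_V_f)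
    show "mech ?p ?u" by (rule mech_lincomb[OF k(3) my k(2) y])
    show "ffrac ?p ?r" by (rule ffrac_lincomb[OF k(4) fy k(2) y])
    fix q assume q: "q \<in> V_f G"
    have fl: "flow ?p ?r q = 1 * flow pk rk q + 1 * flow y r q"
      using k(4) fy by (intro flow_lincomb k(2) y q) (auto simp: ffrac_def)
    \<comment> \<open>Old and new pressure coincide, so the stabilization terms with
      \<open>acoef\<close> cancel and the coupled equation remains.\<close>
    have "(invM C + acoef) * mass y q + dt C * flow y r q = acoef * mass y q - alpha C * dvg u q"
      using st q mass_eq[OF q] by (simp add: fstep_def comm)
    then have "dt C * flow y r q = - (invM C * mass y q + alpha C * dvg u q)" by (simp add: algebra_simps)
    then have "1 / dt C * (invM C * mass y q + alpha C * dvg u q) + flow y r q = 0"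
      using pos(6) by (simp add: field_simps)
    then show "1 / dt C * (invM C * mass ?p q + alpha C * dvg ?u q) +
        flow ?p ?r q =
       load g up pp q"
      unfolding fl mass_lin(1)[OF k(2) y q] dvg_lin(1)[OF k(1) u q q] k(5)[OF q, symmetric]
      by (simp add: algebra_simps)
  qed
  have "vol_norm G (\<lambda>z. ?p z - pk z) = 0"
    using uniq[unfolded BE_pressure_unique_def, rule_format, OF conjI[OF sol sol']] .
  then have "mass y y = 0" by (simp add: mass_self)
  then show ?thesis using mass_eq[OF x] mass_eq[OF y] comm[of x y] by simp
qed

lemma step_contraction_unique:
  assumes sol: "BE_solution G C g up pp uk pk rk \<Lambda>k" and uniq: "BE_pressure_unique G C g up pp"
  obtains r where "0 \<le> r" "r < 1"
    "\<And>x u y rr. x \<in> V_f G \<Longrightarrow> y \<in> V_f G \<Longrightarrow> mech x u \<Longrightarrow> fstep x u y rr \<Longrightarrow> mass y y \<le> r * mass x x"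
proof -
  have "\<exists>c\<ge>0. \<forall>z\<in>step_pairs. mass (fst z) (fst z) \<le> c * mass (fst z - snd z) (fst z - snd z)"
  proof (cases "step_pairs = {}")
    case False
    obtain B where B: "finite B" "step_pairs \<subseteq> span B" by (rule step_pairs_finite_dim)
    have lin: "linear (\<lambda>z :: (R3 \<Rightarrow> real) \<times> (R3 \<Rightarrow> real). fst z - snd z)"
      "linear (fst :: (R3 \<Rightarrow> real) \<times> (R3 \<Rightarrow> real) \<Rightarrow> _)"
      by (rule linearI; simp add: algebra_simps)+
    have mem: "fst z \<in> V_f G" "fst z - snd z \<in> V_f G" if "z \<in> step_pairs" for z
      using that subspace_diff[OF subspace_V_f] by (auto simp: step_pairs_def)
    have psd: "psd_on step_pairs (\<lambda>z z'. mass (fst z - snd z) (fst z' - snd z'))"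
      "psd_on step_pairs (\<lambda>z z'. mass (fst z) (fst z'))"
      using psd_on_vimage[OF psd_mass lin(1) mem(2)] psd_on_vimage[OF psd_mass lin(2) mem(1)] by auto
    have ker: "mass (fst z) (fst z) = 0"
      if "z \<in> step_pairs" "mass (fst z - snd z) (fst z - snd z) = 0" for z
      using step_pairs_kernel[OF sol uniq, of "fst z" "snd z"] that by simp
    obtain c where "c \<ge> 0" "\<And>z. z \<in> step_pairs \<Longrightarrow> mass (fst z) (fst z) \<le> c * mass (fst z - snd z) (fst z - snd z)"
      using psd_dominated[OF subspace_step_pairs[OF False] B psd ker] by metis
    then show ?thesis by auto
  qed auto
  then obtain c where c: "c \<ge> 0"
    "\<And>z. z \<in> step_pairs \<Longrightarrow> mass (fst z) (fst z) \<le> c * mass (fst z - snd z) (fst z - snd z)" by auto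
  show ?thesis
  \<comment> \<open>The bound of the old error by \<open>2 * (c + 1)\<close> times its decrease,
    solved for the new error. Replacing \<open>c\<close> by \<open>c + 1\<close> avoids division by
    0.\<close>
  proof (rule that[of "1 - 1 / (2 * (c + 1))"])
    show "0 \<le> 1 - 1 / (2 * (c + 1))" "1 - 1 / (2 * (c + 1)) < 1" using c(1) by (simp_all add: field_simps)
    fix x u y rr assume a: "x \<in> V_f G" "y \<in> V_f G" "mech x u" "fstep x u y rr"
    have inc: "mass (x - y) (x - y) \<le> 2 * (mass x x - mass y y)"
      using a by (intro increment_estimate)
    have "(x, y) \<in> step_pairs" using a by (auto simp: step_pairs_def)
    from c(2)[OF this] have "mass x x \<le> c * mass (x - y) (x - y)" by simp
    also have "\<dots> \<le> (c + 1) * mass (x - y) (x - y)" using mass_nonneg by (intro mult_right_mono) auto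
    also have "\<dots> \<le> (c + 1) * (2 * (mass x x - mass y y))" using inc c(1) by (intro mult_left_mono) auto
    finally show "mass y y \<le> (1 - 1 / (2 * (c + 1))) * mass x x"
      using c(1) by (simp add: field_simps)
  qed
qed

text \<open>The Poincare inequality exchanges the diffusion term of \<open>step_estimate\<close> for
  the pressure norm; the remaining elastic energy is discarded.\<close>

lemma step_estimate_poincare:
  assumes P: "poincare_constant G CP" and m: "mech x u" and st: "fstep x u y r"
    and x: "x \<in> V_f G" and y: "y \<in> V_f G"
  shows "(invM C + acoef / 2 + dt C * KD C / CP) * mass y y \<le> acoef / 2 * mass x x"
proof -
  have CP: "CP > 0" "mass y y \<le> CP * stiff y y"
    using P y by (auto simp: poincare_constant_def mass_self stiff_self)
  have "dt C * KD C / CP * mass y y \<le> dt C * KD C / CP * (CP * stiff y y)"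
    using pos(5,6) CP by (intro mult_left_mono) auto
  also have "\<dots> = dt C * (KD C * stiff y y)" using CP(1) by simp
  finally show ?thesis
    unfolding distrib_right[of _ "dt C * KD C / CP"]
    using step_estimate[OF m st x y] el_nonneg[of u] by linarith
qed

lemma step_contraction_poincare:
  assumes P: "poincare_constant G CP" and "invM C > 0 \<or> KD C > 0"
  obtains r where "0 \<le> r" "r < 1"
    "\<And>x u y rr. x \<in> V_f G \<Longrightarrow> y \<in> V_f G \<Longrightarrow> mech x u \<Longrightarrow> fstep x u y rr \<Longrightarrow> mass y y \<le> r * mass x x"
proof -
  define K where "K = invM C + dt C * KD C / CP"
  have CP: "CP > 0" using P by (simp add: poincare_constant_def)
  have nn: "0 \<le> invM C" "0 \<le> dt C * KD C / CP" using pos CP by auto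
  have "invM C > 0 \<or> dt C * KD C / CP > 0" using assms(2) pos CP by auto
  then have K: "K > 0" using nn unfolding K_def by linarith
  show ?thesis
  proof (rule that[of "(acoef / 2) / (acoef / 2 + K)"])
    show "0 \<le> (acoef / 2) / (acoef / 2 + K)" "(acoef / 2) / (acoef / 2 + K) < 1"
      using K acoef_pos by simp_all
    fix x u y rr assume a: "x \<in> V_f G" "y \<in> V_f G" "mech x u" "fstep x u y rr"
    have le: "(acoef / 2 + K) * mass y y \<le> acoef / 2 * mass x x"
      using step_estimate_poincare[OF P a(3,4,1,2)] by (simp add: K_def add.assoc add.left_commute)
    have "mass y y \<le> (acoef / 2 * mass x x) / (acoef / 2 + K)"
      by (rule mult_imp_le_div_pos) (use K acoef_pos le in \<open>simp_all add: mult.commute[of "mass y y"]\<close>)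
    then show "mass y y \<le> (acoef / 2) / (acoef / 2 + K) * mass x x" by simp
  qed
qed

text \<open>Differences are written as linear combinations with coefficients 1 and -1 to fit the
  closure lemmas. The pressure and mechanics parts start at index 0, with the initial guess, so that
  the first iteration is a step like any other.\<close>

lemma errors:
  assumes k: "k \<ge> 1" and BE: "BE_evolution G C g k u p pF \<Lambda>"
    and FS: "FS_iterates G C (g k) (u (k - 1)) (p (k - 1)) (pF (k - 1)) uit pit pFit \<Lambda>it"
  shows "1 *\<^sub>R pit i + (-1) *\<^sub>R p k \<in> V_f G"
    "mech (1 *\<^sub>R pit i + (-1) *\<^sub>R p k) (1 *\<^sub>R uit i + (-1) *\<^sub>R u k)"
    "fstep (1 *\<^sub>R pit i + (-1) *\<^sub>R p k) (1 *\<^sub>R uit i + (-1) *\<^sub>R u k)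
      (1 *\<^sub>R pit (Suc i) + (-1) *\<^sub>R p k) (\<lambda>j. 1 *\<^sub>R pFit (Suc i) j + (-1) *\<^sub>R pF k j)"
proof -
  let ?e = "\<lambda>i. 1 *\<^sub>R pit i + (-1) *\<^sub>R p k" and ?u = "\<lambda>i. 1 *\<^sub>R uit i + (-1) *\<^sub>R u k"
    and ?r = "\<lambda>i j. 1 *\<^sub>R pFit (Suc i) j + (-1) *\<^sub>R pF k j"
  have bk: "BE_solution G C (g k) (u (k - 1)) (p (k - 1)) (u k) (p k) (pF k) (\<Lambda> k)"
    using BE k by (simp add: BE_evolution_def)
  note b = BE_imp[OF bk]
  have prev: "p (k - 1) \<in> V_f G \<and> mech (p (k - 1)) (u (k - 1))"
  proof (cases "k = 1")
    case True
    then have "p (k - 1) = 0" "u (k - 1) = 0"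
      using BE by (simp_all add: BE_evolution_def zero_fun_def)
    then show ?thesis using mech_zero subspace_0[OF subspace_V_f] by simp
  next
    case False
    then have "k - 1 \<in> {1..k}" using k by auto
    then have "BE_solution G C (g (k - 1)) (u (k - 1 - 1)) (p (k - 1 - 1)) (u (k - 1)) (p (k - 1)) (pF (k - 1)) (\<Lambda> (k - 1))"
      using BE unfolding BE_evolution_def by blast
    from BE_imp(2)[OF this] BE_imp(3)[OF this] show ?thesis by simp
  qed
  have fsf: "FS_flow G C (g k) (u (k - 1)) (p (k - 1)) (uit i) (pit i) (pit (Suc i)) (pFit (Suc i))"
    and fsm: "FS_mech G C (pit (Suc i)) (pFit (Suc i)) (uit (Suc i)) (\<Lambda>it (Suc i))" for i
  proof -
    have "FS_flow G C (g k) (u (k - 1)) (p (k - 1)) (uit (Suc i - 1)) (pit (Suc i - 1)) (pit (Suc i)) (pFit (Suc i)) \<and>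
        FS_mech G C (pit (Suc i)) (pFit (Suc i)) (uit (Suc i)) (\<Lambda>it (Suc i))"
      using FS unfolding FS_iterates_def by (elim conjE) (erule allE[of _ "Suc i"], simp)
    then show "FS_flow G C (g k) (u (k - 1)) (p (k - 1)) (uit i) (pit i) (pit (Suc i)) (pFit (Suc i))"
      "FS_mech G C (pit (Suc i)) (pFit (Suc i)) (uit (Suc i)) (\<Lambda>it (Suc i))" by simp_all
  qed
  have it: "pit i \<in> V_f G \<and> mech (pit i) (uit i)" for i
  proof (cases i)
    case 0
    then show ?thesis using prev FS by (simp add: FS_iterates_def)
  next
    case (Suc n)
    have "pit (Suc n) \<in> V_f G" "\<And>j. j \<in> fractures G \<Longrightarrow> pFit (Suc n) j \<in> V_F G j"
      using fsf[of n] by (auto simp: FS_flow_def)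
    then show ?thesis using FS_mech_imp[OF fsm[of n]] Suc by simp
  qed
  have pi: "pit i \<in> V_f G" and mi: "mech (pit i) (uit i)" and ui: "uit i \<in> V_m G" for i
    using it[of i] mech_energy(1) by auto
  show e: "?e i \<in> V_f G"
    by (rule subspace_lincomb_mem[OF subspace_V_f pi b(2)])
  show "mech (?e i) (?u i)"
    by (rule mech_lincomb[OF mi b(3) pi b(2)])
  note f = FS_flow_imp[OF fsf ui pi]
  show "fstep (?e i) (?u i)
      (?e (Suc i)) (?r i)"
    unfolding fstep_def
  proof (intro conjI ballI)
    show "ffrac (?e (Suc i)) (?r i)"
      by (rule ffrac_lincomb[OF f(2) b(4) pi b(2)])
    fix q assume q: "q \<in> V_f G"
    have fl: "flow (?e (Suc i)) (?r i) q =
        1 * flow (pit (Suc i)) (pFit (Suc i)) q + (-1) * flow (p k) (pF k) q"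
      using f(2)[of i] b(4) by (intro flow_lincomb pi b(2) q) (auto simp: ffrac_def)
    \<comment> \<open>Subtraction cancels the common load \<open>X\<close>; multiplication by the
      time step then clears the denominators.\<close>
    have ar: "A - E + d * (F - H) = S - D"
      if "1 / d * A + F = X - 1 / d * D + 1 / d * S" "1 / d * E + H = X" "d > 0" for A D E F H S X d :: real
    proof -
      have "1 / d * (A - E) + (F - H) = 1 / d * (S - D)" using that(1,2) by (simp add: algebra_simps add_divide_distrib diff_divide_distrib)
      then have "d * (1 / d * (A - E) + (F - H)) = d * (1 / d * (S - D))" by simp
      then show ?thesis using that(3) by (simp add: distrib_left)
    qed
    show "(invM C + acoef) * mass (?e (Suc i)) q +
        dt C * flow (?e (Suc i)) (?r i) q =
        acoef * mass (?e i) q - alpha C * dvg (?u i) q"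
      using ar[OF f(3)[OF q] b(5)[OF q] pos(6)]
      unfolding fl mass_lin(1)[OF pi b(2) q] dvg_lin(1)[OF ui b(1) q q]
      by (simp add: algebra_simps)
  qed
qed

end

theorem theorem1:
  fixes G :: fractured_domain and C :: poro_coeffs
    and g :: "nat \<Rightarrow> R3 \<Rightarrow> real" and k :: nat
    and u :: "nat \<Rightarrow> R3 \<Rightarrow> R3" and p :: "nat \<Rightarrow> R3 \<Rightarrow> real"
    and pF :: "nat \<Rightarrow> nat \<Rightarrow> R3 \<Rightarrow> real" and \<Lambda> :: "nat \<Rightarrow> nat \<Rightarrow> R3 \<Rightarrow> R3"
    and uit :: "nat \<Rightarrow> R3 \<Rightarrow> R3" and pit :: "nat \<Rightarrow> R3 \<Rightarrow> real"
    and pFit :: "nat \<Rightarrow> nat \<Rightarrow> R3 \<Rightarrow> real" and \<Lambda>it :: "nat \<Rightarrow> nat \<Rightarrow> R3 \<Rightarrow> R3"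
    and eu :: "nat \<Rightarrow> R3 \<Rightarrow> R3" and ep :: "nat \<Rightarrow> R3 \<Rightarrow> real"
    and eF :: "nat \<Rightarrow> nat \<Rightarrow> R3 \<Rightarrow> real"
    and CP \<delta>F :: real
  assumes "admissible G" and "admissible_coeffs G C" and "poincare_constant G CP"
    and "k \<ge> 1"
    and "BE_evolution G C g k u p pF \<Lambda>"
    and "FS_iterates G C (g k) (u (k - 1)) (p (k - 1)) (pF (k - 1)) uit pit pFit \<Lambda>it"
    and "\<And>i. eu i = (\<lambda>x. uit i x - u k x)"
    and "\<And>i. ep i = (\<lambda>x. pit i x - p k x)"
    and "\<And>i j. eF i j = (\<lambda>x. pFit i j x - pF k j x)"
    and "0 < \<delta>F" and "\<delta>F \<le> 1"
  shows "(\<forall>i\<ge>1.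
      2 * mu C * (vol_norm G (strain (eu i)))\<^sup>2 + lam C * (vol_norm G (divergence (eu i)))\<^sup>2
        \<le> (alpha C)\<^sup>2 / K_dr C * (vol_norm G (ep i))\<^sup>2 \<and>
      (\<forall>j\<in>fractures G.
        KF C j * (surf_norm G j (tan_grad G j (eF i j)))\<^sup>2 + 2 * eta C j * (surf_norm G j (eF i j))\<^sup>2
          \<le> eta C j / \<delta>F *
             surf_int G j (\<lambda>x. (trace_pos G j (ep i) x)\<^sup>2 + (trace_neg G j (ep i) x)\<^sup>2)) \<and>
      (invM C + (alpha C)\<^sup>2 / (2 * K_dr C) + dt C * KD C / CP) * (vol_norm G (ep i))\<^sup>2
        \<le> (alpha C)\<^sup>2 / (2 * K_dr C) * (vol_norm G (ep (i - 1)))\<^sup>2)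
    \<and> (invM C > 0 \<or> KD C > 0 \<or> BE_pressure_unique G C (g k) (u (k - 1)) (p (k - 1)) \<longrightarrow>
      (\<lambda>i. vol_norm G (ep i)) \<longlonglongrightarrow> 0
      \<and> (\<lambda>i. vol_norm G (strain (eu i))) \<longlonglongrightarrow> 0
      \<and> (\<lambda>i. vol_norm G (divergence (eu i))) \<longlonglongrightarrow> 0
      \<and> (\<forall>j\<in>fractures G. (\<lambda>i. surf_norm G j (eF i j)) \<longlonglongrightarrow> 0))"
proof -
  interpret poroelastic G C
    using assms(1,2) by unfold_locales
  have ep: "ep i = 1 *\<^sub>R pit i + (-1) *\<^sub>R p k" and eu: "eu i = 1 *\<^sub>R uit i + (-1) *\<^sub>R u k" for i
    by (simp_all add: assms(7,8) fun_eq_iff)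
  have eF: "eF i = (\<lambda>j. 1 *\<^sub>R pFit i j + (-1) *\<^sub>R pF k j)" for i
    by (simp add: assms(9) fun_eq_iff)
  note err = errors[OF assms(4,5,6), folded ep eu eF]
  have frac: "ffrac (ep (Suc i)) (eF (Suc i))" for i
    using err(3)[of i] by (simp add: fstep_def)
  have ac: "(alpha C)\<^sup>2 / (2 * K_dr C) = acoef / 2" by (simp add: acoef_def)
  have mech: "2 * mu C * (vol_norm G (strain (eu i)))\<^sup>2 + lam C * (vol_norm G (divergence (eu i)))\<^sup>2
      \<le> acoef * (vol_norm G (ep i))\<^sup>2" for i
    using mech_estimate[OF err(2)[of i] err(1)[of i]] unfolding el_self mass_self by linarith
  have est: "KF C j * (surf_norm G j (tan_grad G j (eF (Suc i) j)))\<^sup>2 + 2 * eta C j * (surf_norm G j (eF (Suc i) j))\<^sup>2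
      \<le> eta C j / \<delta>F * surf_int G j (\<lambda>x. (trace_pos G j (ep (Suc i)) x)\<^sup>2 + (trace_neg G j (ep (Suc i)) x)\<^sup>2)"
    if j: "j \<in> fractures G" for i j
  proof -
    have "frm j (eF (Suc i) j) (eF (Suc i) j) \<le> eta C j * trf j (ep (Suc i)) (ep (Suc i))"
      by (rule ffrac_estimate(1)[OF frac err(1) j])
    \<comment> \<open>Dividing by \<delta>F, which is at most 1, only enlarges the bound. The value
      1 is sharp: for \<open>KF C j = 0\<close> and equal traces that form a nonzero function of
      \<open>V_F\<close>, both sides agree at \<delta>F = 1, and a larger \<delta>F would violate
      the inequality.\<close>
    also have "\<dots> \<le> eta C j / \<delta>F * trf j (ep (Suc i)) (ep (Suc i))"
      using pos(7)[OF j] assms(10,11) trf_nonneg by (intro mult_right_mono) (auto simp: field_simps)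
    finally show ?thesis unfolding frm_self[OF j] trf_self[OF j err(1)] .
  qed
  have contr: "(invM C + acoef / 2 + dt C * KD C / CP) * (vol_norm G (ep (Suc i)))\<^sup>2
      \<le> acoef / 2 * (vol_norm G (ep i))\<^sup>2" for i
    using step_estimate_poincare[OF assms(3) err(2) err(3) err(1) err(1)] by (simp add: mass_self)
  have lims: "(\<lambda>i. vol_norm G (ep i)) \<longlonglongrightarrow> 0
      \<and> (\<lambda>i. vol_norm G (strain (eu i))) \<longlonglongrightarrow> 0
      \<and> (\<lambda>i. vol_norm G (divergence (eu i))) \<longlonglongrightarrow> 0
      \<and> (\<forall>j\<in>fractures G. (\<lambda>i. surf_norm G j (eF i j)) \<longlonglongrightarrow> 0)"
    if or: "invM C > 0 \<or> KD C > 0 \<or> BE_pressure_unique G C (g k) (u (k - 1)) (p (k - 1))"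
  proof -
    obtain r where r: "0 \<le> r" "r < 1"
      "\<And>x u y rr. x \<in> V_f G \<Longrightarrow> y \<in> V_f G \<Longrightarrow> mech x u \<Longrightarrow> fstep x u y rr \<Longrightarrow> mass y y \<le> r * mass x x"
    proof (cases "invM C > 0 \<or> KD C > 0")
      case True
      show ?thesis by (rule step_contraction_poincare[OF assms(3) True that])
    next
      case False
      then have uniq: "BE_pressure_unique G C (g k) (u (k - 1)) (p (k - 1))" using or by blast
      have sol: "BE_solution G C (g k) (u (k - 1)) (p (k - 1)) (u k) (p k) (pF k) (\<Lambda> k)"
        using assms(4,5) by (simp add: BE_evolution_def)
      show ?thesis by (rule step_contraction_unique[OF sol uniq that])
    qed
    define N where "N = (\<lambda>i. mass (ep i) (ep i))"
    have N: "N \<longlonglongrightarrow> 0"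
    proof (rule nonneg_contraction_tendsto_0[OF r(1,2)])
      show "0 \<le> N i" for i unfolding N_def by (rule mass_nonneg)
      show "N (Suc i) \<le> r * N i" for i
        unfolding N_def by (rule r(3)[OF err(1) err(1) err(2) err(3)])
    qed
    have "(\<lambda>i. vol_norm G (ep i)) \<longlonglongrightarrow> 0"
      by (rule tendsto_0_if_square_le[OF N vol_norm_nonneg, where c=1]) (simp add: N_def mass_self)
    moreover have "(\<lambda>i. vol_norm G (strain (eu i))) \<longlonglongrightarrow> 0"
    proof (rule tendsto_0_if_square_le[OF N vol_norm_nonneg, where c="acoef / (2 * mu C)"], intro always_eventually allI)
      fix i
      have "0 \<le> lam C * (vol_norm G (divergence (eu i)))\<^sup>2" using pos(2) by simp
      then have "2 * mu C * (vol_norm G (strain (eu i)))\<^sup>2 \<le> acoef * N i"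
        using mech[of i] by (simp add: N_def mass_self)
      then show "(vol_norm G (strain (eu i)))\<^sup>2 \<le> acoef / (2 * mu C) * N i"
        using pos(3) by (simp add: field_simps)
    qed
    moreover have "(\<lambda>i. vol_norm G (divergence (eu i))) \<longlonglongrightarrow> 0"
    proof (rule tendsto_0_if_square_le[OF N vol_norm_nonneg, where c="acoef / lam C"], intro always_eventually allI)
      fix i
      have "0 \<le> 2 * mu C * (vol_norm G (strain (eu i)))\<^sup>2" using pos(3) by simp
      then have "lam C * (vol_norm G (divergence (eu i)))\<^sup>2 \<le> acoef * N i"
        using mech[of i] by (simp add: N_def mass_self)
      then show "(vol_norm G (divergence (eu i)))\<^sup>2 \<le> acoef / lam C * N i"
        using pos(2) by (simp add: field_simps)
    qed
    moreover have "(\<lambda>i. surf_norm G j (eF i j)) \<longlonglongrightarrow> 0" if j: "j \<in> fractures G" for j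
    proof -
      obtain c where c: "\<And>p. p \<in> V_f G \<Longrightarrow> trf j p p \<le> c * mass p p"
        using trace_inequality[OF j] by metis
      \<comment> \<open>Shifted by one, because \<open>frac\<close> provides the fracture equation
        for the errors from the first iterate on, not for the initial guess; the limit does not see
        the shift.\<close>
      have "(surf_norm G j (eF (Suc i) j))\<^sup>2 \<le> c / 2 * N (Suc i)" for i
      proof -
        have "eta C j * (2 * (surf_norm G j (eF (Suc i) j))\<^sup>2) \<le> eta C j * trf j (ep (Suc i)) (ep (Suc i))"
          using ffrac_estimate(3)[OF frac err(1) j] by (simp add: mult.assoc mult.left_commute)
        then have "2 * (surf_norm G j (eF (Suc i) j))\<^sup>2 \<le> trf j (ep (Suc i)) (ep (Suc i))"
          using pos(7)[OF j] by (simp only: mult_le_cancel_left_pos)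
        also have "\<dots> \<le> c * N (Suc i)" unfolding N_def by (rule c[OF err(1)])
        finally show ?thesis by simp
      qed
      then have "eventually (\<lambda>i. (surf_norm G j (eF i j))\<^sup>2 \<le> c / 2 * N i) sequentially"
        using eventually_sequentially_Suc[of "\<lambda>i. (surf_norm G j (eF i j))\<^sup>2 \<le> c / 2 * N i"] by simp
      then show ?thesis by (rule tendsto_0_if_square_le[OF N surf_norm_nonneg[OF j]])
    qed
    ultimately show ?thesis by blast
  qed
  show ?thesis
  proof (intro conjI allI impI ballI)
    fix i :: nat assume "1 \<le> i"
    then obtain n where n: "i = Suc n" by (cases i) auto
    show "2 * mu C * (vol_norm G (strain (eu i)))\<^sup>2 + lam C * (vol_norm G (divergence (eu i)))\<^sup>2
        \<le> (alpha C)\<^sup>2 / K_dr C * (vol_norm G (ep i))\<^sup>2"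
      using mech[of i] by (simp add: acoef_def)
    show "KF C j * (surf_norm G j (tan_grad G j (eF i j)))\<^sup>2 + 2 * eta C j * (surf_norm G j (eF i j))\<^sup>2
        \<le> eta C j / \<delta>F * surf_int G j (\<lambda>x. (trace_pos G j (ep i) x)\<^sup>2 + (trace_neg G j (ep i) x)\<^sup>2)"
      if "j \<in> fractures G" for j
      unfolding n by (rule est[OF that])
    show "(invM C + (alpha C)\<^sup>2 / (2 * K_dr C) + dt C * KD C / CP) * (vol_norm G (ep i))\<^sup>2
        \<le> (alpha C)\<^sup>2 / (2 * K_dr C) * (vol_norm G (ep (i - 1)))\<^sup>2"
      unfolding n ac using contr[of n] by simp
  qed (use lims in blast)+
qed

end
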